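(* Let $(Z,d)$ be a complete separable metric space and let $\mu\in\mathcal P(Z)$ satisfy Talagrand's inequality with constant $a>0$, i.e. for all $\nu_1,\nu_2\in\mathcal P(Z)$, $$\mathcal W_2^2(\nu_1,\nu_2)\le a\,[\mathcal H(\nu_1|\mu)+\mathcal H(\nu_2|\mu)].$$ Then for every $\kappa\in\mathcal P(\mathbb N)$, the law $B_{\mu,\kappa}\in\mathcal P(\mathcal M_b(Z))$ of the mixed binomial process satisfies: for all $\Pi_1,\Pi_2\in\mathcal P(\mathcal M_b(Z))$ with $\mathbb W_2^2(\Pi_1,\Pi_2)<+\infty$, $$\mathbb W_2^2(\Pi_1,\Pi_2)+2a\,\mathcal H(\lambda|\kappa)\le a\,\mathcal H(\Pi_1|B_{\mu,\kappa})+a\,\mathcal H(\Pi_2|B_{\mu,\kappa}),$$ where $\lambda\in\mathcal P(\mathbb R_+)$ is the common law of the total mass under $\Pi_1$ and $\Pi_2$, i.e. $\Pi_i(\{\eta\in\mathcal M_b(Z):\eta(Z)\in A\})=\lambda(A)$ for $i\in\{1,2\}$ and all Borel $A\subset\mathbb R_+$.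
   Context: $\mathcal P(E)$ is the set of Borel probability measures on $E$; $\mathcal M_b(Z)$ is the set of finite Borel measures on $Z$ with the weak topology (test functions: bounded continuous functions), which is Polish. $\mathbb N=\{0,1,2,\dots\}$; $\kappa\in\mathcal P(\mathbb N)$ is also regarded as a probability measure on $\mathbb R_+$. Relative entropy: $\mathcal H(\nu_1|\nu_2)=\int\log\frac{d\nu_1}{d\nu_2}\,d\nu_1$ if $\nu_1\ll\nu_2$, and $+\infty$ otherwise. For $\nu_1,\nu_2\in\mathcal P(Z)$, $\mathcal W_2^2(\nu_1,\nu_2)=\inf\mathbb E[d^2(X_1,X_2)]$, the infimum being over all pairs $(X_1,X_2)$ with $X_1\sim\nu_1$, $X_2\sim\nu_2$. For $\nu_1,\nu_2\in\mathcal M_b(Z)$: $\mathcal W_2^2(\nu_1,\nu_2)=m\,\mathcal W_2^2(\nu_1/m,\nu_2/m)$ if $\nu_1(Z)=\nu_2(Z)=m>0$; $=0$ if $\nu_1(Z)=\nu_2(Z)=0$; $=+\infty$ if $\nu_1(Z)\ne\nu_2(Z)$. For $\Pi_1,\Pi_2\in\mathcal P(\mathcal M_b(Z))$, $\mathbb W_2^2(\Pi_1,\Pi_2)=\inf\mathbb E[\mathcal W_2^2(\eta_1,\eta_2)]$, the infimum being over all pairs of random measures with $\eta_1\sim\Pi_1$, $\eta_2\sim\Pi_2$. If this is finite, there is a coupling with $\eta_1(Z)=\eta_2(Z)$ a.s., so the law $\lambda$ of the total mass is the same under $\Pi_1$ and $\Pi_2$. Mixed binomial process: $B_{\mu,\kappa}$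 is the law of $\eta=\sum_{i=1}^N\delta_{X_i}$, where $(X_i)_{i\ge1}$ are i.i.d. with law $\mu$, $N\sim\kappa$ is $\mathbb N$-valued and independent of $(X_i)$ (an empty sum is the zero measure). *)

theory Defs
  imports "HOL-Probability.Probability"
begin

text \<open>
  A complete separable metric space is a type of class \<open>polish_space\<close> with the metric \<open>dist\<close>, and
  \<open>\<P>(E)\<close> is \<open>space (prob_algebra E)\<close>: the probability measures on the sigma-algebra of \<open>E\<close>.
\<close>

definition finite_borel_measures :: "'z::topological_space measure set" where
  "finite_borel_measures = {\<eta>. sets \<eta> = sets borel \<and> finite_measure \<eta>}"

definition weak_topology :: "'z::topological_space measure topology" where
  "weak_topology = topology_generated_by
     {{\<eta> \<in> finite_borel_measures. (\<integral>z. f z \<partial>\<eta>) \<in> U} | (f :: 'z \<Rightarrow> real) U.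
        continuous_on UNIV f \<and> bounded (range f) \<and> open U}"

text \<open>The measurable space \<open>\<M>\<^sub>b(Z)\<close>: finite Borel measures with the Borel sets of the weak topology.\<close>

definition borel_weak :: "'z::topological_space measure measure" where
  "borel_weak = sigma finite_borel_measures {U. openin weak_topology U}"

abbreviation borel_nonneg :: "real measure" where
  "borel_nonneg \<equiv> restrict_space borel {0..}"

text \<open>
  For probability measures the negative part of the log-density is always \<open>N\<close>-integrable, so that it
  fails to be integrable only if its integral is \<open>+\<infinity>\<close>.  The reference measure is the second argument
  here, but the first argument of the library constants.
\<close>

definition relative_entropy :: "'a measure \<Rightarrow> 'a measure \<Rightarrow> ereal" where
  "relative_entropy N M =
     (if absolutely_continuous M N \<and> integrable N (entropy_density (exp 1) M N)
      then ereal (KL_divergence (exp 1) M N) else \<infinity>)"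

text \<open>Couplings are the joint laws of pairs of random variables with the prescribed laws.\<close>

definition couplings :: "'a measure \<Rightarrow> 'b measure \<Rightarrow> ('a \<times> 'b) measure set" where
  "couplings M N =
     {\<gamma> \<in> space (prob_algebra (M \<Otimes>\<^sub>M N)). distr \<gamma> M fst = M \<and> distr \<gamma> N snd = N}"

definition transport_cost ::
  "('a \<Rightarrow> 'b \<Rightarrow> ennreal) \<Rightarrow> 'a measure \<Rightarrow> 'b measure \<Rightarrow> ennreal" where
  "transport_cost c M N = (INF \<gamma>\<in>couplings M N. \<integral>\<^sup>+p. c (fst p) (snd p) \<partial>\<gamma>)"

text \<open>The squared distances \<open>\<W>\<^sub>2\<^sup>2\<close> on \<open>\<P>(Z)\<close>, then \<open>\<W>\<^sub>2\<^sup>2\<close> on \<open>\<M>\<^sub>b(Z)\<close>, then the one on \<open>\<P>(\<M>\<^sub>b(Z))\<close>.\<close>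

definition W2_sq :: "'z::metric_space measure \<Rightarrow> 'z measure \<Rightarrow> ennreal" where
  "W2_sq = transport_cost (\<lambda>x y. ennreal ((dist x y)\<^sup>2))"

definition W2_sq_fin :: "'z::metric_space measure \<Rightarrow> 'z measure \<Rightarrow> ennreal" where
  "W2_sq_fin \<eta>\<^sub>1 \<eta>\<^sub>2 =
     (let m = emeasure \<eta>\<^sub>1 UNIV in
      if m \<noteq> emeasure \<eta>\<^sub>2 UNIV then \<infinity>
      else if m = 0 then 0
      else m * W2_sq (scale_measure (1 / m) \<eta>\<^sub>1) (scale_measure (1 / m) \<eta>\<^sub>2))"

definition WW2_sq :: "'z::metric_space measure measure \<Rightarrow> 'z measure measure \<Rightarrow> ennreal" where
  "WW2_sq = transport_cost W2_sq_fin"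

definition talagrand_inequality :: "real \<Rightarrow> 'z::metric_space measure \<Rightarrow> bool" where
  "talagrand_inequality a \<mu> \<longleftrightarrow>
     (\<forall>\<nu>\<^sub>1 \<in> space (prob_algebra borel). \<forall>\<nu>\<^sub>2 \<in> space (prob_algebra borel).
        enn2ereal (W2_sq \<nu>\<^sub>1 \<nu>\<^sub>2)
          \<le> ereal a * (relative_entropy \<nu>\<^sub>1 \<mu> + relative_entropy \<nu>\<^sub>2 \<mu>))"

definition sum_dirac :: "nat \<Rightarrow> (nat \<Rightarrow> 'z::topological_space) \<Rightarrow> 'z measure" where
  "sum_dirac n x = measure_of UNIV (sets borel) (\<lambda>A. \<Sum>i<n. emeasure (return borel (x i)) A)"

definition mixed_binomial ::
  "'z::topological_space measure \<Rightarrow> nat pmf \<Rightarrow> 'z measure measure" where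
  "mixed_binomial \<mu> \<kappa> =
     distr (measure_pmf \<kappa> \<Otimes>\<^sub>M (\<Pi>\<^sub>M i\<in>UNIV. \<mu>)) borel_weak (\<lambda>(n, x). sum_dirac n x)"

text \<open>\<open>\<kappa> \<in> \<P>(\<nat>)\<close> regarded as a probability measure on \<open>\<real>\<^sub>+\<close>.\<close>

definition law_on_nonneg :: "nat pmf \<Rightarrow> real measure" where
  "law_on_nonneg \<kappa> = distr (measure_pmf \<kappa>) borel_nonneg real"

end

theory Submission
  imports Defs
begin

text \<open>
  Given the total mass \<open>n\<close>, a law with a density with respect to the mixed binomial law lifts to a law
  on sequences with a density with respect to the infinite product of \<open>\<mu>\<close>; matching the \<open>i\<close>-th points
  bounds the cost of two point configurations by the squared Euclidean distance of the first \<open>n\<close>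
  coordinates, and the entropies of the lifts add up to the entropy of the law minus that of its total
  mass. It remains to tensorize Talagrand's inequality. Gluing conditional couplings would require a
  measurable selection; instead the inequality is tensorized in its dual form: if
  \<open>u x * v y \<le> exp (d(x, y)\<^sup>2 / a)\<close> for all \<open>x\<close> and \<open>y\<close>, then \<open>(\<integral>u \<partial>\<mu>) * (\<integral>v \<partial>\<mu>) \<le> 1\<close>, which is stable under products by
  Fubini. The way back to couplings is Kantorovich duality, obtained from Farkas' lemma by quantization.
\<close>

text \<open>The factor 2 in front of the entropy of the mass law is the chain rule used twice: each
  entropy against the mixed binomial law is the entropy of the mass law plus the mean of the
  conditional entropies, and both laws have the same mass law. Talagrand's inequality is applied
  only to the conditional part, with a constant that does not grow with \<open>n\<close>. A
  configuration never has to be decoded into points: \<open>\<lambda>x. F (sum_dirac n x)\<close>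
  is, up to normalization, already a density on sequences, and its image under
  \<open>sum_dirac n\<close> is the conditional law. Infinite sequences rather than n-tuples give
  one product space for all \<open>n\<close>, isomorphic to itself with a coordinate prepended.
  Quantization needs finite second moments, which are not assumed of \<open>\<mu>\<close>; they are
  extracted from the dual inequality itself. Couplings are optimal only up to epsilon, and since the
  mass ranges over the naturals, one such coupling per mass can be chosen freely and mixed.\<close>

section \<open>Finite transport duality\<close>

text \<open>A pair \<open>(f, b)\<close> stands for the linear constraint that the sum of the
  \<open>f j * x j\<close> is at most \<open>b\<close>, so the hull consists of the constraints that
  follow from \<open>A\<close> by addition and nonnegative scaling. The inductive form lets
  properties of all consequences be proved by rule induction, without coefficient vectors.\<close>

inductive in_conic_hull :: "(('j \<Rightarrow> real) \<times> real) set \<Rightarrow> ('j \<Rightarrow> real) \<Rightarrow> real \<Rightarrow> bool"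
  for A :: "(('j \<Rightarrow> real) \<times> real) set" where
  base: "(f, b) \<in> A \<Longrightarrow> in_conic_hull A f b"
| add: "in_conic_hull A f b \<Longrightarrow> in_conic_hull A g d \<Longrightarrow> in_conic_hull A (\<lambda>j. f j + g j) (b + d)"
| scale: "in_conic_hull A f b \<Longrightarrow> t \<ge> 0 \<Longrightarrow> in_conic_hull A (\<lambda>j. t * f j) (t * b)"

lemma in_conic_hull_trans:
  assumes "in_conic_hull A' f b" "\<And>f b. (f, b) \<in> A' \<Longrightarrow> in_conic_hull A f b"
  shows "in_conic_hull A f b"
  using assms by induction (auto intro: in_conic_hull.intros)

lemma finite_sets_separated:
  fixes L U :: "real set"
  assumes "finite L" "finite U" "\<And>l u. l \<in> L \<Longrightarrow> u \<in> U \<Longrightarrow> l \<le> u"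
  shows "\<exists>t. (\<forall>l\<in>L. l \<le> t) \<and> (\<forall>u\<in>U. t \<le> u)"
proof (cases "L = {}")
  case True
  then show ?thesis
    using assms(2) bdd_below_finite[of U] by (auto simp: bdd_below_def)
next
  case False
  then show ?thesis
    using assms by (intro exI[of _ "Max L"]) auto
qed

text \<open>Fourier-Motzkin elimination of one coordinate at a time. A constraint with positive
  coefficient at \<open>k\<close> bounds \<open>x k\<close> above, one with negative coefficient
  bounds it below; adding every such pair with weights that cancel \<open>k\<close> says exactly
  that all lower bounds lie under all upper ones. With no coordinate left, each constraint reads
  \<open>0 \<le> b\<close>, which the hypothesis supplies.\<close>

lemma farkas:
  fixes A :: "(('j \<Rightarrow> real) \<times> real) set"
  assumes "finite J" "finite A"
    and "\<And>f b. in_conic_hull A f b \<Longrightarrow> (\<forall>j\<in>J. f j = 0) \<Longrightarrow> b \<ge> 0"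
  shows "\<exists>x. \<forall>(f, b)\<in>A. (\<Sum>j\<in>J. f j * x j) \<le> b"
  using assms
proof (induction J arbitrary: A rule: finite_induct)
  case empty
  then show ?case
    by (auto intro!: in_conic_hull.base)
next
  case (insert k J)
  define N where "N = {p \<in> A. fst p k = 0}"
  define P where "P = {p \<in> A. fst p k > 0}"
  define M where "M = {p \<in> A. fst p k < 0}"
  \<comment> \<open>The weights \<open>- fst q k\<close> and \<open>fst p k\<close> are both
    positive for \<open>p\<close> in \<open>P\<close> and \<open>q\<close> in \<open>M\<close>, so
    \<open>comb p q\<close> stays in the hull and has coefficient 0 at \<open>k\<close>.\<close>
  define comb :: "('j \<Rightarrow> real) \<times> real \<Rightarrow> ('j \<Rightarrow> real) \<times> real \<Rightarrow> ('j \<Rightarrow> real) \<times> real" where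
    "comb p q = ((\<lambda>j. - fst q k * fst p j + fst p k * fst q j), - fst q k * snd p + fst p k * snd q)"
    for p q
  define A' where "A' = N \<union> (\<lambda>(p, q). comb p q) ` (P \<times> M)"
  have fin: "finite N" "finite P" "finite M"
    using insert.prems(1) by (auto simp: N_def P_def M_def)
  have comb_hull: "in_conic_hull A (fst (comb p q)) (snd (comb p q))" if "p \<in> P" "q \<in> M" for p q
  proof -
    obtain f b g d where [simp]: "p = (f, b)" "q = (g, d)"
      by (cases p, cases q) auto
    have "in_conic_hull A f b" "in_conic_hull A g d"
      using that by (auto simp: P_def M_def intro: in_conic_hull.base)
    then have "in_conic_hull A (\<lambda>j. - g k * f j + f k * g j) (- g k * b + f k * d)"
      using that by (intro in_conic_hull.add in_conic_hull.scale) (auto simp: P_def M_def)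
    then show ?thesis
      by (simp add: comb_def)
  qed
  have sub: "in_conic_hull A f b" if "in_conic_hull A' f b" for f b
    using that
  proof (rule in_conic_hull_trans)
    show "in_conic_hull A g d" if "(g, d) \<in> A'" for g d
    proof -
      from that consider "(g, d) \<in> A" | p q where "p \<in> P" "q \<in> M" "(g, d) = comb p q"
        unfolding A'_def N_def by auto
      then show ?thesis
      proof cases
        case 1
        then show ?thesis by (rule in_conic_hull.base)
      next
        case 2
        then show ?thesis using comb_hull by (metis fst_conv snd_conv)
      qed
    qed
  qed
  \<comment> \<open>Coefficients at \<open>k\<close> vanish on the whole hull of \<open>A'\<close>,
    so a consequence that is zero on \<open>J\<close> is zero on \<open>insert k J\<close>, and the
    hypothesis for \<open>A\<close> applies to it.\<close>
  have zero: "f k = 0" if "in_conic_hull A' f b" for f b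
    using that by induction (auto simp: A'_def N_def comb_def)
  have "\<exists>x. \<forall>(f, b)\<in>A'. (\<Sum>j\<in>J. f j * x j) \<le> b"
  proof (rule insert.IH)
    show "finite A'"
      using fin by (auto simp: A'_def)
    show "b \<ge> 0" if "in_conic_hull A' f b" "\<forall>j\<in>J. f j = 0" for f b
      using insert.prems(2)[of f b] that sub zero by auto
  qed
  then obtain x where x: "\<And>f b. (f, b) \<in> A' \<Longrightarrow> (\<Sum>j\<in>J. f j * x j) \<le> b"
    by blast
  \<comment> \<open>\<open>s p\<close> is the bound that the constraint \<open>p\<close> puts on the
    coordinate \<open>k\<close> once the others are fixed to \<open>x\<close>: an upper bound for
    \<open>P\<close>, a lower one for \<open>M\<close>.\<close>
  define s where "s p = (snd p - (\<Sum>j\<in>J. fst p j * x j)) / fst p k" for p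
  have "\<exists>t. (\<forall>l\<in>s ` M. l \<le> t) \<and> (\<forall>u\<in>s ` P. t \<le> u)"
  proof (rule finite_sets_separated)
    fix l u assume "l \<in> s ` M" "u \<in> s ` P"
    then obtain p q where pq: "p \<in> P" "q \<in> M" "u = s p" "l = s q"
      by auto
    have "comb p q \<in> A'"
      using pq by (auto simp: A'_def)
    then have le: "- fst q k * (\<Sum>j\<in>J. fst p j * x j) + fst p k * (\<Sum>j\<in>J. fst q j * x j)
        \<le> - fst q k * snd p + fst p k * snd q"
      using x[of "fst (comb p q)" "snd (comb p q)"]
      by (simp add: comb_def sum_subtractf sum_distrib_left sum_negf mult.assoc left_diff_distrib)
    show "l \<le> u"
    proof -
      have "fst q k < 0" "fst p k > 0"
        using pq by (auto simp: P_def M_def)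
      moreover have "(snd p - (\<Sum>j\<in>J. fst p j * x j)) * fst q k \<le> (snd q - (\<Sum>j\<in>J. fst q j * x j)) * fst p k"
        using le by (simp add: algebra_simps)
      ultimately show ?thesis
        by (simp add: pq s_def neg_divide_le_eq pos_divide_le_eq)
    qed
  qed (use fin in auto)
  then obtain t where t: "\<And>q. q \<in> M \<Longrightarrow> s q \<le> t" "\<And>p. p \<in> P \<Longrightarrow> t \<le> s p"
    by auto
  show ?case
  proof (intro exI[of _ "x(k := t)"], safe)
    fix f b assume fb: "(f, b) \<in> A"
    have eq: "(\<Sum>j\<in>insert k J. f j * (x(k := t)) j) = f k * t + (\<Sum>j\<in>J. f j * x j)"
      using insert.hyps by (auto intro!: sum.cong)
    consider "f k = 0" | "f k > 0" | "f k < 0" by linarith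
    then show "(\<Sum>j\<in>insert k J. f j * (x(k := t)) j) \<le> b"
    proof cases
      case 1
      then show ?thesis
        using x[of f b] fb by (subst eq) (auto simp: A'_def N_def)
    next
      case 2
      then show ?thesis
        using t(2)[of "(f, b)"] fb by (subst eq) (auto simp: P_def s_def field_simps)
    next
      case 3
      then show ?thesis
        using t(1)[of "(f, b)"] fb by (subst eq) (auto simp: M_def s_def field_simps)
    qed
  qed
qed

text \<open>Strong duality for the transport linear program. The primal constraints, cost at most
  \<open>C\<close> included, form a finite system; by Farkas it is solvable unless some nonnegative
  combination of them is contradictory, and such a combination amounts to potentials that violate
  the dual bound.\<close>

lemma transport_duality_finite:
  fixes c :: "'i \<Rightarrow> 'i \<Rightarrow> real" and p q :: "'i \<Rightarrow> real"
  assumes I: "finite I"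
    and p: "\<And>i. i \<in> I \<Longrightarrow> p i \<ge> 0" "sum p I = 1"
    and q: "\<And>i. i \<in> I \<Longrightarrow> q i \<ge> 0" "sum q I = 1"
    and dual: "\<And>\<phi> \<psi>. (\<And>i j. i \<in> I \<Longrightarrow> j \<in> I \<Longrightarrow> \<phi> i + \<psi> j \<le> c i j) \<Longrightarrow>
        (\<Sum>i\<in>I. \<phi> i * p i) + (\<Sum>j\<in>I. \<psi> j * q j) \<le> C"
  obtains g where "\<And>i j. i \<in> I \<Longrightarrow> j \<in> I \<Longrightarrow> g i j \<ge> 0"
    "\<And>i. i \<in> I \<Longrightarrow> (\<Sum>j\<in>I. g i j) = p i" "\<And>j. j \<in> I \<Longrightarrow> (\<Sum>i\<in>I. g i j) = q j"
    "(\<Sum>i\<in>I. \<Sum>j\<in>I. c i j * g i j) \<le> C"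
proof -
  \<comment> \<open>In order: nonnegativity of the plan, row sums equal to \<open>p\<close> and
    column sums equal to \<open>q\<close> as two inequalities each, and the bound on the
    cost.\<close>
  define A :: "(('i \<times> 'i \<Rightarrow> real) \<times> real) set" where
    "A = (\<lambda>k. (\<lambda>j. - of_bool (j = k), 0)) ` (I \<times> I)
       \<union> (\<lambda>i. (\<lambda>j. of_bool (fst j = i), p i)) ` I \<union> (\<lambda>i. (\<lambda>j. - of_bool (fst j = i), - p i)) ` I
       \<union> (\<lambda>i. (\<lambda>j. of_bool (snd j = i), q i)) ` I \<union> (\<lambda>i. (\<lambda>j. - of_bool (snd j = i), - q i)) ` I
       \<union> {(\<lambda>j. c (fst j) (snd j), C)}"
  have d: "(\<Sum>k\<in>I. of_bool (k = i) * r k) = r i" if "i \<in> I" for i and r :: "'i \<Rightarrow> real"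
    using sum.remove[OF I that, of "\<lambda>k. of_bool (k = i) * r k"] by auto
  \<comment> \<open>\<open>\<phi>\<close> and \<open>\<psi>\<close> collect the signed multipliers
    of the row and column constraints, \<open>t\<close> is that of the cost. The sign constraints
    can only lower the coefficients, hence an inequality for \<open>f\<close> but an equation for
    \<open>b\<close>.\<close>
  have hull: "\<exists>\<phi> \<psi> t. t \<ge> 0 \<and> (\<forall>i\<in>I. \<forall>j\<in>I. f (i, j) \<le> \<phi> i + \<psi> j + t * c i j)
      \<and> b = (\<Sum>i\<in>I. \<phi> i * p i) + (\<Sum>j\<in>I. \<psi> j * q j) + t * C"
    (is "?R f b") if "in_conic_hull A f b" for f b
    using that
  proof induction
    case (base f b)
    consider k where "k \<in> I \<times> I" "f = (\<lambda>j. - of_bool (j = k))" "b = 0"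
      | i where "i \<in> I" "f = (\<lambda>j. of_bool (fst j = i))" "b = p i"
      | i where "i \<in> I" "f = (\<lambda>j. - of_bool (fst j = i))" "b = - p i"
      | i where "i \<in> I" "f = (\<lambda>j. of_bool (snd j = i))" "b = q i"
      | i where "i \<in> I" "f = (\<lambda>j. - of_bool (snd j = i))" "b = - q i"
      | "f = (\<lambda>j. c (fst j) (snd j))" "b = C"
      using base unfolding A_def by blast
    then show ?case
    proof cases
      case 1
      show ?thesis
        by (rule exI[of _ "\<lambda>_. 0"], rule exI[of _ "\<lambda>_. 0"], rule exI[of _ 0]) (use 1 in auto)
    next
      case 2
      show ?thesis
        by (rule exI[of _ "\<lambda>k. of_bool (k = i)"], rule exI[of _ "\<lambda>_. 0"], rule exI[of _ 0])
          (use 2 d in simp)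
    next
      case 3
      show ?thesis
        by (rule exI[of _ "\<lambda>k. - of_bool (k = i)"], rule exI[of _ "\<lambda>_. 0"], rule exI[of _ 0])
          (use 3 d in \<open>simp add: sum_negf\<close>)
    next
      case 4
      show ?thesis
        by (rule exI[of _ "\<lambda>_. 0"], rule exI[of _ "\<lambda>k. of_bool (k = i)"], rule exI[of _ 0])
          (use 4 d in simp)
    next
      case 5
      show ?thesis
        by (rule exI[of _ "\<lambda>_. 0"], rule exI[of _ "\<lambda>k. - of_bool (k = i)"], rule exI[of _ 0])
          (use 5 d in \<open>simp add: sum_negf\<close>)
    next
      case 6
      show ?thesis
        by (rule exI[of _ "\<lambda>_. 0"], rule exI[of _ "\<lambda>_. 0"], rule exI[of _ 1]) (use 6 in simp)
    qed
  next
    case (add f b g d)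
    then obtain \<phi> \<psi> t \<phi>' \<psi>' t' where
      1: "t \<ge> 0" "\<forall>i\<in>I. \<forall>j\<in>I. f (i, j) \<le> \<phi> i + \<psi> j + t * c i j"
      "b = (\<Sum>i\<in>I. \<phi> i * p i) + (\<Sum>j\<in>I. \<psi> j * q j) + t * C" and
      2: "t' \<ge> 0" "\<forall>i\<in>I. \<forall>j\<in>I. g (i, j) \<le> \<phi>' i + \<psi>' j + t' * c i j"
      "d = (\<Sum>i\<in>I. \<phi>' i * p i) + (\<Sum>j\<in>I. \<psi>' j * q j) + t' * C"
      by auto
    have "f (i, j) + g (i, j) \<le> \<phi> i + \<phi>' i + (\<psi> j + \<psi>' j) + (t + t') * c i j"
      if "i \<in> I" "j \<in> I" for i j
    proof -
      have "f (i, j) \<le> \<phi> i + \<psi> j + t * c i j" "g (i, j) \<le> \<phi>' i + \<psi>' j + t' * c i j"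
        using 1 2 that by auto
      then show ?thesis by (simp add: distrib_right)
    qed
    then show ?case
      using 1 2
      by (intro exI[of _ "\<lambda>i. \<phi> i + \<phi>' i"] exI[of _ "\<lambda>i. \<psi> i + \<psi>' i"] exI[of _ "t + t'"])
        (simp add: sum.distrib distrib_right)
  next
    case (scale f b s)
    then obtain \<phi> \<psi> t where
      1: "t \<ge> 0" "\<forall>i\<in>I. \<forall>j\<in>I. f (i, j) \<le> \<phi> i + \<psi> j + t * c i j"
      "b = (\<Sum>i\<in>I. \<phi> i * p i) + (\<Sum>j\<in>I. \<psi> j * q j) + t * C"
      by auto
    have "s * f (i, j) \<le> s * \<phi> i + s * \<psi> j + s * t * c i j" if "i \<in> I" "j \<in> I" for i j
    proof -
      have "s * f (i, j) \<le> s * (\<phi> i + \<psi> j + t * c i j)"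
        using 1 that scale by (intro mult_left_mono) auto
      then show ?thesis by (simp add: algebra_simps)
    qed
    then show ?case
      using 1 scale
      by (intro exI[of _ "\<lambda>i. s * \<phi> i"] exI[of _ "\<lambda>i. s * \<psi> i"] exI[of _ "s * t"])
        (simp add: sum_distrib_left algebra_simps)
  qed
  have "\<exists>x. \<forall>(f, b)\<in>A. (\<Sum>j\<in>I \<times> I. f j * x j) \<le> b"
  proof (rule farkas)
    fix f b assume fb: "in_conic_hull A f b" "\<forall>j\<in>I \<times> I. f j = 0"
    obtain \<phi> \<psi> t where
      1: "t \<ge> 0" "\<forall>i\<in>I. \<forall>j\<in>I. f (i, j) \<le> \<phi> i + \<psi> j + t * c i j"
      "b = (\<Sum>i\<in>I. \<phi> i * p i) + (\<Sum>j\<in>I. \<psi> j * q j) + t * C"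
      using hull[OF fb(1)] by blast
    have 2: "0 \<le> \<phi> i + \<psi> j + t * c i j" if "i \<in> I" "j \<in> I" for i j
      using 1(2) fb(2) that by fastforce
    \<comment> \<open>For \<open>t > 0\<close> the pair \<open>- \<phi> / t\<close>,
      \<open>- \<psi> / t\<close> is admissible in \<open>dual\<close>. For \<open>t = 0\<close>
      there is nothing to divide by, and averaging the nonnegative
      \<open>\<phi> i + \<psi> j\<close> against the product weights \<open>p i * q j\<close> gives
      \<open>b\<close> itself.\<close>
    show "b \<ge> 0"
    proof (cases "t = 0")
      case True
      have "0 \<le> (\<Sum>i\<in>I. \<Sum>j\<in>I. (\<phi> i + \<psi> j) * (p i * q j))"
        using 2 p q True by (intro sum_nonneg mult_nonneg_nonneg) auto
      also have "\<dots> = (\<Sum>i\<in>I. (\<phi> i * p i) * sum q I) + (\<Sum>i\<in>I. p i * (\<Sum>j\<in>I. \<psi> j * q j))"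
        by (simp add: sum.distrib sum_distrib_left algebra_simps)
      also have "\<dots> = b"
        using p q 1 True by (simp flip: sum_distrib_right)
      finally show ?thesis .
    next
      case False
      then have t: "t > 0" using 1 by auto
      have "(\<Sum>i\<in>I. (- \<phi> i / t) * p i) + (\<Sum>j\<in>I. (- \<psi> j / t) * q j) \<le> C"
      proof (rule dual)
        fix i j assume "i \<in> I" "j \<in> I"
        from 2[OF this] show "- \<phi> i / t + - \<psi> j / t \<le> c i j"
          using t by (simp add: field_simps)
      qed
      then have "- ((\<Sum>i\<in>I. \<phi> i * p i) + (\<Sum>j\<in>I. \<psi> j * q j)) / t \<le> C"
        by (simp add: sum_negf sum_divide_distrib diff_divide_distrib)
      then show ?thesis
        using t 1(3) by (simp add: field_simps)
    qed
  qed (use I in \<open>auto simp: A_def\<close>)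
  then obtain x where x: "\<And>f b. (f, b) \<in> A \<Longrightarrow> (\<Sum>j\<in>I \<times> I. f j * x j) \<le> b"
    by blast
  have row: "(\<Sum>k\<in>I \<times> I. of_bool (fst k = i) * x k) = (\<Sum>j\<in>I. x (i, j))" if "i \<in> I" for i
    using d[OF that, of "\<lambda>k. \<Sum>j\<in>I. x (k, j)"]
    by (simp add: sum.cartesian_product' sum_distrib_left)
  have col: "(\<Sum>k\<in>I \<times> I. of_bool (snd k = i) * x k) = (\<Sum>j\<in>I. x (j, i))" if "i \<in> I" for i
    using d[OF that] by (simp add: sum.cartesian_product')
  show thesis
  proof (rule that[of "\<lambda>i j. x (i, j)"])
    show "0 \<le> x (i, j)" if "i \<in> I" "j \<in> I" for i j
    proof -
      have "(\<Sum>k\<in>I \<times> I. of_bool (k = (i, j)) * x k) = x (i, j)"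
        using sum.remove[of "I \<times> I" "(i, j)" "\<lambda>k. of_bool (k = (i, j)) * x k"] I that by simp
      moreover have "(\<Sum>k\<in>I \<times> I. - of_bool (k = (i, j)) * x k) \<le> 0"
        by (rule x) (use that in \<open>auto simp: A_def\<close>)
      ultimately show ?thesis
        by (simp add: sum_negf)
    qed
    show "(\<Sum>j\<in>I. x (i, j)) = p i" if "i \<in> I" for i
    proof -
      have "(\<Sum>k\<in>I \<times> I. of_bool (fst k = i) * x k) \<le> p i"
        "(\<Sum>k\<in>I \<times> I. - of_bool (fst k = i) * x k) \<le> - p i"
        by (rule x; use that in \<open>simp add: A_def\<close>)+
      then show ?thesis
        using row[OF that] by (simp add: sum_negf)
    qed
    show "(\<Sum>i\<in>I. x (i, j)) = q j" if "j \<in> I" for j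
    proof -
      have "(\<Sum>k\<in>I \<times> I. of_bool (snd k = j) * x k) \<le> q j"
        "(\<Sum>k\<in>I \<times> I. - of_bool (snd k = j) * x k) \<le> - q j"
        by (rule x; use that in \<open>simp add: A_def\<close>)+
      then show ?thesis
        using col[OF that] by (simp add: sum_negf)
    qed
    show "(\<Sum>i\<in>I. \<Sum>j\<in>I. c i j * x (i, j)) \<le> C"
      using x[of "\<lambda>j. c (fst j) (snd j)" C] by (simp add: A_def sum.cartesian_product')
  qed
qed

section \<open>Kantorovich duality\<close>

text \<open>Map \<open>x\<close> to the nearest among \<open>z\<close> and the first
  \<open>k\<close> points of a dense sequence. The distance decreases to 0, and starting from
  \<open>z\<close> keeps it below \<open>\<rho> x z\<close>, the majorant for dominated convergence
  under both measures at once. Continuity in the first argument is for measurability, in the second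
  for meeting small balls with the dense set. A function \<open>\<rho>\<close> instead of the metric
  of the type leaves room for pseudometrics.\<close>

lemma finite_quantizer:
  fixes \<rho> :: "'x::second_countable_topology \<Rightarrow> 'x \<Rightarrow> real"
  assumes cont: "\<And>y. continuous_on UNIV (\<lambda>x. \<rho> x y)" "\<And>x. continuous_on UNIV (\<lambda>y. \<rho> x y)"
    and nonneg: "\<And>x y. 0 \<le> \<rho> x y" and refl: "\<And>x. \<rho> x x = 0"
    and [measurable_cong]: "sets \<nu>\<^sub>1 = sets borel" "sets \<nu>\<^sub>2 = sets borel"
    and int: "integrable \<nu>\<^sub>1 (\<lambda>x. (\<rho> x z)\<^sup>2)" "integrable \<nu>\<^sub>2 (\<lambda>x. (\<rho> x z)\<^sup>2)"
    and "\<eta> > 0"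
  obtains q where "simple_function borel q" "(\<lambda>x. \<rho> x (q x)) \<in> borel_measurable borel"
    "\<And>x. \<rho> x (q x) \<le> \<rho> x z"
    "(\<integral>x. (\<rho> x (q x))\<^sup>2 \<partial>\<nu>\<^sub>1) \<le> \<eta>" "(\<integral>x. (\<rho> x (q x))\<^sup>2 \<partial>\<nu>\<^sub>2) \<le> \<eta>"
proof -
  obtain D :: "'x set" where D: "countable D" "\<And>X. open X \<Longrightarrow> X \<noteq> {} \<Longrightarrow> \<exists>d\<in>D. d \<in> X"
    using countable_dense_exists by blast
  have "D \<noteq> {}" using D(2)[of UNIV] by auto
  define q where "q = rec_nat (\<lambda>_. z)
    (\<lambda>k p x. if \<rho> x (from_nat_into D k) < \<rho> x (p x) then from_nat_into D k else p x)"
  have q_0: "q 0 = (\<lambda>_. z)" and q_Suc: "\<And>k. q (Suc k) =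
      (\<lambda>x. if \<rho> x (from_nat_into D k) < \<rho> x (q k x) then from_nat_into D k else q k x)"
    by (auto simp: q_def)
  have [measurable]: "(\<lambda>x. \<rho> x y) \<in> borel_measurable borel" for y
    using cont(1) by (rule borel_measurable_continuous_onI)
  have meas[measurable]: "(\<lambda>x. \<rho> x (q k x)) \<in> borel_measurable borel" for k
  proof (induction k)
    case (Suc k)
    have "(\<lambda>x. \<rho> x (q (Suc k) x)) = (\<lambda>x. min (\<rho> x (from_nat_into D k)) (\<rho> x (q k x)))"
      by (auto simp: q_Suc min_def)
    then show ?case using Suc by simp
  qed (simp add: q_0)
  have simple: "simple_function borel (q k)" for k
    by (induction k) (auto simp: q_0 q_Suc intro!: simple_function_If)
  have decr: "\<rho> x (q (k + l) x) \<le> \<rho> x (q k x)" for k l x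
    by (induction l) (auto simp: q_Suc)
  have le: "\<rho> x (q k x) \<le> \<rho> x z" for k x
    using decr[of x 0 k] by (simp add: q_0)
  have lim: "(\<lambda>k. \<rho> x (q k x)) \<longlonglongrightarrow> 0" for x
  proof (rule LIMSEQ_I)
    fix e :: real assume "e > 0"
    have "open {y. \<rho> x y < e}"
      using cont(2) by (intro open_Collect_less) auto
    moreover have "x \<in> {y. \<rho> x y < e}"
      using refl \<open>e > 0\<close> by auto
    ultimately obtain d where "d \<in> D" "\<rho> x d < e"
      using D(2) by blast
    then obtain j where j: "\<rho> x (from_nat_into D j) < e"
      using from_nat_into_surj[OF D(1)] by metis
    have "\<rho> x (q (Suc j + l) x) < e" for l
      using decr[of x "Suc j" l] j by (auto simp: q_Suc split: if_splits)
    then show "\<exists>n. \<forall>k\<ge>n. norm (\<rho> x (q k x) - 0) < e"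
      using nonneg by (intro exI[of _ "Suc j"]) (auto simp: le_iff_add)
  qed
  have "(\<lambda>k. \<integral>x. (\<rho> x (q k x))\<^sup>2 \<partial>\<nu>) \<longlonglongrightarrow> (\<integral>x. 0 \<partial>\<nu>)"
    if "integrable \<nu> (\<lambda>x. (\<rho> x z)\<^sup>2)" and [measurable_cong]: "sets \<nu> = sets borel" for \<nu>
  proof (rule integral_dominated_convergence)
    show "AE x in \<nu>. (\<lambda>k. (\<rho> x (q k x))\<^sup>2) \<longlonglongrightarrow> 0"
      using tendsto_power[OF lim, of _ 2] by simp
    show "AE x in \<nu>. norm ((\<rho> x (q k x))\<^sup>2) \<le> (\<rho> x z)\<^sup>2" for k
      using le nonneg by (auto intro!: power_mono)
  qed (use that in auto)
  then have "(\<lambda>k. \<integral>x. (\<rho> x (q k x))\<^sup>2 \<partial>\<nu>\<^sub>1) \<longlonglongrightarrow> 0" "(\<lambda>k. \<integral>x. (\<rho> x (q k x))\<^sup>2 \<partial>\<nu>\<^sub>2) \<longlonglongrightarrow> 0"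
    using assms by simp_all
  from order_tendstoD(2)[OF this(1) \<open>\<eta> > 0\<close>] order_tendstoD(2)[OF this(2) \<open>\<eta> > 0\<close>]
  have "\<forall>\<^sub>F k in sequentially. (\<integral>x. (\<rho> x (q k x))\<^sup>2 \<partial>\<nu>\<^sub>1) < \<eta> \<and> (\<integral>x. (\<rho> x (q k x))\<^sup>2 \<partial>\<nu>\<^sub>2) < \<eta>"
    by eventually_elim auto
  then obtain k where "(\<integral>x. (\<rho> x (q k x))\<^sup>2 \<partial>\<nu>\<^sub>1) < \<eta>" "(\<integral>x. (\<rho> x (q k x))\<^sup>2 \<partial>\<nu>\<^sub>2) < \<eta>"
    by (auto simp: eventually_sequentially)
  then show thesis
    by (intro that[of "q k"]) (use simple meas le in auto)
qed

lemma simple_function_compose_integral: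
  fixes \<phi> :: "'b \<Rightarrow> real"
  assumes "finite_measure \<nu>" and q: "simple_function \<nu> q" and UNIV: "space \<nu> = UNIV"
  shows "integrable \<nu> (\<lambda>x. \<phi> (q x))"
    and "(\<integral>x. \<phi> (q x) \<partial>\<nu>) = (\<Sum>i\<in>range q. \<phi> i * measure \<nu> (q -` {i}))"
    and "(\<And>x. 0 \<le> \<phi> (q x)) \<Longrightarrow>
      (\<integral>\<^sup>+x. ennreal (\<phi> (q x)) \<partial>\<nu>) = ennreal (\<Sum>i\<in>range q. \<phi> i * measure \<nu> (q -` {i}))"
proof -
  interpret finite_measure \<nu> by fact
  have fin: "finite (range q)" and [measurable]: "\<And>i. q -` {i} \<in> sets \<nu>"
    using simple_functionD[OF q] UNIV by auto
  have eq: "\<phi> (q x) = (\<Sum>i\<in>range q. \<phi> i * indicator (q -` {i}) x)" for x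
    using fin sum.remove[of "range q" "q x" "\<lambda>i. \<phi> i * indicator (q -` {i}) x"]
    by (simp add: indicator_def)
  show int: "integrable \<nu> (\<lambda>x. \<phi> (q x))"
    unfolding eq by (intro Bochner_Integration.integrable_sum integrable_mult_right integrable_real_indicator)
      (auto simp: emeasure_eq_measure)
  show *: "(\<integral>x. \<phi> (q x) \<partial>\<nu>) = (\<Sum>i\<in>range q. \<phi> i * measure \<nu> (q -` {i}))"
    unfolding eq
    by (subst Bochner_Integration.integral_sum)
      (auto simp: emeasure_eq_measure UNIV)
  show "(\<integral>\<^sup>+x. ennreal (\<phi> (q x)) \<partial>\<nu>) = ennreal (\<Sum>i\<in>range q. \<phi> i * measure \<nu> (q -` {i}))"
    if "\<And>x. 0 \<le> \<phi> (q x)"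
    using nn_integral_eq_integral[OF int] that * by simp
qed

text \<open>\<open>F\<close> is arbitrary because only its finitely many values on the ranges of
  \<open>q\<close> and \<open>r\<close> enter.\<close>

lemma borel_measurable_simple_function_pair:
  fixes F :: "'b \<Rightarrow> 'c \<Rightarrow> real"
  assumes "simple_function M q" "simple_function N r"
  shows "(\<lambda>z. F (q (fst z)) (r (snd z))) \<in> borel_measurable (M \<Otimes>\<^sub>M N)"
proof -
  have "simple_function (M \<Otimes>\<^sub>M N) (\<lambda>z. q (fst z))" "simple_function (M \<Otimes>\<^sub>M N) (\<lambda>z. r (snd z))"
    using assms by (auto intro: simple_function_comp[OF measurable_fst] simple_function_comp[OF measurable_snd])
  then have "simple_function (M \<Otimes>\<^sub>M N) (\<lambda>z. F (q (fst z)) (r (snd z)))"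
    by (rule simple_function_compose2)
  then show ?thesis
    by (rule borel_measurable_simple_function)
qed

section \<open>Couplings given by densities, and integrals of marginals\<close>

lemma distr_density_pair:
  assumes "prob_space M" "prob_space N"
    and [measurable]: "G \<in> borel_measurable (M \<Otimes>\<^sub>M N)"
  shows "(AE x in M. (\<integral>\<^sup>+y. G (x, y) \<partial>N) = 1) \<Longrightarrow> distr (density (M \<Otimes>\<^sub>M N) G) M fst = M"
    and "(AE y in N. (\<integral>\<^sup>+x. G (x, y) \<partial>M) = 1) \<Longrightarrow> distr (density (M \<Otimes>\<^sub>M N) G) N snd = N"
proof -
  interpret M: prob_space M by fact
  interpret N: prob_space N by fact
  interpret pair_prob_space M N ..
  show "distr (density (M \<Otimes>\<^sub>M N) G) M fst = M" if *: "AE x in M. (\<integral>\<^sup>+y. G (x, y) \<partial>N) = 1"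
  proof (rule measure_eqI)
    fix A assume "A \<in> sets (distr (density (M \<Otimes>\<^sub>M N) G) M fst)"
    then have [measurable]: "A \<in> sets M" by simp
    have "emeasure (distr (density (M \<Otimes>\<^sub>M N) G) M fst) A = (\<integral>\<^sup>+z. indicator A (fst z) \<partial>density (M \<Otimes>\<^sub>M N) G)"
      using nn_integral_distr[of fst "density (M \<Otimes>\<^sub>M N) G" M "indicator A"] by simp
    also have "\<dots> = (\<integral>\<^sup>+x. \<integral>\<^sup>+y. G (x, y) * indicator A x \<partial>N \<partial>M)"
      using N.nn_integral_fst[of "\<lambda>z. G z * indicator A (fst z)" M] by (simp add: nn_integral_density)
    also have "\<dots> = (\<integral>\<^sup>+x. indicator A x \<partial>M)"
      using * by (intro nn_integral_cong_AE) (auto simp: nn_integral_multc)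
    finally show "emeasure (distr (density (M \<Otimes>\<^sub>M N) G) M fst) A = emeasure M A" by simp
  qed simp
  show "distr (density (M \<Otimes>\<^sub>M N) G) N snd = N" if *: "AE y in N. (\<integral>\<^sup>+x. G (x, y) \<partial>M) = 1"
  proof (rule measure_eqI)
    fix A assume "A \<in> sets (distr (density (M \<Otimes>\<^sub>M N) G) N snd)"
    then have [measurable]: "A \<in> sets N" by simp
    have "emeasure (distr (density (M \<Otimes>\<^sub>M N) G) N snd) A = (\<integral>\<^sup>+z. indicator A (snd z) \<partial>density (M \<Otimes>\<^sub>M N) G)"
      using nn_integral_distr[of snd "density (M \<Otimes>\<^sub>M N) G" N "indicator A"] by simp
    also have "\<dots> = (\<integral>\<^sup>+y. \<integral>\<^sup>+x. G (x, y) * indicator A y \<partial>M \<partial>N)"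
      using nn_integral_snd[of "\<lambda>z. G z * indicator A (snd z)"] by (simp add: nn_integral_density split_beta')
    also have "\<dots> = (\<integral>\<^sup>+x. indicator A x \<partial>N)"
      using * by (intro nn_integral_cong_AE) (auto simp: nn_integral_multc)
    finally show "emeasure (distr (density (M \<Otimes>\<^sub>M N) G) N snd) A = emeasure N A" by simp
  qed simp
qed

lemma couplingsI:
  assumes "prob_space M" "sets \<gamma> = sets (M \<Otimes>\<^sub>M N)" "distr \<gamma> M fst = M" "distr \<gamma> N snd = N"
  shows "\<gamma> \<in> couplings M N"
proof -
  have "fst \<in> measurable \<gamma> M"
    by (subst measurable_cong_sets[OF assms(2) refl]) simp
  then have "prob_space \<gamma>"
    using assms by (intro prob_space_distrD[of fst \<gamma> M]) auto
  then show ?thesis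
    using assms by (simp add: couplings_def space_prob_algebra)
qed

lemma nn_integral_coupling:
  assumes "\<gamma> \<in> couplings M N"
  shows "f \<in> borel_measurable M \<Longrightarrow> (\<integral>\<^sup>+z. f (fst z) \<partial>\<gamma>) = (\<integral>\<^sup>+x. f x \<partial>M)"
    and "g \<in> borel_measurable N \<Longrightarrow> (\<integral>\<^sup>+z. g (snd z) \<partial>\<gamma>) = (\<integral>\<^sup>+y. g y \<partial>N)"
proof -
  have [measurable_cong]: "sets \<gamma> = sets (M \<Otimes>\<^sub>M N)" and "distr \<gamma> M fst = M" "distr \<gamma> N snd = N"
    using assms by (auto simp: couplings_def space_prob_algebra)
  then show "f \<in> borel_measurable M \<Longrightarrow> (\<integral>\<^sup>+z. f (fst z) \<partial>\<gamma>) = (\<integral>\<^sup>+x. f x \<partial>M)"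
    "g \<in> borel_measurable N \<Longrightarrow> (\<integral>\<^sup>+z. g (snd z) \<partial>\<gamma>) = (\<integral>\<^sup>+y. g y \<partial>N)"
    using nn_integral_distr[of fst \<gamma> M f] nn_integral_distr[of snd \<gamma> N g] by auto
qed

lemma integral_coupling:
  fixes f g :: "_ \<Rightarrow> real"
  assumes "\<gamma> \<in> couplings M N"
  shows "f \<in> borel_measurable M \<Longrightarrow> integrable \<gamma> (\<lambda>z. f (fst z)) \<longleftrightarrow> integrable M f"
    and "f \<in> borel_measurable M \<Longrightarrow> (\<integral>z. f (fst z) \<partial>\<gamma>) = (\<integral>x. f x \<partial>M)"
    and "g \<in> borel_measurable N \<Longrightarrow> integrable \<gamma> (\<lambda>z. g (snd z)) \<longleftrightarrow> integrable N g"
    and "g \<in> borel_measurable N \<Longrightarrow> (\<integral>z. g (snd z) \<partial>\<gamma>) = (\<integral>y. g y \<partial>N)"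
proof -
  have [measurable_cong]: "sets \<gamma> = sets (M \<Otimes>\<^sub>M N)" and "distr \<gamma> M fst = M" "distr \<gamma> N snd = N"
    using assms by (auto simp: couplings_def space_prob_algebra)
  then show "f \<in> borel_measurable M \<Longrightarrow> integrable \<gamma> (\<lambda>z. f (fst z)) \<longleftrightarrow> integrable M f"
    "f \<in> borel_measurable M \<Longrightarrow> (\<integral>z. f (fst z) \<partial>\<gamma>) = (\<integral>x. f x \<partial>M)"
    "g \<in> borel_measurable N \<Longrightarrow> integrable \<gamma> (\<lambda>z. g (snd z)) \<longleftrightarrow> integrable N g"
    "g \<in> borel_measurable N \<Longrightarrow> (\<integral>z. g (snd z) \<partial>\<gamma>) = (\<integral>y. g y \<partial>N)"
    using integrable_distr_eq[of fst \<gamma> M f] integrable_distr_eq[of snd \<gamma> N g]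
      integral_distr[of fst \<gamma> M f] integral_distr[of snd \<gamma> N g] by auto
qed

text \<open>Young's inequality: the weight \<open>\<theta>\<close> keeps the factor of
  \<open>b\<^sup>2\<close> near 1 and loads the error terms with \<open>1 / \<theta>\<close>, which
  is harmless as they are made small after \<open>\<theta>\<close> is fixed.\<close>

lemma square_sum_le:
  fixes b s t \<theta> :: real
  assumes "\<theta> > 0"
  shows "(s + b + t)\<^sup>2 \<le> (1 + \<theta>) * b\<^sup>2 + 2 * (1 + 1 / \<theta>) * (s\<^sup>2 + t\<^sup>2)"
proof -
  define e where "e = s + t"
  have "0 \<le> (\<theta> * b - e)\<^sup>2 / \<theta>"
    using assms by simp
  then have "2 * b * e \<le> \<theta> * b\<^sup>2 + e\<^sup>2 / \<theta>"
    using assms by (simp add: power2_eq_square field_simps)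
  then have "(b + e)\<^sup>2 \<le> (1 + \<theta>) * b\<^sup>2 + (1 + 1 / \<theta>) * e\<^sup>2"
    by (simp add: power2_sum algebra_simps)
  also have "e\<^sup>2 \<le> 2 * (s\<^sup>2 + t\<^sup>2)"
    using zero_le_power2[of "s - t"] by (simp add: e_def power2_sum power2_diff)
  then have "(1 + 1 / \<theta>) * e\<^sup>2 \<le> (1 + 1 / \<theta>) * (2 * (s\<^sup>2 + t\<^sup>2))"
    using assms by (intro mult_left_mono) auto
  finally show ?thesis
    by (simp add: e_def algebra_simps)
qed

text \<open>
  Both directions pass through a finite quantizer \<open>q\<close>: dual pairs of the quantized problem become dual
  pairs of the original one up to an error that is small in the mean, and an optimal coupling of the
  quantized marginals is lifted by making the two points independent given their quantizations.
\<close>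

lemma kantorovich_coupling:
  fixes \<rho> :: "'x::second_countable_topology \<Rightarrow> 'x \<Rightarrow> real"
  assumes cont: "continuous_on UNIV (\<lambda>z. \<rho> (fst z) (snd z))"
    and nonneg: "\<And>x y. 0 \<le> \<rho> x y" and refl: "\<And>x. \<rho> x x = 0" and sym: "\<And>x y. \<rho> x y = \<rho> y x"
    and tri: "\<And>x y z. \<rho> x z \<le> \<rho> x y + \<rho> y z"
    and prob: "prob_space \<nu>\<^sub>1" "prob_space \<nu>\<^sub>2"
    and sets[measurable_cong]: "sets \<nu>\<^sub>1 = sets borel" "sets \<nu>\<^sub>2 = sets borel"
    and int: "integrable \<nu>\<^sub>1 (\<lambda>x. (\<rho> x z)\<^sup>2)" "integrable \<nu>\<^sub>2 (\<lambda>x. (\<rho> x z)\<^sup>2)"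
    and dual: "\<And>\<phi> \<psi> K. \<phi> \<in> borel_measurable borel \<Longrightarrow> \<psi> \<in> borel_measurable borel \<Longrightarrow>
        (\<And>x. \<phi> x \<le> K) \<Longrightarrow> (\<And>x. \<psi> x \<le> K) \<Longrightarrow> integrable \<nu>\<^sub>1 \<phi> \<Longrightarrow> integrable \<nu>\<^sub>2 \<psi> \<Longrightarrow>
        (\<And>x y. \<phi> x + \<psi> y \<le> (\<rho> x y)\<^sup>2) \<Longrightarrow> (\<integral>x. \<phi> x \<partial>\<nu>\<^sub>1) + (\<integral>x. \<psi> x \<partial>\<nu>\<^sub>2) \<le> C"
    and "\<epsilon> > 0"
  shows "\<exists>\<gamma>\<in>couplings \<nu>\<^sub>1 \<nu>\<^sub>2. (\<integral>\<^sup>+z. ennreal ((\<rho> (fst z) (snd z))\<^sup>2) \<partial>\<gamma>) \<le> ennreal (C + \<epsilon>)"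
proof -
  interpret N1: prob_space \<nu>\<^sub>1 by fact
  interpret N2: prob_space \<nu>\<^sub>2 by fact
  interpret pair_prob_space \<nu>\<^sub>1 \<nu>\<^sub>2 ..
  have space: "space \<nu>\<^sub>1 = UNIV" "space \<nu>\<^sub>2 = UNIV"
    using sets_eq_imp_space_eq[OF sets(1)] sets_eq_imp_space_eq[OF sets(2)] by auto
  have cont': "continuous_on UNIV (\<lambda>x. \<rho> x y)" "continuous_on UNIV (\<lambda>x. \<rho> y x)" for y
    using continuous_on_compose2[OF cont, of UNIV "\<lambda>x. (x, y)"]
      continuous_on_compose2[OF cont, of UNIV "\<lambda>x. (y, x)"]
    by (auto simp: continuous_on_Pair)
  \<comment> \<open>The zero functions are an admissible dual pair.\<close>
  have "(\<integral>x. 0 \<partial>\<nu>\<^sub>1) + (\<integral>x. 0 \<partial>\<nu>\<^sub>2) \<le> C"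
    by (rule dual[where K = 0]) auto
  then have "C \<ge> 0" by simp
  \<comment> \<open>The order of choice matters: \<open>\<theta>\<close>, then the factor
    \<open>k\<close> of the errors in \<open>square_sum_le\<close>, then the mesh
    \<open>\<eta>\<close>. The final excess over \<open>C\<close> is \<open>2 * \<theta> * C +
    \<theta>\<^sup>2 * C + 4 * k * \<eta> + 2 * \<theta> * k * \<eta>\<close>, whose terms are at
    most a third, a sixth, a third and a sixth of \<open>\<epsilon>\<close>.\<close>
  define \<theta> where "\<theta> = min 1 (\<epsilon> / (6 * (C + 1)))"
  have \<theta>: "0 < \<theta>" "\<theta> \<le> 1" "\<theta> \<le> \<epsilon> / (6 * (C + 1))"
    using \<open>\<epsilon> > 0\<close> \<open>C \<ge> 0\<close> by (auto simp: \<theta>_def)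
  define k where "k = 2 * (1 + 1 / \<theta>)"
  have k: "k > 0" using \<theta> by (simp add: k_def add_pos_pos)
  define \<eta> where "\<eta> = \<epsilon> / (12 * k)"
  have \<eta>: "\<eta> > 0" "k * \<eta> = \<epsilon> / 12" using k \<open>\<epsilon> > 0\<close> by (auto simp: \<eta>_def)
  obtain q where q: "simple_function borel q" and [measurable]: "(\<lambda>x. \<rho> x (q x)) \<in> borel_measurable borel"
    and q_le: "\<And>x. \<rho> x (q x) \<le> \<rho> x z"
    and q_int: "(\<integral>x. (\<rho> x (q x))\<^sup>2 \<partial>\<nu>\<^sub>1) \<le> \<eta>" "(\<integral>x. (\<rho> x (q x))\<^sup>2 \<partial>\<nu>\<^sub>2) \<le> \<eta>"
    by (rule finite_quantizer[OF cont' nonneg refl sets int \<eta>(1)]) (rule that)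
  have q12: "simple_function \<nu>\<^sub>1 q" "simple_function \<nu>\<^sub>2 q"
    using q by (auto simp: simple_function_def sets space)
  define I where "I = range q"
  have I: "finite I" "\<And>x. q x \<in> I"
    using simple_functionD(1)[OF q] by (auto simp: I_def)
  have "integrable \<nu> (\<lambda>x. (\<rho> x (q x))\<^sup>2)"
    if "integrable \<nu> (\<lambda>x. (\<rho> x z)\<^sup>2)" and [measurable_cong]: "sets \<nu> = sets borel" for \<nu>
    by (rule Bochner_Integration.integrable_bound[OF that(1)])
      (use q_le nonneg in \<open>auto intro!: power_mono\<close>)
  from this[OF int(1) sets(1)] this[OF int(2) sets(2)]
  have err_int: "integrable \<nu>\<^sub>1 (\<lambda>x. (\<rho> x (q x))\<^sup>2)" "integrable \<nu>\<^sub>2 (\<lambda>x. (\<rho> x (q x))\<^sup>2)" .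
  define p r where "p i = measure \<nu>\<^sub>1 (q -` {i})" and "r i = measure \<nu>\<^sub>2 (q -` {i})" for i
  note comp1 = simple_function_compose_integral[OF N1.finite_measure_axioms q12(1) space(1), folded I_def p_def]
  note comp2 = simple_function_compose_integral[OF N2.finite_measure_axioms q12(2) space(2), folded I_def r_def]
  obtain g where g: "\<And>i j. i \<in> I \<Longrightarrow> j \<in> I \<Longrightarrow> g i j \<ge> 0"
    "\<And>i. i \<in> I \<Longrightarrow> (\<Sum>j\<in>I. g i j) = p i" "\<And>j. j \<in> I \<Longrightarrow> (\<Sum>i\<in>I. g i j) = r j"
    "(\<Sum>i\<in>I. \<Sum>j\<in>I. (\<rho> i j)\<^sup>2 * g i j) \<le> (1 + \<theta>) * C + 2 * (k * \<eta>)"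
  proof (rule transport_duality_finite)
    show "finite I" by fact
    show "sum p I = 1" "sum r I = 1"
      using comp1(2)[of "\<lambda>_. 1"] comp2(2)[of "\<lambda>_. 1"] N1.prob_space N2.prob_space by auto
    fix \<phi> \<psi> assume feas: "\<And>i j. i \<in> I \<Longrightarrow> j \<in> I \<Longrightarrow> \<phi> i + \<psi> j \<le> (\<rho> i j)\<^sup>2"
    \<comment> \<open>Potentials on cells are pulled back through \<open>q\<close>; subtracting
      \<open>k\<close> times the squared error and dividing by \<open>1 + \<theta>\<close> pays for
      the passage from \<open>\<rho> (q x) (q y)\<close> to \<open>\<rho> x y\<close>. The result is
      bounded above but in general not below, which is why \<open>dual\<close> speaks of upper
      bounds and integrability.\<close>
    define \<phi>' \<psi>' where "\<phi>' x = (\<phi> (q x) - k * (\<rho> x (q x))\<^sup>2) / (1 + \<theta>)"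
      and "\<psi>' x = (\<psi> (q x) - k * (\<rho> x (q x))\<^sup>2) / (1 + \<theta>)" for x
    have [measurable]: "(\<lambda>x. \<phi> (q x)) \<in> borel_measurable borel" "(\<lambda>x. \<psi> (q x)) \<in> borel_measurable borel"
      using simple_function_compose1[OF q] by (auto intro: borel_measurable_simple_function)
    define K where "K = (\<Sum>i\<in>I. \<bar>\<phi> i\<bar> + \<bar>\<psi> i\<bar>)"
    have K: "\<bar>\<phi> (q x)\<bar> + \<bar>\<psi> (q x)\<bar> \<le> K" for x
      unfolding K_def using I by (intro member_le_sum) auto
    have "(\<integral>x. \<phi>' x \<partial>\<nu>\<^sub>1) + (\<integral>x. \<psi>' x \<partial>\<nu>\<^sub>2) \<le> C"
    proof (rule dual)
      show "\<phi>' \<in> borel_measurable borel" "\<psi>' \<in> borel_measurable borel"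
        by (simp_all add: \<phi>'_def[abs_def] \<psi>'_def[abs_def])
      show "\<phi>' x \<le> K" "\<psi>' x \<le> K" for x
      proof -
        have 1: "y \<le> (1 + \<theta>) * K" if "y \<le> K" "K \<ge> 0" for y
          using mult_right_mono[of 1 "1 + \<theta>" K] that \<theta> by simp
        have 2: "K \<ge> 0"
          using K[of x] by simp
        have 3: "k * (\<rho> x (q x))\<^sup>2 \<ge> 0" using k by simp
        then show "\<phi>' x \<le> K" "\<psi>' x \<le> K"
          using K[of x] \<theta> 1[OF _ 2] unfolding \<phi>'_def \<psi>'_def
          by (auto simp: pos_divide_le_eq mult.commute)
      qed
      show "integrable \<nu>\<^sub>1 \<phi>'" "integrable \<nu>\<^sub>2 \<psi>'"
        using comp1(1)[of \<phi>] comp2(1)[of \<psi>] err_int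
        by (auto simp: \<phi>'_def[abs_def] \<psi>'_def[abs_def])
      show "\<phi>' x + \<psi>' y \<le> (\<rho> x y)\<^sup>2" for x y
      proof -
        have "\<rho> (q x) (q y) \<le> \<rho> x (q x) + \<rho> x y + \<rho> y (q y)"
          using tri[of "q x" "q y" x] tri[of x "q y" y] sym[of "q x" x] by simp
        then have "(\<rho> (q x) (q y))\<^sup>2 \<le> (\<rho> x (q x) + \<rho> x y + \<rho> y (q y))\<^sup>2"
          using nonneg by (intro power_mono)
        also have "\<dots> \<le> (1 + \<theta>) * (\<rho> x y)\<^sup>2 + k * ((\<rho> x (q x))\<^sup>2 + (\<rho> y (q y))\<^sup>2)"
          using square_sum_le[OF \<theta>(1)] by (simp add: k_def)
        finally have "\<phi> (q x) - k * (\<rho> x (q x))\<^sup>2 + (\<psi> (q y) - k * (\<rho> y (q y))\<^sup>2) \<le> (1 + \<theta>) * (\<rho> x y)\<^sup>2"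
          using feas[OF I(2) I(2), of x y] by (simp add: algebra_simps)
        then show ?thesis
          using \<theta> by (simp add: \<phi>'_def \<psi>'_def pos_divide_le_eq mult.commute flip: add_divide_distrib)
      qed
    qed
    also have "(\<integral>x. \<phi>' x \<partial>\<nu>\<^sub>1) = ((\<Sum>i\<in>I. \<phi> i * p i) - k * (\<integral>x. (\<rho> x (q x))\<^sup>2 \<partial>\<nu>\<^sub>1)) / (1 + \<theta>)"
      using comp1(1,2)[of \<phi>] err_int by (simp add: \<phi>'_def[abs_def])
    also have "(\<integral>x. \<psi>' x \<partial>\<nu>\<^sub>2) = ((\<Sum>i\<in>I. \<psi> i * r i) - k * (\<integral>x. (\<rho> x (q x))\<^sup>2 \<partial>\<nu>\<^sub>2)) / (1 + \<theta>)"
      using comp2(1,2)[of \<psi>] err_int by (simp add: \<psi>'_def[abs_def])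
    finally have "(\<Sum>i\<in>I. \<phi> i * p i) + (\<Sum>i\<in>I. \<psi> i * r i)
        \<le> (1 + \<theta>) * C + k * (\<integral>x. (\<rho> x (q x))\<^sup>2 \<partial>\<nu>\<^sub>1) + k * (\<integral>x. (\<rho> x (q x))\<^sup>2 \<partial>\<nu>\<^sub>2)"
      using \<theta> by (simp add: pos_divide_le_eq algebra_simps flip: add_divide_distrib)
    also have "\<dots> \<le> (1 + \<theta>) * C + k * \<eta> + k * \<eta>"
      using q_int k by (intro add_mono order.refl mult_left_mono) auto
    finally show "(\<Sum>i\<in>I. \<phi> i * p i) + (\<Sum>i\<in>I. \<psi> i * r i) \<le> (1 + \<theta>) * C + 2 * (k * \<eta>)"
      by (simp add: mult.commute add.commute)
  qed (auto simp: p_def r_def)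
  have g_le: "g i j \<le> p i" "g i j \<le> r j" if "i \<in> I" "j \<in> I" for i j
    using member_le_sum[of j I "g i"] member_le_sum[of i I "\<lambda>i. g i j"] g that I by auto
  \<comment> \<open>\<open>G\<close> spreads the mass \<open>g i j\<close> over the cell
    \<open>(i, j)\<close> proportionally to the product measure. Where \<open>p i\<close> or
    \<open>r j\<close> is 0, division by zero gives 0, and \<open>g i j\<close> is 0 as well by
    \<open>g_le\<close>.\<close>
  define G where "G i j = g i j / (p i * r j)" for i j
  have G_nonneg: "G (q x) (q y) \<ge> 0" for x y
    using g(1)[OF I(2) I(2)] by (auto simp: G_def p_def r_def)
  have G_r: "G i j * r j = g i j / p i" and G_p: "G i j * p i = g i j / r j" if "i \<in> I" "j \<in> I" for i j
    using g(1)[of i j] g_le[of i j] that by (auto simp: G_def)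
  have Gm[measurable]: "(\<lambda>z. G (q (fst z)) (q (snd z))) \<in> borel_measurable (\<nu>\<^sub>1 \<Otimes>\<^sub>M \<nu>\<^sub>2)"
    and cm[measurable]: "(\<lambda>z. \<rho> (q (fst z)) (q (snd z))) \<in> borel_measurable (\<nu>\<^sub>1 \<Otimes>\<^sub>M \<nu>\<^sub>2)"
    using borel_measurable_simple_function_pair[OF q12] by auto
  define \<gamma> where "\<gamma> = density (\<nu>\<^sub>1 \<Otimes>\<^sub>M \<nu>\<^sub>2) (\<lambda>z. ennreal (G (q (fst z)) (q (snd z))))"
  have null: "AE x in \<nu>\<^sub>1. p (q x) \<noteq> 0" "AE x in \<nu>\<^sub>2. r (q x) \<noteq> 0"
  proof -
    have vs: "q -` {i} \<in> sets borel" for i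
      using simple_functionD(2)[OF q, of "{i}"] by simp
    have "AE x in \<nu>\<^sub>1. \<forall>i\<in>I. p i = 0 \<longrightarrow> q x \<noteq> i"
    proof (intro AE_finite_allI[OF I(1)])
      fix i assume "i \<in> I"
      show "AE x in \<nu>\<^sub>1. p i = 0 \<longrightarrow> q x \<noteq> i"
        using vs[of i] by (cases "p i = 0")
          (auto intro!: AE_I[of _ _ "q -` {i}"] simp: p_def N1.emeasure_eq_measure sets)
    qed
    then show "AE x in \<nu>\<^sub>1. p (q x) \<noteq> 0"
      by eventually_elim (use I in auto)
    have "AE x in \<nu>\<^sub>2. \<forall>i\<in>I. r i = 0 \<longrightarrow> q x \<noteq> i"
    proof (intro AE_finite_allI[OF I(1)])
      fix i assume "i \<in> I"
      show "AE x in \<nu>\<^sub>2. r i = 0 \<longrightarrow> q x \<noteq> i"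
        using vs[of i] by (cases "r i = 0")
          (auto intro!: AE_I[of _ _ "q -` {i}"] simp: r_def N2.emeasure_eq_measure sets)
    qed
    then show "AE x in \<nu>\<^sub>2. r (q x) \<noteq> 0"
      by eventually_elim (use I in auto)
  qed
  have "distr \<gamma> \<nu>\<^sub>1 fst = \<nu>\<^sub>1" unfolding \<gamma>_def
  proof (rule distr_density_pair[OF prob])
    show "AE x in \<nu>\<^sub>1. (\<integral>\<^sup>+y. ennreal (G (q (fst (x, y))) (q (snd (x, y)))) \<partial>\<nu>\<^sub>2) = 1"
      using null(1)
    proof eventually_elim
      fix x assume "p (q x) \<noteq> 0"
      then show "(\<integral>\<^sup>+y. ennreal (G (q (fst (x, y))) (q (snd (x, y)))) \<partial>\<nu>\<^sub>2) = 1"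
        using comp2(3)[of "G (q x)"] G_nonneg I g(2) by (simp add: G_r flip: sum_divide_distrib)
    qed
  qed simp
  moreover have "distr \<gamma> \<nu>\<^sub>2 snd = \<nu>\<^sub>2" unfolding \<gamma>_def
  proof (rule distr_density_pair[OF prob])
    show "AE y in \<nu>\<^sub>2. (\<integral>\<^sup>+x. ennreal (G (q (fst (x, y))) (q (snd (x, y)))) \<partial>\<nu>\<^sub>1) = 1"
      using null(2)
    proof eventually_elim
      fix y assume "r (q y) \<noteq> 0"
      then show "(\<integral>\<^sup>+x. ennreal (G (q (fst (x, y))) (q (snd (x, y)))) \<partial>\<nu>\<^sub>1) = 1"
        using comp1(3)[of "\<lambda>i. G i (q y)"] G_nonneg I g(3) by (simp add: G_p flip: sum_divide_distrib)
    qed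
  qed simp
  ultimately have coup: "\<gamma> \<in> couplings \<nu>\<^sub>1 \<nu>\<^sub>2"
    by (intro couplingsI prob) (auto simp: \<gamma>_def)
  have [measurable_cong]: "sets \<gamma> = sets (\<nu>\<^sub>1 \<Otimes>\<^sub>M \<nu>\<^sub>2)"
    by (simp add: \<gamma>_def)
  have "(\<integral>\<^sup>+z. ennreal ((\<rho> (q (fst z)) (q (snd z)))\<^sup>2) \<partial>\<gamma>)
      = (\<integral>\<^sup>+x. \<integral>\<^sup>+y. ennreal ((\<rho> (q x) (q y))\<^sup>2 * G (q x) (q y)) \<partial>\<nu>\<^sub>2 \<partial>\<nu>\<^sub>1)"
    unfolding \<gamma>_def using G_nonneg
    by (subst nn_integral_density)
      (auto simp: N2.nn_integral_fst[symmetric] ennreal_mult mult.commute)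
  also have "\<dots> = (\<integral>\<^sup>+x. ennreal (\<Sum>j\<in>I. (\<rho> (q x) j)\<^sup>2 * g (q x) j / p (q x)) \<partial>\<nu>\<^sub>1)"
    using comp2(3)[of "\<lambda>j. (\<rho> (q x) j)\<^sup>2 * G (q x) j" for x] G_nonneg I
    by (simp add: mult.assoc G_r)
  also have "\<dots> = ennreal (\<Sum>i\<in>I. (\<Sum>j\<in>I. (\<rho> i j)\<^sup>2 * g i j / p i) * p i)"
    using I g(1) by (subst comp1(3)) (auto intro!: sum_nonneg simp: p_def)
  also have "(\<Sum>i\<in>I. (\<Sum>j\<in>I. (\<rho> i j)\<^sup>2 * g i j / p i) * p i) = (\<Sum>i\<in>I. \<Sum>j\<in>I. (\<rho> i j)\<^sup>2 * g i j)"
  proof (intro sum.cong)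
    fix i assume i: "i \<in> I"
    show "(\<Sum>j\<in>I. (\<rho> i j)\<^sup>2 * g i j / p i) * p i = (\<Sum>j\<in>I. (\<rho> i j)\<^sup>2 * g i j)"
    proof (cases "p i = 0")
      case True
      then have "g i j = 0" if "j \<in> I" for j
        using g_le(1)[OF i that] g(1)[OF i that] by simp
      then show ?thesis using True by simp
    qed (simp flip: sum_divide_distrib)
  qed simp
  finally have quant: "(\<integral>\<^sup>+z. ennreal ((\<rho> (q (fst z)) (q (snd z)))\<^sup>2) \<partial>\<gamma>)
      \<le> ennreal ((1 + \<theta>) * C + 2 * (k * \<eta>))"
    using g(4) by (simp add: ennreal_leI)
  have err: "(\<integral>\<^sup>+z. ennreal ((\<rho> (fst z) (q (fst z)))\<^sup>2) \<partial>\<gamma>) \<le> ennreal \<eta>"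
    "(\<integral>\<^sup>+z. ennreal ((\<rho> (snd z) (q (snd z)))\<^sup>2) \<partial>\<gamma>) \<le> ennreal \<eta>"
    using q_int err_int nn_integral_coupling(1)[OF coup, of "\<lambda>x. ennreal ((\<rho> x (q x))\<^sup>2)"]
      nn_integral_coupling(2)[OF coup, of "\<lambda>x. ennreal ((\<rho> x (q x))\<^sup>2)"]
    by (auto simp: nn_integral_eq_integral ennreal_leI)
  have "(\<integral>\<^sup>+z. ennreal ((\<rho> (fst z) (snd z))\<^sup>2) \<partial>\<gamma>)
      \<le> (\<integral>\<^sup>+z. ennreal (1 + \<theta>) * ennreal ((\<rho> (q (fst z)) (q (snd z)))\<^sup>2)
          + ennreal k * (ennreal ((\<rho> (fst z) (q (fst z)))\<^sup>2) + ennreal ((\<rho> (snd z) (q (snd z)))\<^sup>2)) \<partial>\<gamma>)"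
  proof (intro nn_integral_mono)
    fix z :: "'x \<times> 'x"
    obtain x y where z: "z = (x, y)" by (cases z)
    have "\<rho> x y \<le> \<rho> x (q x) + \<rho> (q x) (q y) + \<rho> y (q y)"
      using tri[of x y "q x"] tri[of "q x" y "q y"] sym[of "q y" y] by simp
    then have "(\<rho> x y)\<^sup>2 \<le> (\<rho> x (q x) + \<rho> (q x) (q y) + \<rho> y (q y))\<^sup>2"
      using nonneg by (intro power_mono)
    also have "\<dots> \<le> (1 + \<theta>) * (\<rho> (q x) (q y))\<^sup>2 + k * ((\<rho> x (q x))\<^sup>2 + (\<rho> y (q y))\<^sup>2)"
      using square_sum_le[OF \<theta>(1)] by (simp add: k_def)
    finally show "ennreal ((\<rho> (fst z) (snd z))\<^sup>2) \<le> ennreal (1 + \<theta>) * ennreal ((\<rho> (q (fst z)) (q (snd z)))\<^sup>2)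
          + ennreal k * (ennreal ((\<rho> (fst z) (q (fst z)))\<^sup>2) + ennreal ((\<rho> (snd z) (q (snd z)))\<^sup>2))"
      using \<theta> k z by (simp add: ennreal_leI flip: ennreal_plus ennreal_mult)
  qed
  also have "\<dots> = ennreal (1 + \<theta>) * (\<integral>\<^sup>+z. ennreal ((\<rho> (q (fst z)) (q (snd z)))\<^sup>2) \<partial>\<gamma>)
      + ennreal k * ((\<integral>\<^sup>+z. ennreal ((\<rho> (fst z) (q (fst z)))\<^sup>2) \<partial>\<gamma>)
        + (\<integral>\<^sup>+z. ennreal ((\<rho> (snd z) (q (snd z)))\<^sup>2) \<partial>\<gamma>))"
    by (simp add: nn_integral_add nn_integral_cmult)
  also have "\<dots> \<le> ennreal (1 + \<theta>) * ennreal ((1 + \<theta>) * C + 2 * (k * \<eta>)) + ennreal k * (ennreal \<eta> + ennreal \<eta>)"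
    using quant err by (intro add_mono mult_left_mono) auto
  also have "\<dots> = ennreal ((1 + \<theta>) * ((1 + \<theta>) * C + 2 * (k * \<eta>)) + k * (\<eta> + \<eta>))"
    using \<theta> k \<eta>(1) \<open>C \<ge> 0\<close> by (simp flip: ennreal_plus ennreal_mult)
  also have "\<dots> \<le> ennreal (C + \<epsilon>)"
  proof (rule ennreal_leI)
    have "\<theta> * C \<le> \<epsilon> / (6 * (C + 1)) * C"
      using \<theta> \<open>C \<ge> 0\<close> by (intro mult_right_mono) auto
    also have "\<dots> \<le> \<epsilon> / 6"
      using \<open>C \<ge> 0\<close> \<open>\<epsilon> > 0\<close> by (simp add: field_simps)
    finally have 1: "\<theta> * C \<le> \<epsilon> / 6" .
    have 2: "\<theta> * (\<theta> * C) \<le> 1 * (\<theta> * C)"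
      using \<theta> \<open>C \<ge> 0\<close> by (intro mult_right_mono) auto
    have 3: "\<theta> * (\<epsilon> / 6) \<le> 1 * (\<epsilon> / 6)"
      using \<theta> \<open>\<epsilon> > 0\<close> by (intro mult_right_mono) auto
    show "(1 + \<theta>) * ((1 + \<theta>) * C + 2 * (k * \<eta>)) + k * (\<eta> + \<eta>) \<le> C + \<epsilon>"
    proof -
      have "(1 + \<theta>) * ((1 + \<theta>) * C + 2 * (k * \<eta>)) + k * (\<eta> + \<eta>)
          = C + 2 * (\<theta> * C) + \<theta> * (\<theta> * C) + 4 * (k * \<eta>) + 2 * (\<theta> * (k * \<eta>))"
        by (simp add: algebra_simps)
      then show ?thesis
        using 1 2 3 unfolding \<eta>(2) by linarith
    qed
  qed
  finally show ?thesis
    using coup by blast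
qed

section \<open>Relative entropy\<close>

lemma mult_ln_ge:
  fixes t :: real
  assumes "t \<ge> 0"
  shows "t - 1 \<le> t * ln t"
proof (cases "t = 0")
  case False
  then have t: "t > 0" using assms by auto
  have "t * ln (1 / t) \<le> t * (1 / t - 1)"
    using t ln_le_minus_one[of "1 / t"] by (intro mult_left_mono) auto
  then show ?thesis
    using t by (simp add: ln_div algebra_simps)
qed simp

text \<open>A quadratic bound suffices: it serves to make \<open>f x * ln (f x)\<close> integrable
  for a bounded density \<open>f\<close>.\<close>

lemma abs_mult_ln_le:
  fixes t :: real
  assumes "t \<ge> 0"
  shows "\<bar>t * ln t\<bar> \<le> 1 + t\<^sup>2"
proof (cases "t = 0")
  case False
  then have t: "t > 0" using assms by auto
  have "t * ln t \<le> t * (t - 1)"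
    using t ln_le_minus_one by (intro mult_left_mono) auto
  then show ?thesis
    using t mult_ln_ge[OF assms] zero_le_power2[of t] unfolding power2_eq_square right_diff_distrib
    by (intro abs_leI) linarith+
qed simp

text \<open>Any nonnegative real density agrees almost everywhere with the Radon-Nikodym derivative
  chosen in the definition. Where it vanishes the integrand is 0, in accordance with 0 ln 0 =
  0.\<close>

lemma relative_entropy_density:
  fixes f :: "'a \<Rightarrow> real"
  assumes "sigma_finite_measure M"
    and f[measurable]: "f \<in> borel_measurable M" and nonneg: "\<And>x. 0 \<le> f x"
    and int: "integrable M (\<lambda>x. f x * ln (f x))"
  shows "relative_entropy (density M f) M = ereal (\<integral>x. f x * ln (f x) \<partial>M)"
proof -
  interpret sigma_finite_measure M by fact
  have "density M (RN_deriv M (density M f)) = density M f"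
    by (rule density_RN_deriv_density) measurable
  then have "AE x in M. RN_deriv M (density M f) x = f x"
    by (intro density_unique) auto
  then have "AE x in M. f x * entropy_density (exp 1) M (density M f) x = f x * ln (f x)"
    using nonneg by (auto simp: entropy_density_def log_def)
  then have "integrable M (\<lambda>x. f x * entropy_density (exp 1) M (density M f) x)"
    using int by (subst integrable_cong_AE) auto
  then have "integrable (density M f) (entropy_density (exp 1) M (density M f))"
    using nonneg by (subst integrable_real_density) auto
  moreover have "KL_divergence (exp 1) M (density M f) = (\<integral>x. f x * ln (f x) \<partial>M)"
    using nonneg by (subst KL_density) (auto simp: log_def)
  ultimately show ?thesis
    using absolutely_continuousI_density[of f M] by (simp add: relative_entropy_def)
qed

text \<open>Trades the abstract derivative for a real density that is nonnegative everywhere, not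
  just almost everywhere: it is later composed with \<open>sum_dirac n\<close>, where exceptional
  null sets would be a nuisance.\<close>

lemma relative_entropy_finiteE:
  assumes "sigma_finite_measure M" "sigma_finite_measure N" "sets N = sets M"
    and fin: "relative_entropy N M \<noteq> \<infinity>"
  obtains f :: "'a \<Rightarrow> real" where "f \<in> borel_measurable M" "\<And>x. 0 \<le> f x"
    "N = density M (\<lambda>x. ennreal (f x))" "integrable M (\<lambda>x. f x * ln (f x))"
    "relative_entropy N M = ereal (\<integral>x. f x * ln (f x) \<partial>M)"
proof -
  interpret sigma_finite_measure M by fact
  have ac: "absolutely_continuous M N" and int: "integrable N (entropy_density (exp 1) M N)"
    using fin by (auto simp: relative_entropy_def split: if_splits)
  \<comment> \<open>\<open>enn2real\<close> replaces infinite values by 0; they form a null set by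
    \<open>RN_deriv_finite\<close>.\<close>
  define f where "f x = enn2real (RN_deriv M N x)" for x
  have f[measurable]: "f \<in> borel_measurable M" and nonneg: "\<And>x. 0 \<le> f x"
    by (auto simp: f_def[abs_def])
  have "AE x in M. RN_deriv M N x = ennreal (f x)"
    using RN_deriv_finite[OF assms(2) ac assms(3)] by eventually_elim (auto simp: f_def less_top)
  then have "density M (RN_deriv M N) = density M f"
    by (intro density_cong) auto
  then have N: "N = density M f"
    using density_RN_deriv[OF ac assms(3)] by simp
  have "entropy_density (exp 1) M N = (\<lambda>x. ln (f x))"
    by (auto simp: entropy_density_def log_def f_def)
  then have "integrable (density M f) (\<lambda>x. ln (f x))"
    using int N by simp
  then have fln: "integrable M (\<lambda>x. f x * ln (f x))"
    using nonneg by (subst (asm) integrable_real_density) auto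
  show thesis
    by (rule that[OF f nonneg N fln])
      (use relative_entropy_density[OF assms(1) f nonneg fln] N in simp)
qed

lemma (in prob_space) integral_pos:
  fixes u :: "'a \<Rightarrow> real"
  assumes "integrable M u" "\<And>x. 0 < u x"
  shows "0 < (\<integral>x. u x \<partial>M)"
proof -
  have "(\<integral>x. u x \<partial>M) \<noteq> 0"
    using assms integral_nonneg_eq_0_iff_AE[OF assms(1)] AE_False by (auto simp: less_le)
  moreover have "(\<integral>x. u x \<partial>M) \<ge> 0"
    using assms by (intro Bochner_Integration.integral_nonneg) (auto intro: less_imp_le)
  ultimately show ?thesis by simp
qed

text \<open>Pointwise this is ln s \<le> s - 1 at \<open>s = u x / (h x * U)\<close>, weighted by
  \<open>h x\<close>; the linear terms integrate to 1 - 1. It is the inequality half of the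
  Donsker-Varadhan duality between entropy and log-Laplace functionals.\<close>

lemma (in prob_space) gibbs_variational:
  fixes h u :: "'a \<Rightarrow> real"
  assumes "integrable M h" "\<And>x. 0 \<le> h x" "(\<integral>x. h x \<partial>M) = 1"
    and "integrable M u" "\<And>x. 0 < u x"
    and "integrable M (\<lambda>x. h x * ln (h x))" "integrable M (\<lambda>x. h x * ln (u x))"
  shows "(\<integral>x. h x * ln (u x) \<partial>M) \<le> (\<integral>x. h x * ln (h x) \<partial>M) + ln (\<integral>x. u x \<partial>M)"
proof -
  define U where "U = (\<integral>x. u x \<partial>M)"
  have U: "U > 0"
    using integral_pos assms by (simp add: U_def)
  have "h x * ln (u x) \<le> h x * ln (h x) + u x / U - h x + h x * ln U" for x
  proof (cases "h x = 0")
    case True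
    then show ?thesis using U assms(5)[of x] by simp
  next
    case False
    then have h: "h x > 0" using assms(2)[of x] by simp
    have "h x * ln (u x / (h x * U)) \<le> h x * (u x / (h x * U) - 1)"
      using h U assms(5)[of x] by (intro mult_left_mono ln_le_minus_one) auto
    then show ?thesis
      using h U assms(5)[of x] by (simp add: ln_div ln_mult algebra_simps)
  qed
  then have "(\<integral>x. h x * ln (u x) \<partial>M) \<le> (\<integral>x. h x * ln (h x) + u x / U - h x + h x * ln U \<partial>M)"
    using assms by (intro integral_mono) auto
  also have "\<dots> = (\<integral>x. h x * ln (h x) \<partial>M) + ln U"
    using assms U by (simp add: U_def)
  finally show ?thesis by (simp add: U_def)
qed

section \<open>Tensorization of Talagrand's inequality\<close>

text \<open>Bobkov-Goetze argument: test the inequality on the tilted laws with densities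
  \<open>u x / U\<close> and \<open>v x / V\<close>, where the variational bound for the entropy is
  an equality. With \<open>A\<close> and \<open>B\<close> the means of \<open>ln (u x)\<close> and
  \<open>ln (v x)\<close> under them, every coupling costs at least \<open>a * (A + B)\<close>,
  while the entropies are \<open>A - ln U\<close> and \<open>B - ln V\<close>; what remains is
  \<open>ln U + ln V \<le> 0\<close>. The upper bounds on \<open>u\<close> and \<open>v\<close> make
  these entropies finite.\<close>

lemma talagrand_dual:
  fixes \<mu> :: "'z::polish_space measure" and u v :: "'z \<Rightarrow> real"
  assumes \<mu>: "\<mu> \<in> space (prob_algebra borel)" and "a > 0" and tal: "talagrand_inequality a \<mu>"
    and meas: "u \<in> borel_measurable borel" "v \<in> borel_measurable borel"
    and u: "\<And>x. 0 < u x" "\<And>x. u x \<le> K" and v: "\<And>x. 0 < v x" "\<And>x. v x \<le> K"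
    and dual: "\<And>x y. u x * v y \<le> exp ((dist x y)\<^sup>2 / a)"
  shows "(\<integral>x. u x \<partial>\<mu>) * (\<integral>x. v x \<partial>\<mu>) \<le> 1"
proof -
  interpret prob_space \<mu> using \<mu> by (simp add: space_prob_algebra)
  have sets[measurable_cong]: "sets \<mu> = sets borel"
    using \<mu> by (simp add: space_prob_algebra)
  have tilt: "integrable \<mu> w" "integral\<^sup>L \<mu> w > 0"
      "density \<mu> (\<lambda>x. w x / integral\<^sup>L \<mu> w) \<in> space (prob_algebra borel)"
      "integrable (density \<mu> (\<lambda>x. w x / integral\<^sup>L \<mu> w)) (\<lambda>x. ln (w x))"
      "relative_entropy (density \<mu> (\<lambda>x. w x / integral\<^sup>L \<mu> w)) \<mu> =
        ereal ((\<integral>x. ln (w x) \<partial>density \<mu> (\<lambda>x. w x / integral\<^sup>L \<mu> w)) - ln (integral\<^sup>L \<mu> w))"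
    if [measurable]: "w \<in> borel_measurable borel" and w: "\<And>x. 0 < w x" "\<And>x. w x \<le> K"
    for w :: "'z \<Rightarrow> real"
  proof -
    define W where "W = integral\<^sup>L \<mu> w"
    show int: "integrable \<mu> w"
      using w by (intro integrable_const_bound[where B = K]) (auto simp: abs_of_pos)
    show W: "integral\<^sup>L \<mu> w > 0"
      by (rule integral_pos[OF int w(1)])
    have W': "W > 0" using W by (simp add: W_def)
    define f where "f x = w x / W" for x
    have [measurable]: "f \<in> borel_measurable borel"
      by (simp add: f_def[abs_def])
    have f: "0 \<le> f x" "f x > 0" "f x \<le> K / W" for x
      using w[of x] W' by (auto simp: f_def divide_right_mono)
    have intf: "integrable \<mu> f" "(\<integral>x. f x \<partial>\<mu>) = 1"
      using int W' by (auto simp: f_def[abs_def] W_def)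
    have "emeasure (density \<mu> f) (space (density \<mu> f)) = (\<integral>\<^sup>+x. ennreal (f x) \<partial>\<mu>)"
      by (subst emeasure_density) (auto intro!: nn_integral_cong)
    also have "\<dots> = 1"
      using nn_integral_eq_integral[OF intf(1)] f intf(2) by simp
    finally have "prob_space (density \<mu> f)"
      by (rule prob_spaceI)
    then show "density \<mu> (\<lambda>x. w x / integral\<^sup>L \<mu> w) \<in> space (prob_algebra borel)"
      by (simp add: space_prob_algebra sets f_def[abs_def] W_def)
    have fln: "integrable \<mu> (\<lambda>x. f x * ln (f x))"
    proof (rule integrable_const_bound[where B = "1 + (K / W)\<^sup>2"])
      show "AE x in \<mu>. norm (f x * ln (f x)) \<le> 1 + (K / W)\<^sup>2"
      proof (rule AE_I2)
        fix x
        show "norm (f x * ln (f x)) \<le> 1 + (K / W)\<^sup>2"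
          using abs_mult_ln_le[OF f(1), of x] power_mono[OF f(3)[of x] f(1), where n = 2] by simp
      qed
    qed measurable
    have ln: "f x * ln (w x) = f x * ln (f x) + f x * ln W" for x
      using w(1)[of x] W' by (simp add: f_def ln_div algebra_simps)
    show "integrable (density \<mu> (\<lambda>x. w x / integral\<^sup>L \<mu> w)) (\<lambda>x. ln (w x))"
      unfolding W_def[symmetric] f_def[symmetric] using fln intf f
      by (subst integrable_real_density) (auto simp: ln)
    have "(\<integral>x. ln (w x) \<partial>density \<mu> f) = (\<integral>x. f x * ln (f x) \<partial>\<mu>) + ln W"
      using fln intf f by (subst integral_real_density) (auto simp: ln)
    then show "relative_entropy (density \<mu> (\<lambda>x. w x / integral\<^sup>L \<mu> w)) \<mu> =
        ereal ((\<integral>x. ln (w x) \<partial>density \<mu> (\<lambda>x. w x / integral\<^sup>L \<mu> w)) - ln (integral\<^sup>L \<mu> w))"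
      unfolding W_def[symmetric] f_def[symmetric]
      using f fln by (subst relative_entropy_density) (auto intro: sigma_finite_measure_axioms)
  qed
  define U V where "U = integral\<^sup>L \<mu> u" and "V = integral\<^sup>L \<mu> v"
  note tu = tilt[OF meas(1) u, folded U_def] and tv = tilt[OF meas(2) v, folded V_def]
  define \<nu>\<^sub>1 \<nu>\<^sub>2 where "\<nu>\<^sub>1 = density \<mu> (\<lambda>x. u x / U)" and "\<nu>\<^sub>2 = density \<mu> (\<lambda>x. v x / V)"
  have sets12[measurable_cong]: "sets \<nu>\<^sub>1 = sets borel" "sets \<nu>\<^sub>2 = sets borel"
    by (simp_all add: \<nu>\<^sub>1_def \<nu>\<^sub>2_def sets)
  define A B where "A = (\<integral>x. ln (u x) \<partial>\<nu>\<^sub>1)" and "B = (\<integral>x. ln (v x) \<partial>\<nu>\<^sub>2)"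
  \<comment> \<open>The easy half of duality: take logarithms in \<open>dual\<close> and integrate
    against a coupling.\<close>
  have "ennreal (a * (A + B)) \<le> W2_sq \<nu>\<^sub>1 \<nu>\<^sub>2"
    unfolding W2_sq_def transport_cost_def
  proof (rule INF_greatest)
    fix \<gamma> assume \<gamma>: "\<gamma> \<in> couplings \<nu>\<^sub>1 \<nu>\<^sub>2"
    then have "sets \<gamma> = sets (\<nu>\<^sub>1 \<Otimes>\<^sub>M \<nu>\<^sub>2)"
      by (auto simp: couplings_def space_prob_algebra)
    also have "\<dots> = sets (borel \<Otimes>\<^sub>M borel)"
      by (intro sets_pair_measure_cong sets12)
    finally have [measurable_cong]: "sets \<gamma> = sets (borel \<Otimes>\<^sub>M borel)" .
    have [measurable]: "(\<lambda>z. (dist (fst z) (snd z))\<^sup>2) \<in> borel_measurable (borel \<Otimes>\<^sub>M borel :: ('z \<times> 'z) measure)"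
      by measurable
    show "ennreal (a * (A + B)) \<le> (\<integral>\<^sup>+z. ennreal ((dist (fst z) (snd z))\<^sup>2) \<partial>\<gamma>)"
    proof (cases "(\<integral>\<^sup>+z. ennreal ((dist (fst z) (snd z))\<^sup>2) \<partial>\<gamma>) = \<infinity>")
      case False
      then have int: "integrable \<gamma> (\<lambda>z. (dist (fst z) (snd z))\<^sup>2)"
        by (intro integrableI_bounded) (auto simp: less_top)
      have m: "(\<lambda>x. ln (u x)) \<in> borel_measurable \<nu>\<^sub>1" "(\<lambda>x. ln (v x)) \<in> borel_measurable \<nu>\<^sub>2"
        using meas by auto
      have i1: "integrable \<gamma> (\<lambda>z. ln (u (fst z)))" and i2: "integrable \<gamma> (\<lambda>z. ln (v (snd z)))"
        using integral_coupling(1)[OF \<gamma> m(1)] integral_coupling(3)[OF \<gamma> m(2)] tu(4) tv(4)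
        by (auto simp: \<nu>\<^sub>1_def \<nu>\<^sub>2_def)
      have "a * (A + B) = (\<integral>z. a * (ln (u (fst z)) + ln (v (snd z))) \<partial>\<gamma>)"
        using i1 i2 integral_coupling(2)[OF \<gamma> m(1)] integral_coupling(4)[OF \<gamma> m(2)]
        by (simp add: A_def B_def)
      also have "\<dots> \<le> (\<integral>z. (dist (fst z) (snd z))\<^sup>2 \<partial>\<gamma>)"
      proof (intro integral_mono int integrable_mult_right Bochner_Integration.integrable_add i1 i2)
        fix z
        have "ln (u (fst z)) + ln (v (snd z)) = ln (u (fst z) * v (snd z))"
          using u v by (subst ln_mult) (auto simp: less_imp_neq[THEN not_sym])
        also have "\<dots> \<le> ln (exp ((dist (fst z) (snd z))\<^sup>2 / a))"
          using u v dual by (intro ln_mono) auto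
        finally show "a * (ln (u (fst z)) + ln (v (snd z))) \<le> (dist (fst z) (snd z))\<^sup>2"
          using \<open>a > 0\<close> by (simp add: pos_le_divide_eq mult.commute)
      qed
      finally show ?thesis
        using nn_integral_eq_integral[OF int] by (simp add: ennreal_leI)
    qed simp
  qed
  \<comment> \<open>If \<open>a * (A + B)\<close> is negative, \<open>ennreal\<close> has cut it to
    0, and nonnegativity of the cost gives the bound.\<close>
  then have "ereal (a * (A + B)) \<le> enn2ereal (W2_sq \<nu>\<^sub>1 \<nu>\<^sub>2)"
    using \<open>a > 0\<close> by (metis enn2ereal_ennreal enn2ereal_nonneg ereal_less_eq(5) less_eq_ennreal.rep_eq linear order_trans)
  also have "\<dots> \<le> ereal a * (relative_entropy \<nu>\<^sub>1 \<mu> + relative_entropy \<nu>\<^sub>2 \<mu>)"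
    using tal tu(3) tv(3) by (auto simp: talagrand_inequality_def \<nu>\<^sub>1_def \<nu>\<^sub>2_def)
  also have "\<dots> = ereal (a * ((A - ln U) + (B - ln V)))"
    using tu(5) tv(5) by (simp add: \<nu>\<^sub>1_def \<nu>\<^sub>2_def A_def B_def)
  finally have "ln U + ln V \<le> 0"
    using \<open>a > 0\<close> by simp
  then have "ln (U * V) \<le> 0"
    using tu(2) tv(2) by (simp add: ln_mult)
  then show ?thesis
    using tu(2) tv(2) by (simp add: U_def V_def ln_le_zero_iff)
qed

text \<open>The dual inequality tensorizes by Fubini: freezing the first coordinates leaves a dual pair in the others.\<close>

lemma talagrand_dual_PiM:
  fixes \<mu> :: "'z::polish_space measure" and u v :: "(nat \<Rightarrow> 'z) \<Rightarrow> real"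
  assumes \<mu>: "\<mu> \<in> space (prob_algebra borel)" and "a > 0" and tal: "talagrand_inequality a \<mu>"
    and "u \<in> borel_measurable (\<Pi>\<^sub>M i\<in>UNIV. \<mu>)" "v \<in> borel_measurable (\<Pi>\<^sub>M i\<in>UNIV. \<mu>)"
    and "\<And>x. 0 < u x" "\<And>x. u x \<le> K" and "\<And>x. 0 < v x" "\<And>x. v x \<le> K"
    and "\<And>x y. u x * v y \<le> exp ((\<Sum>i<n. (dist (x i) (y i))\<^sup>2) / a)"
  shows "(\<integral>x. u x \<partial>(\<Pi>\<^sub>M i\<in>UNIV. \<mu>)) * (\<integral>x. v x \<partial>(\<Pi>\<^sub>M i\<in>UNIV. \<mu>)) \<le> 1"
proof -
  interpret \<mu>: prob_space \<mu> using \<mu> by (simp add: space_prob_algebra)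
  have sets[measurable_cong]: "sets \<mu> = sets borel"
    using \<mu> by (simp add: space_prob_algebra)
  interpret sequence_space \<mu> ..
  interpret PP: pair_prob_space \<mu> S ..
  have bounded: "integrable S w"
    if "w \<in> borel_measurable S" "\<And>x. 0 < w x" "\<And>x. w x \<le> K" for w :: "(nat \<Rightarrow> 'z) \<Rightarrow> real" and K
    using that by (intro P.integrable_const_bound[where B = K]) (auto simp: abs_of_pos)
  show ?thesis
    using assms(4-)
  proof (induction n arbitrary: u v K)
    case 0
    \<comment> \<open>With no coordinate compared, \<open>u x * v y \<le> 1\<close> holds for
      unrelated \<open>x\<close> and \<open>y\<close>, so it can be integrated in each
      separately.\<close>
    have "v y * integral\<^sup>L S u \<le> 1" for y
    proof -
      have "v y * integral\<^sup>L S u = (\<integral>x. v y * u x \<partial>S)"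
        by simp
      also have "\<dots> \<le> (\<integral>x. 1 \<partial>S)"
        using "0.prems"(7)[of _ y] bounded[OF "0.prems"(1,3,4)]
        by (intro integral_mono) (auto simp: mult.commute)
      finally show ?thesis by (simp add: P.prob_space)
    qed
    then have "(\<integral>y. v y * integral\<^sup>L S u \<partial>S) \<le> (\<integral>y. 1 \<partial>S)"
      using bounded[OF "0.prems"(2,5,6)] by (intro integral_mono) auto
    then show ?case
      by (simp add: P.prob_space mult.commute)
  next
    case (Suc n)
    note [measurable] = Suc.prems(1,2)
    \<comment> \<open>Integrates out all coordinates but the first; \<open>case_nat s x\<close> puts
      \<open>s\<close> in front of \<open>x\<close>, and \<open>PiM_iter\<close> says that this map
      carries the product of \<open>\<mu>\<close> and \<open>S\<close> to \<open>S\<close>.\<close>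
    define w' where "w' w s = (\<integral>x. w (case_nat s x) \<partial>S)" for w :: "(nat \<Rightarrow> 'z) \<Rightarrow> real" and s
    have w': "w' w \<in> borel_measurable borel" "integrable S (\<lambda>x. w (case_nat s x))"
        "0 < w' w s" "w' w s \<le> K" "integral\<^sup>L S w = (\<integral>s. w' w s \<partial>\<mu>)"
      if [measurable]: "w \<in> borel_measurable S" and w: "\<And>x. 0 < w x" "\<And>x. w x \<le> K" for w s
    proof -
      have "w' w \<in> borel_measurable \<mu>"
        unfolding w'_def[abs_def] by measurable
      then show "w' w \<in> borel_measurable borel"
        by (simp cong: measurable_cong_sets add: sets)
      show int: "integrable S (\<lambda>x. w (case_nat s x))"
      proof (rule bounded)
        show "(\<lambda>x. w (case_nat s x)) \<in> borel_measurable S"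
          by measurable (auto simp: sets_eq_imp_space_eq[OF sets])
      qed (use w in auto)
      show "0 < w' w s"
        unfolding w'_def by (rule P.integral_pos[OF int]) (use w in auto)
      have "w' w s \<le> (\<integral>x. K \<partial>S)"
        unfolding w'_def using int w by (intro integral_mono) auto
      then show "w' w s \<le> K" by (simp add: P.prob_space)
      have "integral\<^sup>L S w = integral\<^sup>L (distr (\<mu> \<Otimes>\<^sub>M S) S (\<lambda>(s, \<omega>). case_nat s \<omega>)) w"
        by (simp add: PiM_iter)
      also have "\<dots> = (\<integral>z. (\<lambda>(s, \<omega>). w (case_nat s \<omega>)) z \<partial>(\<mu> \<Otimes>\<^sub>M S))"
        by (subst integral_distr) (auto simp: split_beta')
      also have "\<dots> = (\<integral>s. w' w s \<partial>\<mu>)"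
        unfolding w'_def
        by (subst PP.integral_fst'[symmetric])
          (auto intro!: PP.integrable_const_bound[where B = K] simp: w abs_of_pos split: prod.split)
      finally show "integral\<^sup>L S w = (\<integral>s. w' w s \<partial>\<mu>)" .
    qed
    note wu = w'[OF Suc.prems(1,3,4)] and wv = w'[OF Suc.prems(2,5,6)]
    have "w' u s * w' v t \<le> exp ((dist s t)\<^sup>2 / a)" for s t
    proof -
      define e where "e = exp (- (dist s t)\<^sup>2 / a)"
      have e: "e > 0" "e \<le> 1"
        using \<open>a > 0\<close> by (auto simp: e_def)
      have "(\<integral>x. e * u (case_nat s x) \<partial>S) * (\<integral>y. v (case_nat t y) \<partial>S) \<le> 1"
      proof (rule Suc.IH)
        show "(\<lambda>x. e * u (case_nat s x)) \<in> borel_measurable S" "(\<lambda>y. v (case_nat t y)) \<in> borel_measurable S"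
          using wu(2) wv(2) by auto
        show "e * u (case_nat s x) \<le> K" for x
          using mult_mono[of e 1 "u (case_nat s x)" K] e Suc.prems(3,4)[of "case_nat s x"] by simp
        show "e * u (case_nat s x) * v (case_nat t y) \<le> exp ((\<Sum>i<n. (dist (x i) (y i))\<^sup>2) / a)" for x y
        proof -
          have "e * (u (case_nat s x) * v (case_nat t y))
              \<le> e * exp ((\<Sum>i<Suc n. (dist (case_nat s x i) (case_nat t y i))\<^sup>2) / a)"
            using e Suc.prems(7) by (intro mult_left_mono) auto
          also have "\<dots> = exp ((\<Sum>i<n. (dist (x i) (y i))\<^sup>2) / a)"
            by (simp add: e_def sum.lessThan_Suc_shift add_divide_distrib exp_add exp_minus del: sum.lessThan_Suc)
          finally show ?thesis by (simp add: mult.assoc)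
        qed
      qed (use e Suc.prems(3-6) in auto)
      then have "e * (w' u s * w' v t) \<le> 1"
        by (simp add: w'_def mult.assoc)
      then show ?thesis
        by (simp add: e_def exp_minus field_simps)
    qed
    then have "(\<integral>s. w' u s \<partial>\<mu>) * (\<integral>s. w' v s \<partial>\<mu>) \<le> 1"
      using wu wv by (intro talagrand_dual[OF \<mu> \<open>a > 0\<close> tal]) auto
    then show ?case
      using wu(5) wv(5) by simp
  qed
qed

text \<open>
  The dual pair consists of the exponential of the truncated squared distance to a cube of positive
  measure and, essentially, the indicator of that cube.
\<close>

lemma talagrand_second_moment:
  fixes \<mu> :: "'z::polish_space measure" and h :: "(nat \<Rightarrow> 'z) \<Rightarrow> real"
  assumes \<mu>: "\<mu> \<in> space (prob_algebra borel)" and "a > 0" and tal: "talagrand_inequality a \<mu>"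
    and h: "integrable (\<Pi>\<^sub>M i\<in>UNIV. \<mu>) h" "\<And>x. 0 \<le> h x" "(\<integral>x. h x \<partial>(\<Pi>\<^sub>M i\<in>UNIV. \<mu>)) = 1"
      "integrable (\<Pi>\<^sub>M i\<in>UNIV. \<mu>) (\<lambda>x. h x * ln (h x))"
  shows "integrable (\<Pi>\<^sub>M i\<in>UNIV. \<mu>) (\<lambda>x. h x * (\<Sum>i<n. (dist (x i) z)\<^sup>2))"
proof -
  interpret \<mu>: prob_space \<mu> using \<mu> by (simp add: space_prob_algebra)
  have sets[measurable_cong]: "sets \<mu> = sets borel"
    using \<mu> by (simp add: space_prob_algebra)
  define S where "S = (\<Pi>\<^sub>M i\<in>(UNIV::nat set). \<mu>)"
  interpret S: prob_space S
    unfolding S_def by (rule prob_space_PiM) unfold_locales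
  have sp: "space S = UNIV"
    using sets_eq_imp_space_eq[OF sets] by (simp add: S_def space_PiM PiE_UNIV_domain)
  note h = h[folded S_def]
  have [measurable]: "h \<in> borel_measurable S"
    using h(1) by simp
  have comp[measurable]: "(\<lambda>x. dist (x i) z) \<in> borel_measurable S" for i
    unfolding S_def by measurable
  \<comment> \<open>Cubes around \<open>z\<close> in the first \<open>n\<close> coordinates exhaust
    the space, so one of them has positive measure.\<close>
  define B where "B k = {x \<in> space S. \<forall>i\<in>{..<n}. dist (x i) z < real k}" for k :: nat
  have B[measurable]: "B k \<in> sets S" for k
    unfolding B_def by measurable
  have "\<exists>k. emeasure S (B k) \<noteq> 0"
  proof (rule ccontr)
    assume *: "\<not> ?thesis"
    have "(\<Union>k. B k) = space S"
    proof safe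
      fix x assume "x \<in> space S"
      obtain k :: nat where "(\<Sum>i<n. dist (x i) z) < real k"
        using reals_Archimedean2 by blast
      moreover have "dist (x i) z \<le> (\<Sum>i<n. dist (x i) z)" if "i < n" for i
        using that by (intro member_le_sum) auto
      ultimately have "x \<in> B k"
        using \<open>x \<in> space S\<close> by (force simp: B_def)
      then show "x \<in> (\<Union>k. B k)" by blast
    qed (auto simp: B_def)
    then show False
      using emeasure_UN_eq_0[of S B] * S.emeasure_space_1 B by (auto simp: image_subset_iff)
  qed
  then obtain r :: nat where "emeasure S (B r) \<noteq> 0" by blast
  then have b: "measure S (B r) > 0"
    by (simp add: S.emeasure_eq_measure less_le)
  \<comment> \<open>\<open>dist (x i) z - r\<close> is a lower bound for the distance from
    \<open>x i\<close> to the i-th coordinate of any point of the cube \<open>B r\<close>.\<close>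
  define g where "g x = (\<Sum>i<n. (max 0 (dist (x i) z - r))\<^sup>2) / a" for x :: "nat \<Rightarrow> 'z"
  have [measurable]: "g \<in> borel_measurable S"
    unfolding g_def[abs_def] by measurable
  have g: "g x \<ge> 0" for x
    using \<open>a > 0\<close> by (simp add: g_def sum_nonneg)
  \<comment> \<open>Does not depend on the truncation level \<open>R\<close>: the dual inequality
    bounds the mean of \<open>u\<close> by \<open>1 / measure S (B r)\<close> for every
    \<open>R \<ge> 0\<close>.\<close>
  define L where "L = (\<integral>x. h x * ln (h x) \<partial>S) + ln (1 / measure S (B r))"
  have intg: "integrable S (\<lambda>x. h x * min R (g x))" if "R \<ge> 0" for R
    by (rule Bochner_Integration.integrable_bound[of S "\<lambda>x. h x * R"])
      (use h g that in \<open>auto simp: abs_mult intro!: mult_left_mono\<close>)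
  have bound: "(\<integral>x. h x * min R (g x) \<partial>S) \<le> L" if "R \<ge> 0" for R
  proof -
    \<comment> \<open>Truncation at \<open>R\<close> makes \<open>u\<close> bounded. Off the cube
      \<open>v\<close> is \<open>exp (- R)\<close> rather than 0, to stay positive, and this is just
      small enough for \<open>u x * v y \<le> 1\<close>.\<close>
    define u where "u x = exp (min R (g x))" for x
    define v where "v x = (if x \<in> B r then 1 else exp (- R))" for x
    have [measurable]: "u \<in> borel_measurable S" "v \<in> borel_measurable S"
      unfolding u_def[abs_def] v_def[abs_def] by measurable
    have u: "0 < u x" "u x \<le> exp R" and v: "0 < v x" "v x \<le> exp R" for x
      using that by (auto simp: u_def v_def)
    have uv: "u x * v y \<le> exp ((\<Sum>i<n. (dist (x i) (y i))\<^sup>2) / a)" for x y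
    proof (cases "y \<in> B r")
      case True
      have "(\<Sum>i<n. (max 0 (dist (x i) z - r))\<^sup>2) \<le> (\<Sum>i<n. (dist (x i) (y i))\<^sup>2)"
      proof (intro sum_mono power_mono)
        fix i assume "i \<in> {..<n}"
        then have "dist (y i) z < r" using True by (auto simp: B_def)
        then show "max 0 (dist (x i) z - r) \<le> dist (x i) (y i)"
          using dist_triangle[of "x i" z "y i"] by auto
      qed auto
      then have "min R (g x) \<le> (\<Sum>i<n. (dist (x i) (y i))\<^sup>2) / a"
        using \<open>a > 0\<close> by (auto simp: g_def divide_right_mono min.coboundedI2)
      then show ?thesis using True by (simp add: u_def v_def)
    next
      case False
      have "u x * v y \<le> exp 0"
        using False by (simp add: u_def v_def flip: exp_add)
      also have "\<dots> \<le> exp ((\<Sum>i<n. (dist (x i) (y i))\<^sup>2) / a)"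
        using \<open>a > 0\<close> by (subst exp_le_cancel_iff) (simp add: sum_nonneg)
      finally show ?thesis .
    qed
    have intu: "integrable S u" and intv: "integrable S v"
      using u v by (auto intro!: S.integrable_const_bound[where B = "exp R"] simp: abs_of_pos)
    have 1: "(\<integral>x. u x \<partial>S) * (\<integral>x. v x \<partial>S) \<le> 1"
      unfolding S_def
      by (rule talagrand_dual_PiM[OF \<mu> \<open>a > 0\<close> tal]) (use u v uv in \<open>auto simp flip: S_def\<close>)
    have "measure S (B r) = (\<integral>x. indicator (B r) x \<partial>S)"
      by simp
    also have "\<dots> \<le> (\<integral>x. v x \<partial>S)"
      by (intro integral_mono integrable_real_indicator intv)
        (auto simp: v_def S.emeasure_eq_measure split: split_indicator)
    finally have "(\<integral>x. u x \<partial>S) * measure S (B r) \<le> (\<integral>x. u x \<partial>S) * (\<integral>x. v x \<partial>S)"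
      using S.integral_pos[OF intu u(1)] by (intro mult_left_mono) auto
    with 1 have "(\<integral>x. u x \<partial>S) \<le> 1 / measure S (B r)"
      using b by (simp add: pos_le_divide_eq)
    then have "ln (\<integral>x. u x \<partial>S) \<le> ln (1 / measure S (B r))"
      using S.integral_pos[OF intu u(1)] by (intro ln_mono) auto
    moreover have "(\<integral>x. h x * ln (u x) \<partial>S) \<le> (\<integral>x. h x * ln (h x) \<partial>S) + ln (\<integral>x. u x \<partial>S)"
      by (intro S.gibbs_variational h intu u(1)) (use intg[OF that] in \<open>simp add: u_def\<close>)
    ultimately show ?thesis
      by (simp add: u_def L_def)
  qed
  \<comment> \<open>Pointwise the supremum is reached once the level \<open>m\<close> is at least
    \<open>g x\<close>, so monotone convergence removes the truncation.\<close>
  have "(\<integral>\<^sup>+x. ennreal (h x * g x) \<partial>S) \<le> (\<integral>\<^sup>+x. (SUP m. ennreal (h x * min (real m) (g x))) \<partial>S)"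
  proof (intro nn_integral_mono SUP_upper2)
    fix x
    show "ennreal (h x * g x) \<le> ennreal (h x * min (real (nat \<lceil>g x\<rceil>)) (g x))"
      by (simp add: min_absorb2 real_nat_ceiling_ge)
  qed simp
  also have "\<dots> = (SUP m. \<integral>\<^sup>+x. ennreal (h x * min (real m) (g x)) \<partial>S)"
    using h(2) by (intro nn_integral_monotone_convergence_SUP)
      (auto simp: incseq_def le_fun_def intro!: ennreal_leI mult_left_mono)
  also have "\<dots> \<le> ennreal L"
  proof (rule SUP_least)
    fix m :: nat
    show "(\<integral>\<^sup>+x. ennreal (h x * min (real m) (g x)) \<partial>S) \<le> ennreal L"
      using intg[of "real m"] bound[of "real m"] h(2) g
      by (subst nn_integral_eq_integral) (auto intro: ennreal_leI)
  qed
  finally have "integrable S (\<lambda>x. h x * g x)"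
    using h(2) g by (intro integrableI_nonneg) (auto simp: le_less_trans)
  then have "integrable S (\<lambda>x. 2 * a * (h x * g x) + 2 * (real n * (real r)\<^sup>2) * h x)"
    using h(1) by auto
  then have "integrable S (\<lambda>x. h x * (\<Sum>i<n. (dist (x i) z)\<^sup>2))"
  proof (rule Bochner_Integration.integrable_bound)
    show "AE x in S. norm (h x * (\<Sum>i<n. (dist (x i) z)\<^sup>2))
        \<le> norm (2 * a * (h x * g x) + 2 * (real n * (real r)\<^sup>2) * h x)"
    proof (rule AE_I2)
      fix x
      have "(\<Sum>i<n. (dist (x i) z)\<^sup>2) \<le> (\<Sum>i<n. 2 * (max 0 (dist (x i) z - r))\<^sup>2 + 2 * (real r)\<^sup>2)"
      proof (rule sum_mono)
        fix i
        have "(dist (x i) z)\<^sup>2 \<le> (max 0 (dist (x i) z - r) + r)\<^sup>2"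
          by (intro power_mono) auto
        also have "\<dots> \<le> 2 * (max 0 (dist (x i) z - r))\<^sup>2 + 2 * (real r)\<^sup>2"
          using zero_le_power2[of "max 0 (dist (x i) z - r) - r"]
          unfolding power2_sum power2_diff by simp
        finally show "(dist (x i) z)\<^sup>2 \<le> 2 * (max 0 (dist (x i) z - r))\<^sup>2 + 2 * (real r)\<^sup>2" .
      qed
      also have "\<dots> = 2 * a * g x + 2 * (real n * (real r)\<^sup>2)"
        using \<open>a > 0\<close> by (simp add: g_def sum.distrib flip: sum_distrib_left)
      finally have "h x * (\<Sum>i<n. (dist (x i) z)\<^sup>2) \<le> h x * (2 * a * g x + 2 * (real n * (real r)\<^sup>2))"
        using h(2) by (intro mult_left_mono) auto
      moreover have "h x * (\<Sum>i<n. (dist (x i) z)\<^sup>2) \<ge> 0"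
        using h(2) by (simp add: sum_nonneg)
      ultimately show "norm (h x * (\<Sum>i<n. (dist (x i) z)\<^sup>2))
        \<le> norm (2 * a * (h x * g x) + 2 * (real n * (real r)\<^sup>2) * h x)"
        by (simp add: algebra_simps)
    qed
  qed measurable
  then show ?thesis by (simp add: S_def)
qed

text \<open>Kantorovich duality reduces the claim to potentials \<open>\<phi>\<close> and
  \<open>\<psi>\<close>. The functions \<open>exp (\<phi> x / a)\<close> and
  \<open>exp (\<psi> x / a)\<close> form a pair for the tensorized dual inequality, and the
  variational bound applied to each bounds the means of \<open>\<phi> x / a\<close> and
  \<open>\<psi> x / a\<close> by the entropies plus logarithms whose sum is at most 0. The constant
  \<open>a\<close> is the same for every \<open>n\<close>.\<close>

lemma talagrand_coupling_PiM:
  fixes \<mu> :: "'z::polish_space measure" and h\<^sub>1 h\<^sub>2 :: "(nat \<Rightarrow> 'z) \<Rightarrow> real"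
  assumes \<mu>: "\<mu> \<in> space (prob_algebra borel)" and "a > 0" and tal: "talagrand_inequality a \<mu>"
    and h1: "integrable (\<Pi>\<^sub>M i\<in>UNIV. \<mu>) h\<^sub>1" "\<And>x. 0 \<le> h\<^sub>1 x" "(\<integral>x. h\<^sub>1 x \<partial>(\<Pi>\<^sub>M i\<in>UNIV. \<mu>)) = 1"
      "integrable (\<Pi>\<^sub>M i\<in>UNIV. \<mu>) (\<lambda>x. h\<^sub>1 x * ln (h\<^sub>1 x))"
    and h2: "integrable (\<Pi>\<^sub>M i\<in>UNIV. \<mu>) h\<^sub>2" "\<And>x. 0 \<le> h\<^sub>2 x" "(\<integral>x. h\<^sub>2 x \<partial>(\<Pi>\<^sub>M i\<in>UNIV. \<mu>)) = 1"
      "integrable (\<Pi>\<^sub>M i\<in>UNIV. \<mu>) (\<lambda>x. h\<^sub>2 x * ln (h\<^sub>2 x))"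
    and "\<epsilon> > 0"
  shows "\<exists>\<gamma>\<in>couplings (density (\<Pi>\<^sub>M i\<in>UNIV. \<mu>) h\<^sub>1) (density (\<Pi>\<^sub>M i\<in>UNIV. \<mu>) h\<^sub>2).
    (\<integral>\<^sup>+z. ennreal (\<Sum>i<n. (dist (fst z i) (snd z i))\<^sup>2) \<partial>\<gamma>)
      \<le> ennreal (a * ((\<integral>x. h\<^sub>1 x * ln (h\<^sub>1 x) \<partial>(\<Pi>\<^sub>M i\<in>UNIV. \<mu>))
          + (\<integral>x. h\<^sub>2 x * ln (h\<^sub>2 x) \<partial>(\<Pi>\<^sub>M i\<in>UNIV. \<mu>))) + \<epsilon>)"
proof -
  interpret \<mu>: prob_space \<mu> using \<mu> by (simp add: space_prob_algebra)
  have sets[measurable_cong]: "sets \<mu> = sets borel"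
    using \<mu> by (simp add: space_prob_algebra)
  define S where "S = (\<Pi>\<^sub>M i\<in>(UNIV::nat set). \<mu>)"
  interpret S: prob_space S
    unfolding S_def by (rule prob_space_PiM) unfold_locales
  have "sets S = sets (\<Pi>\<^sub>M i\<in>(UNIV::nat set). (borel :: 'z measure))"
    unfolding S_def by (intro sets_PiM_cong sets refl)
  then have setsS[measurable_cong]: "sets S = sets borel"
    by (simp add: sets_PiM_equal_borel)
  note h1' = h1[folded S_def] and h2' = h2[folded S_def]
  have [measurable]: "h\<^sub>1 \<in> borel_measurable S" "h\<^sub>2 \<in> borel_measurable S"
    using h1'(1) h2'(1) by auto
  \<comment> \<open>Only a pseudometric on sequences: it vanishes when the first \<open>n\<close>
    entries agree.\<close>
  define \<rho> :: "(nat \<Rightarrow> 'z) \<Rightarrow> (nat \<Rightarrow> 'z) \<Rightarrow> real" where "\<rho> x y = L2_set (\<lambda>i. dist (x i) (y i)) {..<n}" for x y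
  have sq: "(\<rho> x y)\<^sup>2 = (\<Sum>i<n. (dist (x i) (y i))\<^sup>2)" for x y
    by (simp add: \<rho>_def L2_set_def sum_nonneg)
  have prob: "prob_space (density S h)" if "integrable S h" "\<And>x. 0 \<le> h x" "(\<integral>x. h x \<partial>S) = 1" for h
  proof (rule prob_spaceI)
    have [measurable]: "h \<in> borel_measurable S"
      using that by auto
    have "emeasure (density S h) (space (density S h)) = (\<integral>\<^sup>+x. ennreal (h x) \<partial>S)"
      by (subst emeasure_density) (auto intro!: nn_integral_cong)
    then show "emeasure (density S h) (space (density S h)) = 1"
      using nn_integral_eq_integral[OF that(1)] that(2,3) by simp
  qed
  define z :: 'z where "z = undefined"
  have mom: "integrable (density S h) (\<lambda>x. (\<rho> x (\<lambda>_. z))\<^sup>2)"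
    if "integrable S h" "\<And>x. 0 \<le> h x" "(\<integral>x. h x \<partial>S) = 1" "integrable S (\<lambda>x. h x * ln (h x))" for h
  proof -
    have "(\<lambda>x. dist (x i) z) \<in> borel_measurable S" for i
      unfolding S_def by measurable
    then have "(\<lambda>x. (\<rho> x (\<lambda>_. z))\<^sup>2) \<in> borel_measurable S"
      unfolding sq by (intro borel_measurable_sum borel_measurable_power)
    then show ?thesis
      using talagrand_second_moment[OF \<mu> \<open>a > 0\<close> tal that(1-4)[unfolded S_def], where n = n and z = z, folded S_def] that
      by (subst integrable_real_density) (auto simp: sq)
  qed
  have "\<exists>\<gamma>\<in>couplings (density S h\<^sub>1) (density S h\<^sub>2). (\<integral>\<^sup>+z. ennreal ((\<rho> (fst z) (snd z))\<^sup>2) \<partial>\<gamma>)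
      \<le> ennreal (a * ((\<integral>x. h\<^sub>1 x * ln (h\<^sub>1 x) \<partial>S) + (\<integral>x. h\<^sub>2 x * ln (h\<^sub>2 x) \<partial>S)) + \<epsilon>)"
  proof (rule kantorovich_coupling)
    have "continuous_on UNIV (\<lambda>z :: (nat \<Rightarrow> 'z) \<times> (nat \<Rightarrow> 'z). fst z i)"
      "continuous_on UNIV (\<lambda>z :: (nat \<Rightarrow> 'z) \<times> (nat \<Rightarrow> 'z). snd z i)" for i :: nat
      by (rule continuous_on_product_then_coordinatewise,
          (rule continuous_on_fst continuous_on_snd continuous_on_id)+)+
    then show "continuous_on UNIV (\<lambda>z. \<rho> (fst z) (snd z))"
      unfolding \<rho>_def L2_set_def
      by (intro continuous_on_real_sqrt continuous_on_sum continuous_on_power continuous_on_dist)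
    show "\<rho> x z \<le> \<rho> x y + \<rho> y z" for x y z
    proof -
      have "\<rho> x z \<le> L2_set (\<lambda>i. dist (x i) (y i) + dist (y i) (z i)) {..<n}"
        unfolding \<rho>_def by (intro L2_set_mono dist_triangle) auto
      also have "\<dots> \<le> \<rho> x y + \<rho> y z"
        unfolding \<rho>_def by (rule L2_set_triangle_ineq)
      finally show ?thesis .
    qed
    show "\<rho> x x = 0" for x
      by (simp add: \<rho>_def L2_set_def)
    show "\<rho> x y = \<rho> y x" for x y
      by (simp add: \<rho>_def dist_commute)
    show "prob_space (density S h\<^sub>1)" "prob_space (density S h\<^sub>2)"
      using prob h1' h2' by auto
    show "integrable (density S h\<^sub>1) (\<lambda>x. (\<rho> x (\<lambda>_. z))\<^sup>2)" "integrable (density S h\<^sub>2) (\<lambda>x. (\<rho> x (\<lambda>_. z))\<^sup>2)"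
      using mom h1' h2' by auto
    fix \<phi> \<psi> :: "(nat \<Rightarrow> 'z) \<Rightarrow> real" and K
    assume [measurable]: "\<phi> \<in> borel_measurable borel" "\<psi> \<in> borel_measurable borel"
      and K: "\<And>x. \<phi> x \<le> K" "\<And>x. \<psi> x \<le> K"
      and int: "integrable (density S h\<^sub>1) \<phi>" "integrable (density S h\<^sub>2) \<psi>"
      and feas: "\<And>x y. \<phi> x + \<psi> y \<le> (\<rho> x y)\<^sup>2"
    define u where "u x = exp (\<phi> x / a)" for x
    define v where "v x = exp (\<psi> x / a)" for x
    have [measurable]: "u \<in> borel_measurable S" "v \<in> borel_measurable S"
      unfolding u_def[abs_def] v_def[abs_def] by measurable
    have u: "0 < u x" "u x \<le> exp (K / a)" and v: "0 < v x" "v x \<le> exp (K / a)" for x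
      using K \<open>a > 0\<close> by (auto simp: u_def v_def divide_right_mono)
    have uv: "u x * v y \<le> exp ((\<Sum>i<n. (dist (x i) (y i))\<^sup>2) / a)" for x y
      using feas[of x y] \<open>a > 0\<close>
      by (simp add: u_def v_def sq divide_right_mono flip: exp_add add_divide_distrib)
    have intu: "integrable S u" and intv: "integrable S v"
      using u v by (auto intro!: S.integrable_const_bound[where B = "exp (K / a)"] simp: abs_of_pos)
    note pos = S.integral_pos[OF intu u(1)] S.integral_pos[OF intv v(1)]
    have "(\<integral>x. u x \<partial>S) * (\<integral>x. v x \<partial>S) \<le> 1"
      unfolding S_def
      by (rule talagrand_dual_PiM[OF \<mu> \<open>a > 0\<close> tal]) (use u v uv in \<open>auto simp flip: S_def\<close>)
    then have "ln ((\<integral>x. u x \<partial>S) * (\<integral>x. v x \<partial>S)) \<le> 0"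
      using pos by (intro ln_le_zero_iff[THEN iffD2]) auto
    then have "ln (\<integral>x. u x \<partial>S) + ln (\<integral>x. v x \<partial>S) \<le> 0"
      using pos by (subst (asm) ln_mult) auto
    moreover have i1: "integrable S (\<lambda>x. h\<^sub>1 x * \<phi> x)" and i2: "integrable S (\<lambda>x. h\<^sub>2 x * \<psi> x)"
      using int h1' h2' by (auto simp: integrable_real_density)
    have "(\<integral>x. h\<^sub>1 x * ln (u x) \<partial>S) \<le> (\<integral>x. h\<^sub>1 x * ln (h\<^sub>1 x) \<partial>S) + ln (\<integral>x. u x \<partial>S)"
      by (intro S.gibbs_variational h1' intu u(1)) (use i1 in \<open>simp add: u_def\<close>)
    moreover have "(\<integral>x. h\<^sub>2 x * ln (v x) \<partial>S) \<le> (\<integral>x. h\<^sub>2 x * ln (h\<^sub>2 x) \<partial>S) + ln (\<integral>x. v x \<partial>S)"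
      by (intro S.gibbs_variational h2' intv v(1)) (use i2 in \<open>simp add: v_def\<close>)
    moreover have "(\<integral>x. h\<^sub>1 x * ln (u x) \<partial>S) = (\<integral>x. \<phi> x \<partial>density S h\<^sub>1) / a"
      using h1' by (subst integral_real_density) (auto simp: u_def)
    moreover have "(\<integral>x. h\<^sub>2 x * ln (v x) \<partial>S) = (\<integral>x. \<psi> x \<partial>density S h\<^sub>2) / a"
      using h2' by (subst integral_real_density) (auto simp: v_def)
    ultimately have "((\<integral>x. \<phi> x \<partial>density S h\<^sub>1) + (\<integral>x. \<psi> x \<partial>density S h\<^sub>2)) / a
        \<le> (\<integral>x. h\<^sub>1 x * ln (h\<^sub>1 x) \<partial>S) + (\<integral>x. h\<^sub>2 x * ln (h\<^sub>2 x) \<partial>S)"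
      by (simp add: add_divide_distrib)
    then show "(\<integral>x. \<phi> x \<partial>density S h\<^sub>1) + (\<integral>x. \<psi> x \<partial>density S h\<^sub>2)
        \<le> a * ((\<integral>x. h\<^sub>1 x * ln (h\<^sub>1 x) \<partial>S) + (\<integral>x. h\<^sub>2 x * ln (h\<^sub>2 x) \<partial>S))"
      using \<open>a > 0\<close> by (simp add: pos_divide_le_eq mult.commute)
  qed (use \<open>\<epsilon> > 0\<close> in \<open>auto simp: \<rho>_def setsS L2_set_nonneg\<close>)
  then show ?thesis
    by (simp add: sq S_def)
qed

section \<open>Random measures\<close>

lemma space_borel_weak[simp]: "space borel_weak = finite_borel_measures"
  by (simp add: borel_weak_def space_measure_of_conv)

lemma topspace_weak_topology: "topspace weak_topology = (finite_borel_measures :: 'z::topological_space measure set)"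
proof -
  have "\<exists>(f :: 'z \<Rightarrow> real) U. finite_borel_measures = {\<eta> \<in> finite_borel_measures. (\<integral>z. f z \<partial>\<eta>) \<in> U}
      \<and> continuous_on UNIV f \<and> bounded (range f) \<and> open U"
    by (rule exI[of _ "\<lambda>_. 0"], rule exI[of _ UNIV]) auto
  then show ?thesis
    unfolding weak_topology_def topology_generated_by_topspace by blast
qed

lemma openin_weak_topology_subset:
  "openin weak_topology U \<Longrightarrow> U \<subseteq> (finite_borel_measures :: 'z::topological_space measure set)"
  using openin_subset topspace_weak_topology by metis

lemma sets_borel_weak: "sets borel_weak = sigma_sets finite_borel_measures {U. openin weak_topology U}"
  unfolding borel_weak_def
  by (rule sets_measure_of) (use openin_weak_topology_subset in blast)

text \<open>Weakly open sets are arbitrary unions of finite intersections of subbasic ones;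
  continuity of \<open>T\<close>, unlike measurability of the individual integrals, passes from the
  subbase to all of them without an appeal to a countable base.\<close>

lemma measurable_borel_weakI:
  fixes T :: "'x::topological_space \<Rightarrow> 'z::topological_space measure"
  assumes T: "\<And>x. T x \<in> finite_borel_measures"
    and cont: "\<And>f :: 'z \<Rightarrow> real. continuous_on UNIV f \<Longrightarrow> bounded (range f) \<Longrightarrow>
      continuous_on UNIV (\<lambda>x. \<integral>z. f z \<partial>T x)"
  shows "T \<in> measurable borel borel_weak"
proof (rule measurable_sigma_sets[OF sets_borel_weak])
  show "{U. openin weak_topology U} \<subseteq> Pow (finite_borel_measures :: 'z measure set)"
    by (use openin_weak_topology_subset in blast)
  show "T \<in> space borel \<rightarrow> finite_borel_measures"
    using T by auto
  have "continuous_map euclidean weak_topology T"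
    unfolding weak_topology_def
  proof (rule continuous_on_generated_topo)
    fix U
    assume "U \<in> {{\<eta> \<in> finite_borel_measures. (\<integral>z. f z \<partial>\<eta>) \<in> U} | (f :: 'z \<Rightarrow> real) U.
        continuous_on UNIV f \<and> bounded (range f) \<and> open U}"
    then obtain f :: "'z \<Rightarrow> real" and V where U: "U = {\<eta> \<in> finite_borel_measures. (\<integral>z. f z \<partial>\<eta>) \<in> V}"
      and f: "continuous_on UNIV f" "bounded (range f)" and "open V"
      by blast
    have "T -` U = (\<lambda>x. \<integral>z. f z \<partial>T x) -` V"
      using T by (auto simp: U)
    then show "openin euclidean (T -` U \<inter> topspace euclidean)"
      using open_vimage[OF \<open>open V\<close> cont[OF f]] by simp
  next
    show "T ` topspace euclidean \<subseteq> \<Union> {{\<eta> \<in> finite_borel_measures. (\<integral>z. f z \<partial>\<eta>) \<in> U} | (f :: 'z \<Rightarrow> real) U.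
        continuous_on UNIV f \<and> bounded (range f) \<and> open U}"
      using T topspace_weak_topology[where ?'z = 'z]
      unfolding weak_topology_def topology_generated_by_topspace by auto
  qed
  then show "T -` U \<inter> space borel \<in> sets borel" if "U \<in> {U. openin weak_topology U}" for U
    using openin_continuous_map_preimage[of euclidean weak_topology T U] that by (simp add: vimage_def)
qed

text \<open>The total mass is the integral of the constant 1, so the preimage of an open set belongs
  to the subbase.\<close>

lemma measure_UNIV_measurable[measurable]:
  "(\<lambda>\<eta>. measure \<eta> UNIV) \<in> borel_measurable (borel_weak :: 'z::topological_space measure measure)"
proof (rule borel_measurableI)
  fix U :: "real set" assume "open U"
  have eq: "(\<integral>z. 1 \<partial>\<eta>) = measure \<eta> UNIV" if "\<eta> \<in> finite_borel_measures" for \<eta> :: "'z measure"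
    using that sets_eq_imp_space_eq[of \<eta> borel] by (simp add: finite_borel_measures_def)
  have "openin weak_topology {\<eta> \<in> finite_borel_measures. (\<integral>z. 1 \<partial>(\<eta> :: 'z measure)) \<in> U}"
    unfolding weak_topology_def
    by (rule topology_generated_by_Basis) (use \<open>open U\<close> in \<open>auto intro!: exI[of _ "\<lambda>_. 1"] exI[of _ U]\<close>)
  also have "{\<eta> \<in> finite_borel_measures. (\<integral>z. 1 \<partial>(\<eta> :: 'z measure)) \<in> U}
      = (\<lambda>\<eta>. measure \<eta> UNIV) -` U \<inter> space borel_weak"
    using eq by auto
  finally show "(\<lambda>\<eta>. measure \<eta> UNIV) -` U \<inter> space borel_weak \<in> sets (borel_weak :: 'z measure measure)"
    by (auto simp: sets_borel_weak)
qed

section \<open>Finite sums of Dirac masses\<close>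

lemma
  fixes x :: "nat \<Rightarrow> 'z::topological_space"
  shows sets_sum_dirac[simp]: "sets (sum_dirac n x) = sets borel"
    and space_sum_dirac[simp]: "space (sum_dirac n x) = UNIV"
    and emeasure_sum_dirac: "A \<in> sets borel \<Longrightarrow> emeasure (sum_dirac n x) A = (\<Sum>i<n. indicator A (x i))"
proof -
  have alg: "sets borel \<subseteq> Pow (UNIV :: 'z set)" by auto
  show "sets (sum_dirac n x) = sets borel"
    unfolding sum_dirac_def using sets.sigma_algebra_axioms[of "borel :: 'z measure"]
    by (simp add: sets_measure_of_conv sigma_algebra.sigma_sets_eq)
  show "space (sum_dirac n x) = UNIV"
    by (simp add: sum_dirac_def space_measure_of_conv)
  \<comment> \<open>\<open>measure_of\<close> falls back to the zero measure unless the set function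
    is a measure, so countable additivity has to be checked before the formula can be read
    off.\<close>
  show "emeasure (sum_dirac n x) A = (\<Sum>i<n. indicator A (x i))" if "A \<in> sets borel"
    unfolding sum_dirac_def
  proof (subst emeasure_measure_of_sigma)
    show "sigma_algebra UNIV (sets (borel :: 'z measure))"
      using sets.sigma_algebra_axioms[of "borel :: 'z measure"] by simp
    show "positive (sets borel) (\<lambda>A. \<Sum>i<n. emeasure (return borel (x i)) A)"
      by (auto simp: positive_def)
    show "countably_additive (sets borel) (\<lambda>A. \<Sum>i<n. emeasure (return borel (x i)) A)"
    proof (rule countably_additiveI)
      fix A :: "nat \<Rightarrow> 'z set"
      assume A: "range A \<subseteq> sets borel" "disjoint_family A" "(\<Union>i. A i) \<in> sets borel"
      then have "(\<Sum>k. emeasure (return borel (x i)) (A k)) = emeasure (return borel (x i)) (\<Union>k. A k)" for i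
        by (intro suminf_emeasure) auto
      then show "(\<Sum>k. \<Sum>i<n. emeasure (return borel (x i)) (A k)) = (\<Sum>i<n. emeasure (return borel (x i)) (\<Union>k. A k))"
        by (subst suminf_sum) auto
    qed
    show "A \<in> sets borel" by fact
    show "(\<Sum>i<n. emeasure (return borel (x i)) A) = (\<Sum>i<n. indicator A (x i))"
      using that by (intro sum.cong) auto
  qed
qed

lemma emeasure_sum_dirac_UNIV: "emeasure (sum_dirac n x) UNIV = of_nat n"
  by (simp add: emeasure_sum_dirac)

lemma measure_sum_dirac_UNIV: "measure (sum_dirac n x) UNIV = real n"
  by (simp add: measure_def emeasure_sum_dirac_UNIV flip: ennreal_of_nat_eq_real_of_nat)

lemma sum_dirac_in_finite_borel_measures: "sum_dirac n x \<in> finite_borel_measures"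
  by (auto simp: finite_borel_measures_def emeasure_sum_dirac_UNIV intro!: finite_measureI)

text \<open>Seen as an image of counting measure, it turns integrals into finite sums.\<close>

lemma sum_dirac_eq_distr:
  "sum_dirac n x = distr (count_space {..<n}) borel x"
proof (rule measure_eqI)
  fix A assume "A \<in> sets (sum_dirac n x)"
  then have A: "A \<in> sets borel" by simp
  have "emeasure (distr (count_space {..<n}) borel x) A = (\<integral>\<^sup>+i. indicator A (x i) \<partial>count_space {..<n})"
    using A nn_integral_distr[of x "count_space {..<n}" borel "indicator A"] by simp
  then show "emeasure (sum_dirac n x) A = emeasure (distr (count_space {..<n}) borel x) A"
    using A by (simp add: emeasure_sum_dirac nn_integral_count_space_finite)
qed simp

lemma integral_sum_dirac:
  fixes f :: "'z::topological_space \<Rightarrow> real"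
  assumes [measurable]: "f \<in> borel_measurable borel"
  shows "(\<integral>z. f z \<partial>sum_dirac n x) = (\<Sum>i<n. f (x i))"
  by (simp add: sum_dirac_eq_distr integral_distr lebesgue_integral_count_space_finite)

lemma sum_dirac_measurable:
  "(\<lambda>x. sum_dirac n x) \<in> measurable borel (borel_weak :: 'z::topological_space measure measure)"
proof (rule measurable_borel_weakI)
  fix f :: "'z \<Rightarrow> real" assume f: "continuous_on UNIV f"
  have "continuous_on UNIV (\<lambda>x. \<Sum>i<n. f (x i))"
    by (intro continuous_on_sum continuous_on_compose2[OF f] continuous_on_product_coordinates) auto
  then show "continuous_on UNIV (\<lambda>x. \<integral>z. f z \<partial>sum_dirac n x)"
    using f by (simp add: integral_sum_dirac borel_measurable_continuous_onI)
qed (rule sum_dirac_in_finite_borel_measures)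

text \<open>Matching \<open>x i\<close> with \<open>y i\<close> is a coupling of the normalized empirical measures.\<close>

lemma W2_sq_fin_sum_dirac_le:
  fixes x y :: "nat \<Rightarrow> 'z::polish_space"
  shows "W2_sq_fin (sum_dirac n x) (sum_dirac n y) \<le> ennreal (\<Sum>i<n. (dist (x i) (y i))\<^sup>2)"
proof (cases "n = 0")
  case True
  then show ?thesis by (simp add: W2_sq_fin_def emeasure_sum_dirac_UNIV)
next
  case False
  \<comment> \<open>A uniform random index realizes both normalized measures at once.\<close>
  define P where "P = measure_pmf (pmf_of_set {..<n})"
  interpret P: prob_space P unfolding P_def by (rule prob_space_measure_pmf)
  have nnP: "(\<integral>\<^sup>+i. f i \<partial>P) = (\<Sum>i<n. f i) / of_nat n" for f :: "nat \<Rightarrow> ennreal"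
    using False unfolding P_def by (subst nn_integral_pmf_of_set) auto
  define \<gamma> where "\<gamma> = distr P (borel \<Otimes>\<^sub>M borel) (\<lambda>i. (x i, y i))"
  have m: "f \<in> measurable P N" if "\<And>i. f i \<in> space N" for f and N :: "'b measure"
    using that by (auto simp: P_def)
  define D where "D w = scale_measure (1 / of_nat n) (sum_dirac n w)" for w :: "nat \<Rightarrow> 'z"
  have D: "distr P borel w = D w" for w
  proof (rule measure_eqI)
    fix A assume "A \<in> sets (distr P borel w)"
    then have A: "A \<in> sets borel" by simp
    have "emeasure (distr P borel w) A = (\<integral>\<^sup>+i. indicator A (w i) \<partial>P)"
      using A nn_integral_distr[of w P borel "indicator A"] m[of w borel] by simp
    also have "\<dots> = emeasure (D w) A"
      using A by (simp add: nnP D_def emeasure_sum_dirac divide_ennreal_def mult.commute)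
    finally show "emeasure (distr P borel w) A = emeasure (D w) A" .
  qed (simp add: D_def)
  have probD: "prob_space (D w)" for w
    unfolding D[symmetric] by (intro P.prob_space_distr m) simp
  have setsD[measurable_cong]: "sets (D w) = sets borel" for w
    by (simp add: D_def)
  have \<gamma>_meas: "(\<lambda>i. (x i, y i)) \<in> measurable P (borel \<Otimes>\<^sub>M borel)"
    by (rule m) (simp add: space_pair_measure)
  have "\<gamma> \<in> couplings (D x) (D y)"
  proof (rule couplingsI[OF probD])
    show "sets \<gamma> = sets (D x \<Otimes>\<^sub>M D y)"
      unfolding \<gamma>_def sets_distr by (intro sets_pair_measure_cong) (auto simp: setsD)
    have "distr \<gamma> (D x) fst = distr \<gamma> borel fst" "distr \<gamma> (D y) snd = distr \<gamma> borel snd"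
      by (auto intro!: distr_cong simp: setsD)
    moreover have "distr \<gamma> borel fst = distr P borel x" "distr \<gamma> borel snd = distr P borel y"
      unfolding \<gamma>_def using \<gamma>_meas by (simp_all add: distr_distr comp_def)
    ultimately show "distr \<gamma> (D x) fst = D x" "distr \<gamma> (D y) snd = D y"
      by (simp_all add: D)
  qed
  then have "W2_sq (D x) (D y) \<le> (\<integral>\<^sup>+z. ennreal ((dist (fst z) (snd z))\<^sup>2) \<partial>\<gamma>)"
    unfolding W2_sq_def transport_cost_def by (rule INF_lower)
  also have "\<dots> = (\<integral>\<^sup>+i. ennreal ((dist (x i) (y i))\<^sup>2) \<partial>P)"
    unfolding \<gamma>_def using \<gamma>_meas by (subst nn_integral_distr) auto
  also have "\<dots> = ennreal (\<Sum>i<n. (dist (x i) (y i))\<^sup>2) / of_nat n"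
    by (simp add: nnP)
  finally have "of_nat n * W2_sq (D x) (D y) \<le> of_nat n * (ennreal (\<Sum>i<n. (dist (x i) (y i))\<^sup>2) / of_nat n)"
    by (rule mult_left_mono) simp
  \<comment> \<open>The mass factor in \<open>W2_sq_fin\<close> cancels the normalization, so the
    bound carries no factor \<open>n\<close>.\<close>
  also have "\<dots> = ennreal (\<Sum>i<n. (dist (x i) (y i))\<^sup>2)"
    using False by (subst ennreal_times_divide, subst mult.commute, subst ennreal_mult_divide_eq) auto
  finally show ?thesis
    using False by (simp add: W2_sq_fin_def emeasure_sum_dirac_UNIV D_def Let_def)
qed

lemma sum_dirac_measurable_pair:
  assumes "sets \<mu> = sets (borel :: 'z::polish_space measure)"
  shows "(\<lambda>(n, x). sum_dirac n x) \<in> measurable (measure_pmf \<kappa> \<Otimes>\<^sub>M (\<Pi>\<^sub>M i\<in>UNIV. \<mu>)) borel_weak"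
    and "sum_dirac n \<in> measurable (\<Pi>\<^sub>M i\<in>UNIV. \<mu>) borel_weak"
proof -
  have "sets (\<Pi>\<^sub>M i\<in>(UNIV::nat set). \<mu>) = sets (\<Pi>\<^sub>M i\<in>(UNIV::nat set). (borel :: 'z measure))"
    by (intro sets_PiM_cong assms refl)
  then have S: "sets (\<Pi>\<^sub>M i\<in>(UNIV::nat set). \<mu>) = sets borel"
    by (simp add: sets_PiM_equal_borel)
  show T: "sum_dirac n \<in> measurable (\<Pi>\<^sub>M i\<in>UNIV. \<mu>) borel_weak" for n
    using sum_dirac_measurable[of n] by (simp cong: measurable_cong_sets add: S)
  have "(\<lambda>(n, x). sum_dirac n x) \<in> measurable (count_space UNIV \<Otimes>\<^sub>M (\<Pi>\<^sub>M i\<in>UNIV. \<mu>)) borel_weak"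
    by (rule measurable_pair_measure_countable1) (use T in auto)
  then show "(\<lambda>(n, x). sum_dirac n x) \<in> measurable (measure_pmf \<kappa> \<Otimes>\<^sub>M (\<Pi>\<^sub>M i\<in>UNIV. \<mu>)) borel_weak"
    by (simp cong: measurable_cong_sets sets_pair_measure_cong)
qed

section \<open>Mixed binomial laws, their densities and the total mass\<close>

lemma mixed_binomial_in_prob_algebra:
  fixes \<mu> :: "'z::polish_space measure"
  assumes "\<mu> \<in> space (prob_algebra borel)"
  shows "mixed_binomial \<mu> \<kappa> \<in> space (prob_algebra borel_weak)"
proof -
  interpret \<mu>: prob_space \<mu> using assms by (simp add: space_prob_algebra)
  interpret S: prob_space "\<Pi>\<^sub>M i\<in>(UNIV::nat set). \<mu>"
    by (rule prob_space_PiM) unfold_locales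
  interpret K: prob_space "measure_pmf \<kappa>" by (rule prob_space_measure_pmf)
  interpret pair_prob_space "measure_pmf \<kappa>" "\<Pi>\<^sub>M i\<in>(UNIV::nat set). \<mu>" ..
  show ?thesis
    using assms unfolding mixed_binomial_def
    by (auto simp: space_prob_algebra intro!: prob_space_distr sum_dirac_measurable_pair)
qed

text \<open>Integrals of functions that are not known to be measurable are lower integrals.\<close>

lemma nn_integral_le_measurable:
  assumes "\<And>s. s \<in> borel_measurable M \<Longrightarrow> (\<And>x. s x \<le> g x) \<Longrightarrow> (\<integral>\<^sup>+x. s x \<partial>M) \<le> C"
  shows "(\<integral>\<^sup>+x. g x \<partial>M) \<le> C"
  unfolding nn_integral_def
proof (rule SUP_least, safe)
  fix s assume "simple_function M s" "s \<le> g"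
  then show "integral\<^sup>S M s \<le> C"
    using assms[of s] by (simp add: nn_integral_eq_simple_integral borel_measurable_simple_function le_fun_def)
qed

text \<open>The cost is infinite wherever the masses differ, so a coupling of finite cost gives this
  event probability 0. The event is measurable because the total mass is; for the cost itself
  monotonicity of the lower integral is enough.\<close>

lemma WW2_sq_finite_imp_same_mass:
  fixes \<Pi>\<^sub>1 \<Pi>\<^sub>2 :: "'z::metric_space measure measure"
  assumes 1: "\<Pi>\<^sub>1 \<in> space (prob_algebra borel_weak)" and 2: "\<Pi>\<^sub>2 \<in> space (prob_algebra borel_weak)"
    and "WW2_sq \<Pi>\<^sub>1 \<Pi>\<^sub>2 < \<infinity>"
  shows "distr \<Pi>\<^sub>1 borel (\<lambda>\<eta>. measure \<eta> UNIV) = distr \<Pi>\<^sub>2 borel (\<lambda>\<eta>. measure \<eta> UNIV)"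
proof -
  obtain \<gamma> where \<gamma>: "\<gamma> \<in> couplings \<Pi>\<^sub>1 \<Pi>\<^sub>2" "(\<integral>\<^sup>+p. W2_sq_fin (fst p) (snd p) \<partial>\<gamma>) < \<infinity>"
    using assms(3) unfolding WW2_sq_def transport_cost_def by (auto simp: INF_less_iff)
  have [measurable_cong]: "sets \<Pi>\<^sub>1 = sets borel_weak" "sets \<Pi>\<^sub>2 = sets borel_weak"
    using 1 2 by (auto simp: space_prob_algebra)
  have [measurable_cong]: "sets \<gamma> = sets (\<Pi>\<^sub>1 \<Otimes>\<^sub>M \<Pi>\<^sub>2)"
    and marg: "distr \<gamma> \<Pi>\<^sub>1 fst = \<Pi>\<^sub>1" "distr \<gamma> \<Pi>\<^sub>2 snd = \<Pi>\<^sub>2"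
    using \<gamma>(1) by (auto simp: couplings_def space_prob_algebra)
  define E where "E = {p \<in> space \<gamma>. measure (fst p) UNIV \<noteq> measure (snd p) UNIV}"
  have E[measurable]: "E \<in> sets \<gamma>"
    unfolding E_def by measurable
  have "\<infinity> * emeasure \<gamma> E = (\<integral>\<^sup>+p. \<infinity> * indicator E p \<partial>\<gamma>)"
    by (simp add: nn_integral_cmult)
  also have "\<dots> \<le> (\<integral>\<^sup>+p. W2_sq_fin (fst p) (snd p) \<partial>\<gamma>)"
  proof (intro nn_integral_mono)
    fix p
    show "\<infinity> * indicator E p \<le> W2_sq_fin (fst p) (snd p)"
      by (auto simp: E_def W2_sq_fin_def measure_def Let_def split: split_indicator)
  qed
  finally have "\<infinity> * emeasure \<gamma> E < \<infinity>"
    using \<gamma>(2) by (rule le_less_trans)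
  then have "emeasure \<gamma> E = 0"
    by (auto simp: ennreal_top_mult split: if_splits)
  then have "AE p in \<gamma>. measure (fst p) UNIV = measure (snd p) UNIV"
    by (intro AE_I[of _ _ E]) (auto simp: E_def)
  then have "distr \<gamma> borel (\<lambda>p. measure (fst p) UNIV) = distr \<gamma> borel (\<lambda>p. measure (snd p) UNIV)"
    by (intro distr_cong_AE) auto
  moreover have "distr \<gamma> borel (\<lambda>p. measure (fst p) UNIV) = distr (distr \<gamma> \<Pi>\<^sub>1 fst) borel (\<lambda>\<eta>. measure \<eta> UNIV)"
    by (subst distr_distr) (auto simp: comp_def)
  moreover have "distr \<gamma> borel (\<lambda>p. measure (snd p) UNIV) = distr (distr \<gamma> \<Pi>\<^sub>2 snd) borel (\<lambda>\<eta>. measure \<eta> UNIV)"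
    by (subst distr_distr) (auto simp: comp_def)
  ultimately show ?thesis
    by (simp add: marg)
qed

text \<open>Fubini over the number of points. \<open>m\<close> is the density of the mass law with
  respect to \<open>\<kappa>\<close>, and \<open>J n\<close> is the unnormalized entropy of the
  slice at \<open>n\<close>. Integrability comes only for almost every slice, which for a
  \<open>pmf\<close> means the \<open>n\<close> in \<open>set_pmf \<kappa>\<close>.\<close>

lemma mixed_binomial_density:
  fixes \<mu> :: "'z::polish_space measure" and F :: "'z measure \<Rightarrow> real" and \<kappa> :: "nat pmf"
  defines "S \<equiv> \<Pi>\<^sub>M i\<in>(UNIV::nat set). \<mu>"
  defines "m \<equiv> \<lambda>n. \<integral>x. F (sum_dirac n x) \<partial>S"
  defines "J \<equiv> \<lambda>n. \<integral>x. F (sum_dirac n x) * ln (F (sum_dirac n x)) \<partial>S"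
  assumes \<mu>: "\<mu> \<in> space (prob_algebra borel)"
    and F: "F \<in> borel_measurable (mixed_binomial \<mu> \<kappa>)" "\<And>\<eta>. 0 \<le> F \<eta>"
      "integrable (mixed_binomial \<mu> \<kappa>) (\<lambda>\<eta>. F \<eta> * ln (F \<eta>))"
    and prob: "prob_space (density (mixed_binomial \<mu> \<kappa>) F)"
  shows "(\<lambda>x. F (sum_dirac n x)) \<in> borel_measurable S"
    and "n \<in> set_pmf \<kappa> \<Longrightarrow> integrable S (\<lambda>x. F (sum_dirac n x))"
    and "n \<in> set_pmf \<kappa> \<Longrightarrow> integrable S (\<lambda>x. F (sum_dirac n x) * ln (F (sum_dirac n x)))"
    and "0 \<le> m n" and "integrable (measure_pmf \<kappa>) m" and "integrable (measure_pmf \<kappa>) J"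
    and "(\<integral>n. J n \<partial>measure_pmf \<kappa>) = (\<integral>\<eta>. F \<eta> * ln (F \<eta>) \<partial>mixed_binomial \<mu> \<kappa>)"
    and "A \<in> sets borel_weak \<Longrightarrow> emeasure (density (mixed_binomial \<mu> \<kappa>) F) A
      = (\<integral>\<^sup>+n. \<integral>\<^sup>+x. ennreal (F (sum_dirac n x)) * indicator A (sum_dirac n x) \<partial>S \<partial>measure_pmf \<kappa>)"
    and "R \<in> sets borel \<Longrightarrow> emeasure (density (mixed_binomial \<mu> \<kappa>) F) {\<eta> \<in> finite_borel_measures. measure \<eta> UNIV \<in> R}
      = (\<integral>\<^sup>+n. ennreal (m n) * indicator R (real n) \<partial>measure_pmf \<kappa>)"
proof -
  interpret \<mu>: prob_space \<mu> using \<mu> by (simp add: space_prob_algebra)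
  interpret S: prob_space S
    unfolding S_def by (rule prob_space_PiM) unfold_locales
  interpret K: prob_space "measure_pmf \<kappa>" by (rule prob_space_measure_pmf)
  interpret pair_prob_space "measure_pmf \<kappa>" S ..
  have sets: "sets \<mu> = sets borel"
    using \<mu> by (simp add: space_prob_algebra)
  define B where "B = mixed_binomial \<mu> \<kappa>"
  note F = F[folded B_def]
  have setsB[measurable_cong]: "sets B = sets borel_weak"
    by (simp add: B_def mixed_binomial_def)
  note F(1)[measurable]
  note T[measurable] = sum_dirac_measurable_pair[OF sets, folded S_def]
  have B: "B = distr (measure_pmf \<kappa> \<Otimes>\<^sub>M S) borel_weak (\<lambda>(n, x). sum_dirac n x)"
    by (simp add: B_def mixed_binomial_def S_def)
  have Fm[measurable]: "F \<in> borel_measurable borel_weak"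
    using F(1) by (simp cong: measurable_cong_sets add: setsB)
  show G: "(\<lambda>x. F (sum_dirac n x)) \<in> borel_measurable S" for n
    by measurable
  have pair: "integrable (measure_pmf \<kappa> \<Otimes>\<^sub>M S) (\<lambda>(n, x). f (sum_dirac n x))
      \<and> (\<integral>\<eta>. f \<eta> \<partial>B) = (\<integral>z. (case z of (n, x) \<Rightarrow> f (sum_dirac n x)) \<partial>(measure_pmf \<kappa> \<Otimes>\<^sub>M S))"
    if "integrable B f" and [measurable]: "f \<in> borel_measurable borel_weak" for f :: "'z measure \<Rightarrow> real"
    using that(1) unfolding B by (auto simp: integrable_distr_eq integral_distr split_beta')
  have slice: "n \<in> set_pmf \<kappa> \<Longrightarrow> integrable S (\<lambda>x. f (sum_dirac n x))"
      "integrable (measure_pmf \<kappa>) (\<lambda>n. \<integral>x. f (sum_dirac n x) \<partial>S)"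
      "(\<integral>n. \<integral>x. f (sum_dirac n x) \<partial>S \<partial>measure_pmf \<kappa>) = (\<integral>\<eta>. f \<eta> \<partial>B)"
    if "integrable B f" and [measurable]: "f \<in> borel_measurable borel_weak" for f :: "'z measure \<Rightarrow> real" and n
    using pair[OF that] AE_integrable_fst'[of "\<lambda>(n, x). f (sum_dirac n x)"]
      integrable_fst'[of "\<lambda>(n, x). f (sum_dirac n x)"] integral_fst'[of "\<lambda>(n, x). f (sum_dirac n x)"]
    by (auto simp: AE_measure_pmf_iff)
  have "(\<integral>\<^sup>+\<eta>. ennreal (F \<eta>) \<partial>B) = 1"
    using prob_space.emeasure_space_1[OF prob] unfolding B_def[symmetric]
    by (simp add: emeasure_density cong: nn_integral_cong)
  then have intF: "integrable B F"
    using F(2) by (intro integrableI_nonneg) auto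
  show i1: "integrable S (\<lambda>x. F (sum_dirac n x))" if "n \<in> set_pmf \<kappa>" for n
    using slice(1)[OF intF _ that] by simp
  show "integrable S (\<lambda>x. F (sum_dirac n x) * ln (F (sum_dirac n x)))" if "n \<in> set_pmf \<kappa>"
    using slice(1)[OF F(3) _ that] by simp
  show "0 \<le> m n"
    unfolding m_def using F(2) by (intro Bochner_Integration.integral_nonneg) auto
  show "integrable (measure_pmf \<kappa>) m" "integrable (measure_pmf \<kappa>) J"
    "(\<integral>n. J n \<partial>measure_pmf \<kappa>) = (\<integral>\<eta>. F \<eta> * ln (F \<eta>) \<partial>mixed_binomial \<mu> \<kappa>)"
    unfolding m_def J_def B_def[symmetric] using slice(2)[OF intF] slice(2,3)[OF F(3)] by auto
  show em: "emeasure (density (mixed_binomial \<mu> \<kappa>) F) A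
      = (\<integral>\<^sup>+n. \<integral>\<^sup>+x. ennreal (F (sum_dirac n x)) * indicator A (sum_dirac n x) \<partial>S \<partial>measure_pmf \<kappa>)"
    if [measurable]: "A \<in> sets borel_weak" for A
  proof -
    have "emeasure (density B F) A = (\<integral>\<^sup>+\<eta>. ennreal (F \<eta>) * indicator A \<eta> \<partial>B)"
      by (subst emeasure_density) (auto simp: setsB)
    also have "\<dots> = (\<integral>\<^sup>+z. (case z of (n, x) \<Rightarrow> ennreal (F (sum_dirac n x)) * indicator A (sum_dirac n x)) \<partial>(measure_pmf \<kappa> \<Otimes>\<^sub>M S))"
      unfolding B by (subst nn_integral_distr) (auto simp: split_beta')
    also have "\<dots> = (\<integral>\<^sup>+n. \<integral>\<^sup>+x. ennreal (F (sum_dirac n x)) * indicator A (sum_dirac n x) \<partial>S \<partial>measure_pmf \<kappa>)"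
      by (subst S.nn_integral_fst[symmetric]) auto
    finally show ?thesis by (simp add: B_def)
  qed
  show "emeasure (density (mixed_binomial \<mu> \<kappa>) F) {\<eta> \<in> finite_borel_measures. measure \<eta> UNIV \<in> R}
      = (\<integral>\<^sup>+n. ennreal (m n) * indicator R (real n) \<partial>measure_pmf \<kappa>)" if R[measurable]: "R \<in> sets borel"
  proof -
    have "{\<eta> \<in> space borel_weak. measure \<eta> UNIV \<in> R} \<in> sets (borel_weak :: 'z measure measure)"
      by measurable
    \<comment> \<open>The mass of \<open>sum_dirac n x\<close> is \<open>n\<close>, which makes the
      indicator constant on each slice.\<close>
    then have "emeasure (density (mixed_binomial \<mu> \<kappa>) F) {\<eta> \<in> finite_borel_measures. measure \<eta> UNIV \<in> R}
        = (\<integral>\<^sup>+n. \<integral>\<^sup>+x. ennreal (F (sum_dirac n x)) * indicator R (real n) \<partial>S \<partial>measure_pmf \<kappa>)"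
      by (subst em) (auto simp: indicator_def measure_sum_dirac_UNIV sum_dirac_in_finite_borel_measures)
    also have "\<dots> = (\<integral>\<^sup>+n. ennreal (m n) * indicator R (real n) \<partial>measure_pmf \<kappa>)"
    proof (rule nn_integral_cong_AE, unfold AE_measure_pmf_iff, safe)
      fix n assume n: "n \<in> set_pmf \<kappa>"
      have "(\<integral>\<^sup>+x. ennreal (F (sum_dirac n x)) \<partial>S) = ennreal (m n)"
        unfolding m_def using i1[OF n] F(2) by (subst nn_integral_eq_integral) auto
      then show "(\<integral>\<^sup>+x. ennreal (F (sum_dirac n x)) * indicator R (real n) \<partial>S) = ennreal (m n) * indicator R (real n)"
        by (simp add: nn_integral_multc)
    qed
    finally show ?thesis .
  qed
qed

text \<open>Densities survive the image under the injection \<open>real\<close>, so the entropy is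
  computed on the naturals.\<close>

lemma relative_entropy_law_on_nonneg:
  fixes m :: "nat \<Rightarrow> real"
  assumes m: "\<And>n. 0 \<le> m n" and int: "integrable (measure_pmf \<kappa>) (\<lambda>n. m n * ln (m n))"
  shows "relative_entropy (distr (density (measure_pmf \<kappa>) m) borel_nonneg real) (law_on_nonneg \<kappa>)
    = ereal (\<integral>n. m n * ln (m n) \<partial>measure_pmf \<kappa>)"
proof -
  have real[measurable]: "real \<in> measurable (measure_pmf \<kappa>) borel_nonneg"
    by (simp add: space_restrict_space)
  interpret L: prob_space "law_on_nonneg \<kappa>"
    unfolding law_on_nonneg_def by (rule measure_pmf.prob_space_distr[OF real])
  \<comment> \<open>A measurable extension of \<open>m\<close> from the naturals to the reals, by
    rounding down.\<close>
  define f where "f r = m (nat \<lfloor>r\<rfloor>)" for r :: real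
  have "(\<lambda>r::real. nat \<lfloor>r\<rfloor>) \<in> measurable borel (count_space UNIV)"
    by measurable
  then have "f \<in> borel_measurable borel"
    unfolding f_def[abs_def] by (rule measurable_compose) simp
  then have [measurable]: "f \<in> borel_measurable borel_nonneg"
    by (rule measurable_restrict_space1)
  then have f: "f \<in> borel_measurable (law_on_nonneg \<kappa>)"
    by (simp add: law_on_nonneg_def)
  have f_real: "f (real n) = m n" for n
    by (simp add: f_def)
  have eq: "distr (density (measure_pmf \<kappa>) m) borel_nonneg real = density (law_on_nonneg \<kappa>) f"
    unfolding law_on_nonneg_def by (subst density_distr) (auto simp: f_real)
  have int': "integrable (law_on_nonneg \<kappa>) (\<lambda>r. f r * ln (f r))"
    unfolding law_on_nonneg_def using int by (subst integrable_distr_eq) (auto simp: f_real)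
  have "relative_entropy (density (law_on_nonneg \<kappa>) f) (law_on_nonneg \<kappa>)
      = ereal (\<integral>r. f r * ln (f r) \<partial>law_on_nonneg \<kappa>)"
    by (rule relative_entropy_density[OF L.sigma_finite_measure_axioms f _ int']) (simp add: f_def m)
  also have "(\<integral>r. f r * ln (f r) \<partial>law_on_nonneg \<kappa>) = (\<integral>n. m n * ln (m n) \<partial>measure_pmf \<kappa>)"
    unfolding law_on_nonneg_def by (subst integral_distr) (auto simp: f_real)
  finally show ?thesis by (simp add: eq)
qed

section \<open>Mixing couplings over the total mass\<close>

lemma nn_integral_embed_pmf_density:
  fixes m :: "nat \<Rightarrow> real"
  assumes m: "\<And>n. 0 \<le> m n" and 1: "(\<integral>\<^sup>+n. ennreal (m n) \<partial>measure_pmf \<kappa>) = 1"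
  shows "pmf (embed_pmf (\<lambda>n. pmf \<kappa> n * m n)) n = pmf \<kappa> n * m n"
    and "(\<integral>\<^sup>+n. f n \<partial>measure_pmf (embed_pmf (\<lambda>n. pmf \<kappa> n * m n))) = (\<integral>\<^sup>+n. ennreal (m n) * f n \<partial>measure_pmf \<kappa>)"
proof -
  have "(\<integral>\<^sup>+n. ennreal (pmf \<kappa> n * m n) \<partial>count_space UNIV) = 1"
    using 1 m by (simp add: nn_integral_measure_pmf ennreal_mult)
  then show *: "pmf (embed_pmf (\<lambda>n. pmf \<kappa> n * m n)) n = pmf \<kappa> n * m n" for n
    using m by (intro pmf_embed_pmf) auto
  show "(\<integral>\<^sup>+n. f n \<partial>measure_pmf (embed_pmf (\<lambda>n. pmf \<kappa> n * m n))) = (\<integral>\<^sup>+n. ennreal (m n) * f n \<partial>measure_pmf \<kappa>)"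
    using m by (simp add: nn_integral_measure_pmf * ennreal_mult mult.assoc)
qed

text \<open>
  Given the total mass \<open>n\<close>, both laws are images under \<open>sum_dirac n\<close> of laws on sequences with the lifted
  densities; the couplings of the latter are mixed over the common law of the total mass.
\<close>

lemma WW2_sq_density_mixed_binomial_le:
  fixes \<mu> :: "'z::polish_space measure" and F\<^sub>1 F\<^sub>2 :: "'z measure \<Rightarrow> real" and \<kappa> :: "nat pmf"
  defines "S \<equiv> \<Pi>\<^sub>M i\<in>(UNIV::nat set). \<mu>" and "B \<equiv> mixed_binomial \<mu> \<kappa>"
  defines "m \<equiv> \<lambda>n. \<integral>x. F\<^sub>1 (sum_dirac n x) \<partial>S"
  assumes \<mu>: "\<mu> \<in> space (prob_algebra borel)" and "a > 0" and tal: "talagrand_inequality a \<mu>"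
    and F1: "F\<^sub>1 \<in> borel_measurable B" "\<And>\<eta>. 0 \<le> F\<^sub>1 \<eta>" "integrable B (\<lambda>\<eta>. F\<^sub>1 \<eta> * ln (F\<^sub>1 \<eta>))"
    and F2: "F\<^sub>2 \<in> borel_measurable B" "\<And>\<eta>. 0 \<le> F\<^sub>2 \<eta>" "integrable B (\<lambda>\<eta>. F\<^sub>2 \<eta> * ln (F\<^sub>2 \<eta>))"
    and prob: "prob_space (density B F\<^sub>1)" "prob_space (density B F\<^sub>2)"
    and same: "\<And>n. n \<in> set_pmf \<kappa> \<Longrightarrow> (\<integral>x. F\<^sub>2 (sum_dirac n x) \<partial>S) = m n"
  shows "integrable (measure_pmf \<kappa>) (\<lambda>n. m n * ln (m n))"
    and "0 \<le> a * ((\<integral>\<eta>. F\<^sub>1 \<eta> * ln (F\<^sub>1 \<eta>) \<partial>B) + (\<integral>\<eta>. F\<^sub>2 \<eta> * ln (F\<^sub>2 \<eta>) \<partial>B)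
        - 2 * (\<integral>n. m n * ln (m n) \<partial>measure_pmf \<kappa>))"
    and "WW2_sq (density B F\<^sub>1) (density B F\<^sub>2)
      \<le> ennreal (a * ((\<integral>\<eta>. F\<^sub>1 \<eta> * ln (F\<^sub>1 \<eta>) \<partial>B) + (\<integral>\<eta>. F\<^sub>2 \<eta> * ln (F\<^sub>2 \<eta>) \<partial>B)
        - 2 * (\<integral>n. m n * ln (m n) \<partial>measure_pmf \<kappa>)))"
proof -
  interpret \<mu>: prob_space \<mu> using \<mu> by (simp add: space_prob_algebra)
  interpret S: prob_space S
    unfolding S_def by (rule prob_space_PiM) unfold_locales
  have sets: "sets \<mu> = sets borel"
    using \<mu> by (simp add: space_prob_algebra)
  have setsB: "sets B = sets borel_weak"
    by (simp add: B_def mixed_binomial_def)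
  note T[measurable] = sum_dirac_measurable_pair(2)[OF sets, folded S_def]
  have m_eq: "m n = (\<integral>x. F\<^sub>1 (sum_dirac n x) \<partial>S)" for n
    by (simp add: m_def)
  define J\<^sub>1 where "J\<^sub>1 n = (\<integral>x. F\<^sub>1 (sum_dirac n x) * ln (F\<^sub>1 (sum_dirac n x)) \<partial>S)" for n
  define J\<^sub>2 where "J\<^sub>2 n = (\<integral>x. F\<^sub>2 (sum_dirac n x) * ln (F\<^sub>2 (sum_dirac n x)) \<partial>S)" for n
  note D1 = mixed_binomial_density[OF \<mu> F1[unfolded B_def] prob(1)[unfolded B_def], folded B_def S_def, folded m_eq J\<^sub>1_def]
  note D2 = mixed_binomial_density[OF \<mu> F2[unfolded B_def] prob(2)[unfolded B_def], folded B_def S_def, folded J\<^sub>2_def]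
  note D1(1)[measurable] D2(1)[measurable]
  have m_nonneg: "0 \<le> m n" for n by (rule D1(4))
  define H\<^sub>1 where "H\<^sub>1 = (\<integral>\<eta>. F\<^sub>1 \<eta> * ln (F\<^sub>1 \<eta>) \<partial>B)"
  define H\<^sub>2 where "H\<^sub>2 = (\<integral>\<eta>. F\<^sub>2 \<eta> * ln (F\<^sub>2 \<eta>) \<partial>B)"
  have H: "(\<integral>n. J\<^sub>1 n \<partial>measure_pmf \<kappa>) = H\<^sub>1" "(\<integral>n. J\<^sub>2 n \<partial>measure_pmf \<kappa>) = H\<^sub>2"
    using D1(7) D2(7) by (simp_all add: H\<^sub>1_def H\<^sub>2_def)
  \<comment> \<open>Slices outside the support of the mass law: a nonnegative function with mean 0
    vanishes almost everywhere, and its entropy integral with it.\<close>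
  have zero: "(AE x in S. F (sum_dirac n x) = 0) \<and> (\<integral>x. F (sum_dirac n x) * ln (F (sum_dirac n x)) \<partial>S) = 0"
    if "integrable S (\<lambda>x. F (sum_dirac n x))" "\<And>\<eta>. 0 \<le> F \<eta>" "(\<integral>x. F (sum_dirac n x) \<partial>S) = 0"
    for F :: "'z measure \<Rightarrow> real" and n
  proof -
    have *: "AE x in S. F (sum_dirac n x) = 0"
      using integral_nonneg_eq_0_iff_AE[OF that(1)] that(2,3) by auto
    then have "AE x in S. F (sum_dirac n x) * ln (F (sum_dirac n x)) = 0"
      by eventually_elim simp
    then show ?thesis
      using * by (simp add: integral_eq_zero_AE)
  qed
  \<comment> \<open>Conditioning on \<open>n\<close> points divides the slice by \<open>m n\<close>.
    This is the chain rule: the entropy of the normalized slice is the unnormalized one over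
    \<open>m n\<close>, minus \<open>ln (m n)\<close>. It is nonnegative by the variational bound
    with \<open>u = 1\<close>.\<close>
  have normalized: "integrable S (\<lambda>x. F (sum_dirac n x) / m n)" "(\<integral>x. F (sum_dirac n x) / m n \<partial>S) = 1"
      "integrable S (\<lambda>x. F (sum_dirac n x) / m n * ln (F (sum_dirac n x) / m n))"
      "(\<integral>x. F (sum_dirac n x) / m n * ln (F (sum_dirac n x) / m n) \<partial>S)
        = (\<integral>x. F (sum_dirac n x) * ln (F (sum_dirac n x)) \<partial>S) / m n - ln (m n)"
      "0 \<le> (\<integral>x. F (sum_dirac n x) * ln (F (sum_dirac n x)) \<partial>S) / m n - ln (m n)"
    if F: "integrable S (\<lambda>x. F (sum_dirac n x))" "\<And>\<eta>. 0 \<le> F \<eta>" "(\<integral>x. F (sum_dirac n x) \<partial>S) = m n"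
      "integrable S (\<lambda>x. F (sum_dirac n x) * ln (F (sum_dirac n x)))" and m: "m n > 0"
    for F :: "'z measure \<Rightarrow> real" and n
  proof -
    show 1: "integrable S (\<lambda>x. F (sum_dirac n x) / m n)"
      using F by simp
    show 2: "(\<integral>x. F (sum_dirac n x) / m n \<partial>S) = 1"
      using F m by simp
    have eq: "F \<eta> / m n * ln (F \<eta> / m n) = F \<eta> * ln (F \<eta>) / m n - F \<eta> * (ln (m n) / m n)" for \<eta>
    proof (cases "F \<eta> = 0")
      case False
      then have "F \<eta> > 0" using F(2)[of \<eta>] by simp
      then show ?thesis using m by (simp add: ln_div field_simps)
    qed simp
    show 3: "integrable S (\<lambda>x. F (sum_dirac n x) / m n * ln (F (sum_dirac n x) / m n))"
      unfolding eq using F by (intro Bochner_Integration.integrable_diff integrable_mult_left integrable_divide)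
    show 4: "(\<integral>x. F (sum_dirac n x) / m n * ln (F (sum_dirac n x) / m n) \<partial>S)
        = (\<integral>x. F (sum_dirac n x) * ln (F (sum_dirac n x)) \<partial>S) / m n - ln (m n)"
      unfolding eq using F m by (subst Bochner_Integration.integral_diff) auto
    have "(\<integral>x. F (sum_dirac n x) / m n * ln 1 \<partial>S)
        \<le> (\<integral>x. F (sum_dirac n x) / m n * ln (F (sum_dirac n x) / m n) \<partial>S) + ln (\<integral>x. 1 \<partial>S)"
      using 1 2 3 F(2) m by (intro S.gibbs_variational) auto
    then show "0 \<le> (\<integral>x. F (sum_dirac n x) * ln (F (sum_dirac n x)) \<partial>S) / m n - ln (m n)"
      unfolding 4 by (simp add: S.prob_space)
  qed
  have mln_le: "m n * ln (m n) \<le> J\<^sub>1 n" "m n * ln (m n) \<le> J\<^sub>2 n" if n: "n \<in> set_pmf \<kappa>" for n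
  proof -
    consider "m n = 0" | "m n > 0" using m_nonneg[of n] by linarith
    then have "m n * ln (m n) \<le> J\<^sub>1 n \<and> m n * ln (m n) \<le> J\<^sub>2 n"
    proof cases
      case 1
      then show ?thesis
        using zero[OF D1(2)[OF n] F1(2)] zero[OF D2(2)[OF n] F2(2)] same[OF n]
        by (simp add: J\<^sub>1_def J\<^sub>2_def m_def)
    next
      case 2
      then show ?thesis
        using normalized(5)[OF D1(2)[OF n] F1(2) _ D1(3)[OF n] 2]
          normalized(5)[OF D2(2)[OF n] F2(2) same[OF n] D2(3)[OF n] 2]
        by (simp add: J\<^sub>1_def J\<^sub>2_def m_eq[symmetric] pos_le_divide_eq mult.commute)
    qed
    then show "m n * ln (m n) \<le> J\<^sub>1 n" "m n * ln (m n) \<le> J\<^sub>2 n" by auto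
  qed
  \<comment> \<open>Squeezed between -1 and \<open>J\<^sub>1 n\<close>: the entropy of the mass law
    is dominated by that of the full law.\<close>
  show mln: "integrable (measure_pmf \<kappa>) (\<lambda>n. m n * ln (m n))"
  proof (rule Bochner_Integration.integrable_bound)
    show "integrable (measure_pmf \<kappa>) (\<lambda>n. 1 + \<bar>J\<^sub>1 n\<bar>)"
      using D1(6) by simp
    show "AE n in measure_pmf \<kappa>. norm (m n * ln (m n)) \<le> norm (1 + \<bar>J\<^sub>1 n\<bar>)"
      unfolding AE_measure_pmf_iff
    proof
      fix n assume "n \<in> set_pmf \<kappa>"
      then show "norm (m n * ln (m n)) \<le> norm (1 + \<bar>J\<^sub>1 n\<bar>)"
        using mult_ln_ge[OF m_nonneg[of n]] mln_le(1)[of n] m_nonneg[of n]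
        unfolding real_norm_def by linarith
    qed
  qed simp
  \<comment> \<open>For \<open>m n > 0\<close>, \<open>c n / m n\<close> is \<open>a\<close> times
    the sum of the two conditional entropies; so \<open>c n\<close> already carries the weight of
    the mass law, and its mean under \<open>\<kappa>\<close> is the bound to be proved.\<close>
  define c where "c n = a * (J\<^sub>1 n + J\<^sub>2 n - 2 * (m n * ln (m n)))" for n
  have c_nonneg: "c n \<ge> 0" if "n \<in> set_pmf \<kappa>" for n
    unfolding c_def using mln_le[OF that] \<open>a > 0\<close> by (intro mult_nonneg_nonneg) auto
  have c_int: "integrable (measure_pmf \<kappa>) c"
    unfolding c_def[abs_def] using D1(6) D2(6) mln by simp
  define X where "X = a * (H\<^sub>1 + H\<^sub>2 - 2 * (\<integral>n. m n * ln (m n) \<partial>measure_pmf \<kappa>))"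
  have X: "(\<integral>n. c n \<partial>measure_pmf \<kappa>) = X"
    unfolding c_def[abs_def] X_def using D1(6) D2(6) mln by (simp add: H)
  have X_nonneg: "X \<ge> 0"
    unfolding X[symmetric] using c_nonneg
    by (intro Bochner_Integration.integral_nonneg_AE) (simp add: AE_measure_pmf_iff)
  then show "0 \<le> a * ((\<integral>\<eta>. F\<^sub>1 \<eta> * ln (F\<^sub>1 \<eta>) \<partial>B) + (\<integral>\<eta>. F\<^sub>2 \<eta> * ln (F\<^sub>2 \<eta>) \<partial>B)
        - 2 * (\<integral>n. m n * ln (m n) \<partial>measure_pmf \<kappa>))"
    by (simp add: X_def H\<^sub>1_def H\<^sub>2_def)
  have int_m: "(\<integral>\<^sup>+n. ennreal (m n) \<partial>measure_pmf \<kappa>) = 1"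
  proof -
    have "space (density B F\<^sub>1) = {\<eta> \<in> finite_borel_measures. measure \<eta> UNIV \<in> UNIV}"
      using sets_eq_imp_space_eq[OF setsB] by simp
    then show ?thesis
      using D1(9)[of UNIV] prob_space.emeasure_space_1[OF prob(1)] by simp
  qed
  then have int_m': "(\<integral>n. m n \<partial>measure_pmf \<kappa>) = 1"
    using nn_integral_eq_integral[OF D1(5)] m_nonneg by (simp add: Bochner_Integration.integral_nonneg)
  \<comment> \<open>The common mass law as a \<open>pmf\<close>, so that couplings can be mixed over
    it with \<open>bind\<close>.\<close>
  define \<Lambda> where "\<Lambda> = embed_pmf (\<lambda>n. pmf \<kappa> n * m n)"
  note \<Lambda> = nn_integral_embed_pmf_density[OF m_nonneg int_m, folded \<Lambda>_def]
  have set_\<Lambda>: "n \<in> set_pmf \<Lambda> \<longleftrightarrow> n \<in> set_pmf \<kappa> \<and> m n > 0" for n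
    using m_nonneg[of n] by (auto simp: set_pmf_iff \<Lambda>(1))
  define \<Pi>\<^sub>1 \<Pi>\<^sub>2 where "\<Pi>\<^sub>1 = density B F\<^sub>1" and "\<Pi>\<^sub>2 = density B F\<^sub>2"
  have setsP: "sets \<Pi>\<^sub>1 = sets borel_weak" "sets \<Pi>\<^sub>2 = sets borel_weak"
    by (simp_all add: \<Pi>\<^sub>1_def \<Pi>\<^sub>2_def setsB)
  define h where "h F n x = F (sum_dirac n x) / m n" for F :: "'z measure \<Rightarrow> real" and n x
  have eps: "WW2_sq \<Pi>\<^sub>1 \<Pi>\<^sub>2 \<le> ennreal X + ennreal \<epsilon>" if "\<epsilon> > 0" for \<epsilon>
  proof -
    \<comment> \<open>Outside the support of \<open>\<Lambda>\<close> the product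
      \<open>S \<Otimes>\<^sub>M S\<close> is a filler, so that \<open>\<gamma> n\<close> is a
      probability measure for every \<open>n\<close>. Choosing it raises no measurability question,
      as the index is discrete.\<close>
    define good where "good n \<gamma> \<longleftrightarrow> sets \<gamma> = sets (S \<Otimes>\<^sub>M S) \<and> prob_space \<gamma> \<and>
        (n \<in> set_pmf \<Lambda> \<longrightarrow> \<gamma> \<in> couplings (density S (h F\<^sub>1 n)) (density S (h F\<^sub>2 n)) \<and>
          (\<integral>\<^sup>+z. ennreal (\<Sum>i<n. (dist (fst z i) (snd z i))\<^sup>2) \<partial>\<gamma>) \<le> ennreal (c n / m n + \<epsilon>))" for n \<gamma>
    have "\<exists>\<gamma>. good n \<gamma>" for n
    proof (cases "n \<in> set_pmf \<Lambda>")
      case True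
      then have n: "n \<in> set_pmf \<kappa>" and m: "m n > 0"
        by (auto simp: set_\<Lambda>)
      note N1 = normalized[OF D1(2)[OF n] F1(2) _ D1(3)[OF n] m, folded m_eq J\<^sub>1_def h_def, OF refl]
      note N2 = normalized[OF D2(2)[OF n] F2(2) same[OF n] D2(3)[OF n] m, folded J\<^sub>2_def h_def]
      have "\<exists>\<gamma>\<in>couplings (density S (h F\<^sub>1 n)) (density S (h F\<^sub>2 n)).
          (\<integral>\<^sup>+z. ennreal (\<Sum>i<n. (dist (fst z i) (snd z i))\<^sup>2) \<partial>\<gamma>)
          \<le> ennreal (a * ((\<integral>x. h F\<^sub>1 n x * ln (h F\<^sub>1 n x) \<partial>S) + (\<integral>x. h F\<^sub>2 n x * ln (h F\<^sub>2 n x) \<partial>S)) + \<epsilon>)"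
        unfolding S_def
        by (rule talagrand_coupling_PiM[OF \<mu> \<open>a > 0\<close> tal])
          (use N1(1-3) N2(1-3) F1(2) F2(2) m \<open>\<epsilon> > 0\<close> in \<open>auto simp: h_def simp flip: S_def\<close>)
      moreover have "a * ((\<integral>x. h F\<^sub>1 n x * ln (h F\<^sub>1 n x) \<partial>S) + (\<integral>x. h F\<^sub>2 n x * ln (h F\<^sub>2 n x) \<partial>S)) = c n / m n"
        using m by (simp add: N1(4) N2(4) c_def field_simps)
      ultimately obtain \<gamma> where \<gamma>: "\<gamma> \<in> couplings (density S (h F\<^sub>1 n)) (density S (h F\<^sub>2 n))"
        "(\<integral>\<^sup>+z. ennreal (\<Sum>i<n. (dist (fst z i) (snd z i))\<^sup>2) \<partial>\<gamma>) \<le> ennreal (c n / m n + \<epsilon>)"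
        by auto
      have "sets (density S (h F\<^sub>1 n) \<Otimes>\<^sub>M density S (h F\<^sub>2 n)) = sets (S \<Otimes>\<^sub>M S)"
        by (intro sets_pair_measure_cong) auto
      then show ?thesis
        using \<gamma> by (intro exI[of _ \<gamma>]) (auto simp: good_def couplings_def space_prob_algebra)
    next
      case False
      interpret SS: pair_prob_space S S ..
      show ?thesis
        by (rule exI[of _ "S \<Otimes>\<^sub>M S"]) (use False SS.prob_space_axioms in \<open>auto simp: good_def\<close>)
    qed
    then obtain \<gamma> where "\<And>n. good n (\<gamma> n)"
      by metis
    then have sets\<gamma>[measurable_cong]: "\<And>n. sets (\<gamma> n) = sets (S \<Otimes>\<^sub>M S)" and prob\<gamma>: "\<And>n. prob_space (\<gamma> n)"
      and coup: "\<And>n. n \<in> set_pmf \<Lambda> \<Longrightarrow> \<gamma> n \<in> couplings (density S (h F\<^sub>1 n)) (density S (h F\<^sub>2 n))"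
      and cost: "\<And>n. n \<in> set_pmf \<Lambda> \<Longrightarrow>
        (\<integral>\<^sup>+z. ennreal (\<Sum>i<n. (dist (fst z i) (snd z i))\<^sup>2) \<partial>\<gamma> n) \<le> ennreal (c n / m n + \<epsilon>)"
      by (simp_all add: good_def)
    define N where "N = (borel_weak \<Otimes>\<^sub>M borel_weak :: ('z measure \<times> 'z measure) measure)"
    define K where "K n = distr (\<gamma> n) N (\<lambda>z. (sum_dirac n (fst z), sum_dirac n (snd z)))" for n
    have TT[measurable]: "(\<lambda>z. (sum_dirac n (fst z), sum_dirac n (snd z))) \<in> measurable (\<gamma> n) N" for n
      unfolding N_def by measurable
    have K_meas: "K \<in> measurable (measure_pmf \<Lambda>) (subprob_algebra N)"
      using prob_space_imp_subprob_space[OF prob_space.prob_space_distr[OF prob\<gamma> TT]]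
      by (simp add: space_subprob_algebra K_def)
    define \<Gamma> where "\<Gamma> = measure_pmf \<Lambda> \<bind> K"
    have sets\<Gamma>[measurable_cong]: "sets \<Gamma> = sets N"
      unfolding \<Gamma>_def by (rule sets_bind) (auto simp: K_def)
    have int\<Gamma>: "(\<integral>\<^sup>+z. s z \<partial>\<Gamma>) = (\<integral>\<^sup>+n. \<integral>\<^sup>+z. s (sum_dirac n (fst z), sum_dirac n (snd z)) \<partial>\<gamma> n \<partial>measure_pmf \<Lambda>)"
      if "s \<in> borel_measurable N" for s
      unfolding \<Gamma>_def using that by (subst nn_integral_bind[OF _ K_meas]) (auto simp: K_def nn_integral_distr)
    \<comment> \<open>The weight \<open>m n\<close> of the mixture undoes the normalization in
      \<open>h\<close>; for \<open>m n = 0\<close> both sides vanish by \<open>zero\<close>.\<close>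
    have marginal: "(\<integral>\<^sup>+n. \<integral>\<^sup>+x. indicator A (sum_dirac n x) \<partial>density S (h F n) \<partial>measure_pmf \<Lambda>)
        = (\<integral>\<^sup>+n. \<integral>\<^sup>+x. ennreal (F (sum_dirac n x)) * indicator A (sum_dirac n x) \<partial>S \<partial>measure_pmf \<kappa>)"
      if [measurable]: "A \<in> sets borel_weak" and F: "\<And>\<eta>. 0 \<le> F \<eta>" "\<And>n. (\<lambda>x. F (sum_dirac n x)) \<in> borel_measurable S"
        "\<And>n. n \<in> set_pmf \<kappa> \<Longrightarrow> integrable S (\<lambda>x. F (sum_dirac n x))"
        "\<And>n. n \<in> set_pmf \<kappa> \<Longrightarrow> (\<integral>x. F (sum_dirac n x) \<partial>S) = m n"
      for A and F :: "'z measure \<Rightarrow> real"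
      unfolding \<Lambda>(2)
    proof (rule nn_integral_cong_AE, unfold AE_measure_pmf_iff, safe)
      fix n assume n: "n \<in> set_pmf \<kappa>"
      note F(2)[measurable]
      have "ennreal (m n) * (\<integral>\<^sup>+x. indicator A (sum_dirac n x) \<partial>density S (h F n))
          = (\<integral>\<^sup>+x. ennreal (m n) * (ennreal (h F n x) * indicator A (sum_dirac n x)) \<partial>S)"
        by (subst nn_integral_density, unfold h_def[abs_def]) (auto simp: nn_integral_cmult)
      also have "\<dots> = (\<integral>\<^sup>+x. ennreal (F (sum_dirac n x)) * indicator A (sum_dirac n x) \<partial>S)"
      proof (cases "m n = 0")
        case True
        then have "AE x in S. F (sum_dirac n x) = 0"
          using zero[OF F(3)[OF n] F(1)] F(4)[OF n] by auto
        then show ?thesis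
          using True by (intro nn_integral_cong_AE) auto
      next
        case False
        then show ?thesis
          using m_nonneg[of n] F(1)
          by (intro nn_integral_cong) (auto simp: h_def simp flip: mult.assoc ennreal_mult)
      qed
      finally show "ennreal (m n) * (\<integral>\<^sup>+x. indicator A (sum_dirac n x) \<partial>density S (h F n))
          = (\<integral>\<^sup>+x. ennreal (F (sum_dirac n x)) * indicator A (sum_dirac n x) \<partial>S)" .
    qed
    have sets\<Gamma>_pair: "sets \<Gamma> = sets (\<Pi>\<^sub>1 \<Otimes>\<^sub>M \<Pi>\<^sub>2)"
      unfolding sets\<Gamma> N_def by (intro sets_pair_measure_cong) (auto simp: setsP)
    have fst_snd: "fst \<in> measurable \<Gamma> \<Pi>\<^sub>1" "snd \<in> measurable \<Gamma> \<Pi>\<^sub>2"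
      by (simp_all cong: measurable_cong_sets add: sets\<Gamma>_pair)
    have "distr \<Gamma> \<Pi>\<^sub>1 fst = \<Pi>\<^sub>1"
    proof (rule measure_eqI)
      fix A assume "A \<in> sets (distr \<Gamma> \<Pi>\<^sub>1 fst)"
      then have A: "A \<in> sets \<Pi>\<^sub>1" and A'[measurable]: "A \<in> sets borel_weak" by (simp_all add: setsP)
      have "emeasure (distr \<Gamma> \<Pi>\<^sub>1 fst) A = (\<integral>\<^sup>+z. indicator A (fst z) \<partial>\<Gamma>)"
        using nn_integral_distr[OF fst_snd(1), of "indicator A"] A by simp
      also have "\<dots> = (\<integral>\<^sup>+n. \<integral>\<^sup>+z. indicator A (sum_dirac n (fst z)) \<partial>\<gamma> n \<partial>measure_pmf \<Lambda>)"
        by (subst int\<Gamma>) (auto simp: N_def)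
      also have "\<dots> = (\<integral>\<^sup>+n. \<integral>\<^sup>+x. indicator A (sum_dirac n x) \<partial>density S (h F\<^sub>1 n) \<partial>measure_pmf \<Lambda>)"
      proof (rule nn_integral_cong_AE, unfold AE_measure_pmf_iff, safe)
        fix n assume "n \<in> set_pmf \<Lambda>"
        from nn_integral_coupling(1)[OF coup[OF this], of "\<lambda>x. indicator A (sum_dirac n x)"]
        show "(\<integral>\<^sup>+z. indicator A (sum_dirac n (fst z)) \<partial>\<gamma> n)
            = (\<integral>\<^sup>+x. indicator A (sum_dirac n x) \<partial>density S (h F\<^sub>1 n))"
          by simp
      qed
      also have "\<dots> = emeasure \<Pi>\<^sub>1 A"
        using marginal[OF A' F1(2) D1(1) D1(2)] D1(8)[OF A'] by (simp add: \<Pi>\<^sub>1_def m_def)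
      finally show "emeasure (distr \<Gamma> \<Pi>\<^sub>1 fst) A = emeasure \<Pi>\<^sub>1 A" .
    qed simp
    moreover have "distr \<Gamma> \<Pi>\<^sub>2 snd = \<Pi>\<^sub>2"
    proof (rule measure_eqI)
      fix A assume "A \<in> sets (distr \<Gamma> \<Pi>\<^sub>2 snd)"
      then have A: "A \<in> sets \<Pi>\<^sub>2" and A'[measurable]: "A \<in> sets borel_weak" by (simp_all add: setsP)
      have "emeasure (distr \<Gamma> \<Pi>\<^sub>2 snd) A = (\<integral>\<^sup>+z. indicator A (snd z) \<partial>\<Gamma>)"
        using nn_integral_distr[OF fst_snd(2), of "indicator A"] A by simp
      also have "\<dots> = (\<integral>\<^sup>+n. \<integral>\<^sup>+z. indicator A (sum_dirac n (snd z)) \<partial>\<gamma> n \<partial>measure_pmf \<Lambda>)"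
        by (subst int\<Gamma>) (auto simp: N_def)
      also have "\<dots> = (\<integral>\<^sup>+n. \<integral>\<^sup>+x. indicator A (sum_dirac n x) \<partial>density S (h F\<^sub>2 n) \<partial>measure_pmf \<Lambda>)"
      proof (rule nn_integral_cong_AE, unfold AE_measure_pmf_iff, safe)
        fix n assume "n \<in> set_pmf \<Lambda>"
        from nn_integral_coupling(2)[OF coup[OF this], of "\<lambda>x. indicator A (sum_dirac n x)"]
        show "(\<integral>\<^sup>+z. indicator A (sum_dirac n (snd z)) \<partial>\<gamma> n)
            = (\<integral>\<^sup>+x. indicator A (sum_dirac n x) \<partial>density S (h F\<^sub>2 n))"
          by simp
      qed
      also have "\<dots> = emeasure \<Pi>\<^sub>2 A"
        using marginal[OF A' F2(2) D2(1) D2(2) same] D2(8)[OF A'] by (simp add: \<Pi>\<^sub>2_def)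
      finally show "emeasure (distr \<Gamma> \<Pi>\<^sub>2 snd) A = emeasure \<Pi>\<^sub>2 A" .
    qed simp
    ultimately have "\<Gamma> \<in> couplings \<Pi>\<^sub>1 \<Pi>\<^sub>2"
      using prob(1) sets\<Gamma>_pair by (intro couplingsI) (auto simp: \<Pi>\<^sub>1_def)
    then have "WW2_sq \<Pi>\<^sub>1 \<Pi>\<^sub>2 \<le> (\<integral>\<^sup>+p. W2_sq_fin (fst p) (snd p) \<partial>\<Gamma>)"
      unfolding WW2_sq_def transport_cost_def by (rule INF_lower)
    also have "\<dots> \<le> ennreal (X + \<epsilon>)"
    proof (rule nn_integral_le_measurable)
      fix s assume "s \<in> borel_measurable \<Gamma>" and s: "\<And>p. s p \<le> W2_sq_fin (fst p) (snd p)"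
      then have "s \<in> borel_measurable N"
        by (simp cong: measurable_cong_sets add: sets\<Gamma>)
      then have "(\<integral>\<^sup>+p. s p \<partial>\<Gamma>)
          = (\<integral>\<^sup>+n. \<integral>\<^sup>+z. s (sum_dirac n (fst z), sum_dirac n (snd z)) \<partial>\<gamma> n \<partial>measure_pmf \<Lambda>)"
        by (rule int\<Gamma>)
      also have "\<dots> \<le> (\<integral>\<^sup>+n. ennreal (c n / m n + \<epsilon>) \<partial>measure_pmf \<Lambda>)"
      proof (rule nn_integral_mono_AE, unfold AE_measure_pmf_iff, safe)
        fix n assume n: "n \<in> set_pmf \<Lambda>"
        have "(\<integral>\<^sup>+z. s (sum_dirac n (fst z), sum_dirac n (snd z)) \<partial>\<gamma> n)
            \<le> (\<integral>\<^sup>+z. ennreal (\<Sum>i<n. (dist (fst z i) (snd z i))\<^sup>2) \<partial>\<gamma> n)"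
          by (intro nn_integral_mono order_trans[OF s]) (simp add: W2_sq_fin_sum_dirac_le)
        then show "(\<integral>\<^sup>+z. s (sum_dirac n (fst z), sum_dirac n (snd z)) \<partial>\<gamma> n) \<le> ennreal (c n / m n + \<epsilon>)"
          using cost[OF n] by (rule order_trans)
      qed
      also have "\<dots> = (\<integral>\<^sup>+n. ennreal (m n) * ennreal (c n / m n + \<epsilon>) \<partial>measure_pmf \<kappa>)"
        by (rule \<Lambda>(2))
      \<comment> \<open>For \<open>m n = 0\<close> the left side is 0 and \<open>c n\<close> is
        nonnegative.\<close>
      also have "\<dots> \<le> (\<integral>\<^sup>+n. ennreal (c n + m n * \<epsilon>) \<partial>measure_pmf \<kappa>)"
      proof (rule nn_integral_mono_AE, unfold AE_measure_pmf_iff, safe)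
        fix n assume n: "n \<in> set_pmf \<kappa>"
        have "ennreal (m n) * ennreal (c n / m n + \<epsilon>) = ennreal (m n * (c n / m n + \<epsilon>))"
          using m_nonneg[of n] by (simp add: ennreal_mult')
        also have "\<dots> \<le> ennreal (c n + m n * \<epsilon>)"
          using m_nonneg[of n] c_nonneg[OF n] by (intro ennreal_leI) (cases "m n = 0"; simp add: field_simps)
        finally show "ennreal (m n) * ennreal (c n / m n + \<epsilon>) \<le> ennreal (c n + m n * \<epsilon>)" .
      qed
      also have "\<dots> = ennreal (\<integral>n. c n + m n * \<epsilon> \<partial>measure_pmf \<kappa>)"
        using c_int D1(5) c_nonneg m_nonneg \<open>\<epsilon> > 0\<close>
        by (intro nn_integral_eq_integral) (auto simp: AE_measure_pmf_iff)
      also have "(\<integral>n. c n + m n * \<epsilon> \<partial>measure_pmf \<kappa>) = X + \<epsilon>"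
        using c_int D1(5) by (simp add: X int_m')
      finally show "(\<integral>\<^sup>+p. s p \<partial>\<Gamma>) \<le> ennreal (X + \<epsilon>)" .
    qed
    also have "\<dots> = ennreal X + ennreal \<epsilon>"
      using X_nonneg \<open>\<epsilon> > 0\<close> by simp
    finally show ?thesis .
  qed
  have "WW2_sq \<Pi>\<^sub>1 \<Pi>\<^sub>2 \<le> ennreal X"
    by (rule ennreal_le_epsilon) (rule eps)
  then show "WW2_sq (density B F\<^sub>1) (density B F\<^sub>2)
      \<le> ennreal (a * ((\<integral>\<eta>. F\<^sub>1 \<eta> * ln (F\<^sub>1 \<eta>) \<partial>B) + (\<integral>\<eta>. F\<^sub>2 \<eta> * ln (F\<^sub>2 \<eta>) \<partial>B)
        - 2 * (\<integral>n. m n * ln (m n) \<partial>measure_pmf \<kappa>)))"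
    by (simp add: \<Pi>\<^sub>1_def \<Pi>\<^sub>2_def X_def H\<^sub>1_def H\<^sub>2_def)
qed

section \<open>Reduction of the theorem to densities\<close>

theorem theorem1p1:
  fixes \<mu> :: "'z::polish_space measure" and a :: real and \<kappa> :: "nat pmf"
  assumes "\<mu> \<in> space (prob_algebra borel)"
    and "a > 0"
    and "talagrand_inequality a \<mu>"
  shows "mixed_binomial \<mu> \<kappa> \<in> space (prob_algebra borel_weak) \<and>
    (\<forall>\<Pi>\<^sub>1 \<in> space (prob_algebra borel_weak). \<forall>\<Pi>\<^sub>2 \<in> space (prob_algebra borel_weak).
       WW2_sq \<Pi>\<^sub>1 \<Pi>\<^sub>2 < \<infinity> \<longrightarrow>
       (\<exists>\<Lambda> \<in> space (prob_algebra borel_nonneg).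
          (\<forall>A \<in> sets borel_nonneg.
             emeasure \<Pi>\<^sub>1 {\<eta> \<in> finite_borel_measures. measure \<eta> UNIV \<in> A} = emeasure \<Lambda> A \<and>
             emeasure \<Pi>\<^sub>2 {\<eta> \<in> finite_borel_measures. measure \<eta> UNIV \<in> A} = emeasure \<Lambda> A) \<and>
          enn2ereal (WW2_sq \<Pi>\<^sub>1 \<Pi>\<^sub>2) + ereal (2 * a) * relative_entropy \<Lambda> (law_on_nonneg \<kappa>)
            \<le> ereal a * relative_entropy \<Pi>\<^sub>1 (mixed_binomial \<mu> \<kappa>)
              + ereal a * relative_entropy \<Pi>\<^sub>2 (mixed_binomial \<mu> \<kappa>)))"
proof (intro conjI ballI impI)
  define B where "B = mixed_binomial \<mu> \<kappa>"
  show "mixed_binomial \<mu> \<kappa> \<in> space (prob_algebra borel_weak)"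
    by (rule mixed_binomial_in_prob_algebra) fact
  then interpret B: prob_space B
    by (simp add: B_def space_prob_algebra)
  fix \<Pi>\<^sub>1 \<Pi>\<^sub>2 :: "'z measure measure"
  assume P1: "\<Pi>\<^sub>1 \<in> space (prob_algebra borel_weak)" and P2: "\<Pi>\<^sub>2 \<in> space (prob_algebra borel_weak)"
    and fin: "WW2_sq \<Pi>\<^sub>1 \<Pi>\<^sub>2 < \<infinity>"
  have [measurable_cong]: "sets \<Pi>\<^sub>1 = sets borel_weak" "sets \<Pi>\<^sub>2 = sets borel_weak"
    and sets: "sets \<Pi>\<^sub>1 = sets B" "sets \<Pi>\<^sub>2 = sets B"
    using P1 P2 by (auto simp: space_prob_algebra B_def mixed_binomial_def)
  interpret P1: prob_space \<Pi>\<^sub>1 using P1 by (simp add: space_prob_algebra)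
  interpret P2: prob_space \<Pi>\<^sub>2 using P2 by (simp add: space_prob_algebra)
  \<comment> \<open>Taken from \<open>\<Pi>\<^sub>1\<close>; finiteness of the transport cost makes
    it the mass law of \<open>\<Pi>\<^sub>2\<close> as well.\<close>
  define \<Lambda> where "\<Lambda> = distr \<Pi>\<^sub>1 borel_nonneg (\<lambda>\<eta>. measure \<eta> UNIV)"
  have mass[measurable]: "(\<lambda>\<eta>. measure \<eta> UNIV) \<in> measurable \<Pi>\<^sub>1 borel_nonneg"
    by (rule measurable_restrict_space2) auto
  have "prob_space \<Lambda>"
    unfolding \<Lambda>_def by (rule P1.prob_space_distr[OF mass])
  then have \<Lambda>_prob: "\<Lambda> \<in> space (prob_algebra borel_nonneg)"
    by (simp add: space_prob_algebra \<Lambda>_def)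
  have spaceP: "space \<Pi>\<^sub>1 = finite_borel_measures" "space \<Pi>\<^sub>2 = finite_borel_measures"
    using P1 P2 sets_eq_imp_space_eq[of _ borel_weak] by (auto simp: space_prob_algebra)
  have borel: "A \<in> sets borel" if "A \<in> sets borel_nonneg" for A :: "real set"
    using that by (auto simp: sets_restrict_space)
  have law1: "emeasure \<Pi>\<^sub>1 {\<eta> \<in> finite_borel_measures. measure \<eta> UNIV \<in> A} = emeasure \<Lambda> A"
    if "A \<in> sets borel_nonneg" for A
    using that mass unfolding \<Lambda>_def
    by (subst emeasure_distr) (auto simp: spaceP intro!: arg_cong[where f = "emeasure \<Pi>\<^sub>1"])
  have same: "emeasure \<Pi>\<^sub>1 {\<eta> \<in> finite_borel_measures. measure \<eta> UNIV \<in> A}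
      = emeasure \<Pi>\<^sub>2 {\<eta> \<in> finite_borel_measures. measure \<eta> UNIV \<in> A}" if "A \<in> sets borel" for A
  proof -
    have "emeasure P {\<eta> \<in> finite_borel_measures. measure \<eta> UNIV \<in> A} = emeasure (distr P borel (\<lambda>\<eta>. measure \<eta> UNIV)) A"
      if "space P = finite_borel_measures" and [measurable_cong]: "sets P = sets borel_weak"
      for P :: "'z measure measure"
      using \<open>A \<in> sets borel\<close> that
      by (subst emeasure_distr) (auto intro!: arg_cong[where f = "emeasure P"])
    then show ?thesis
      using spaceP P1 P2 WW2_sq_finite_imp_same_mass[OF P1 P2 fin] by (auto simp: space_prob_algebra)
  qed
  show "\<exists>\<Lambda>\<in>space (prob_algebra borel_nonneg).
      (\<forall>A\<in>sets borel_nonneg.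
         emeasure \<Pi>\<^sub>1 {\<eta> \<in> finite_borel_measures. measure \<eta> UNIV \<in> A} = emeasure \<Lambda> A \<and>
         emeasure \<Pi>\<^sub>2 {\<eta> \<in> finite_borel_measures. measure \<eta> UNIV \<in> A} = emeasure \<Lambda> A) \<and>
      enn2ereal (WW2_sq \<Pi>\<^sub>1 \<Pi>\<^sub>2) + ereal (2 * a) * relative_entropy \<Lambda> (law_on_nonneg \<kappa>)
        \<le> ereal a * relative_entropy \<Pi>\<^sub>1 (mixed_binomial \<mu> \<kappa>) + ereal a * relative_entropy \<Pi>\<^sub>2 (mixed_binomial \<mu> \<kappa>)"
  proof (rule bexI[OF _ \<Lambda>_prob], intro conjI ballI)
    fix A assume A: "A \<in> sets borel_nonneg"
    show "emeasure \<Pi>\<^sub>1 {\<eta> \<in> finite_borel_measures. measure \<eta> UNIV \<in> A} = emeasure \<Lambda> A"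
      by (rule law1[OF A])
    then show "emeasure \<Pi>\<^sub>2 {\<eta> \<in> finite_borel_measures. measure \<eta> UNIV \<in> A} = emeasure \<Lambda> A"
      using same[OF borel[OF A]] by simp
  next
    show "enn2ereal (WW2_sq \<Pi>\<^sub>1 \<Pi>\<^sub>2) + ereal (2 * a) * relative_entropy \<Lambda> (law_on_nonneg \<kappa>)
        \<le> ereal a * relative_entropy \<Pi>\<^sub>1 (mixed_binomial \<mu> \<kappa>) + ereal a * relative_entropy \<Pi>\<^sub>2 (mixed_binomial \<mu> \<kappa>)"
    proof (cases "relative_entropy \<Pi>\<^sub>1 B = \<infinity> \<or> relative_entropy \<Pi>\<^sub>2 B = \<infinity>")
      case True
      \<comment> \<open>\<open>relative_entropy\<close> is either real or positive infinity, so no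
        indefinite sum arises and the right side is infinite.\<close>
      moreover have "ereal a * relative_entropy P B \<noteq> -\<infinity>" for P
        using \<open>a > 0\<close> by (simp add: relative_entropy_def)
      ultimately have "ereal a * relative_entropy \<Pi>\<^sub>1 B + ereal a * relative_entropy \<Pi>\<^sub>2 B = \<infinity>"
        using \<open>a > 0\<close> by auto
      then show ?thesis
        unfolding B_def by (simp only: ereal_less_eq(1))
    next
      case False
      obtain F\<^sub>1 where F1: "F\<^sub>1 \<in> borel_measurable B" "\<And>\<eta>. 0 \<le> F\<^sub>1 \<eta>" "\<Pi>\<^sub>1 = density B F\<^sub>1"
        "integrable B (\<lambda>\<eta>. F\<^sub>1 \<eta> * ln (F\<^sub>1 \<eta>))"
        "relative_entropy \<Pi>\<^sub>1 B = ereal (\<integral>\<eta>. F\<^sub>1 \<eta> * ln (F\<^sub>1 \<eta>) \<partial>B)"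
        by (rule relative_entropy_finiteE[OF B.sigma_finite_measure_axioms P1.sigma_finite_measure_axioms sets(1)])
          (use False in auto)
      obtain F\<^sub>2 where F2: "F\<^sub>2 \<in> borel_measurable B" "\<And>\<eta>. 0 \<le> F\<^sub>2 \<eta>" "\<Pi>\<^sub>2 = density B F\<^sub>2"
        "integrable B (\<lambda>\<eta>. F\<^sub>2 \<eta> * ln (F\<^sub>2 \<eta>))"
        "relative_entropy \<Pi>\<^sub>2 B = ereal (\<integral>\<eta>. F\<^sub>2 \<eta> * ln (F\<^sub>2 \<eta>) \<partial>B)"
        by (rule relative_entropy_finiteE[OF B.sigma_finite_measure_axioms P2.sigma_finite_measure_axioms sets(2)])
          (use False in auto)
      have prob: "prob_space (density B F\<^sub>1)" "prob_space (density B F\<^sub>2)"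
        using P1.prob_space_axioms P2.prob_space_axioms F1(3) F2(3) by auto
      note D1 = mixed_binomial_density[OF assms(1) F1(1,2,4)[unfolded B_def] prob(1)[unfolded B_def], folded B_def, folded F1(3)]
      note D2 = mixed_binomial_density[OF assms(1) F2(1,2,4)[unfolded B_def] prob(2)[unfolded B_def], folded B_def, folded F2(3)]
      define m where "m n = (\<integral>x. F\<^sub>1 (sum_dirac n x) \<partial>(\<Pi>\<^sub>M i\<in>UNIV. \<mu>))" for n
      \<comment> \<open>Two densities of one law with respect to \<open>\<kappa>\<close> can be
        compared only where \<open>\<kappa>\<close> has mass: test on \<open>{real n}\<close> and
        cancel \<open>pmf \<kappa> n\<close>.\<close>
      have same_m: "(\<integral>x. F\<^sub>2 (sum_dirac n x) \<partial>(\<Pi>\<^sub>M i\<in>UNIV. \<mu>)) = m n" if "n \<in> set_pmf \<kappa>" for n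
      proof -
        have "(\<integral>\<^sup>+k. ennreal (g k) * indicator {real n} (real k) \<partial>measure_pmf \<kappa>) = ennreal (g n) * ennreal (pmf \<kappa> n)"
          for g :: "nat \<Rightarrow> real"
        proof -
          have "(\<integral>\<^sup>+k. ennreal (g k) * indicator {real n} (real k) \<partial>measure_pmf \<kappa>)
              = (\<integral>\<^sup>+k. ennreal (g n) * indicator {n} k \<partial>measure_pmf \<kappa>)"
            by (intro nn_integral_cong) (auto simp: indicator_def)
          then show ?thesis
            by (simp add: nn_integral_cmult emeasure_pmf_single)
        qed
        then have "ennreal (m n) * ennreal (pmf \<kappa> n)
            = ennreal (\<integral>x. F\<^sub>2 (sum_dirac n x) \<partial>(\<Pi>\<^sub>M i\<in>UNIV. \<mu>)) * ennreal (pmf \<kappa> n)"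
          using D1(9)[of "{real n}"] D2(9)[of "{real n}"] same[of "{real n}"] by (simp add: m_def)
        then have "ennreal (m n) = ennreal (\<integral>x. F\<^sub>2 (sum_dirac n x) \<partial>(\<Pi>\<^sub>M i\<in>UNIV. \<mu>))"
          using that by (subst (asm) (1 2) mult.commute) (auto simp: ennreal_mult_cancel_left pmf_eq_0_set_pmf)
        then show ?thesis
          using D1(4) D2(4) by (simp add: m_def)
      qed
      note W = WW2_sq_density_mixed_binomial_le[OF assms F1(1,2,4)[unfolded B_def] F2(1,2,4)[unfolded B_def]
          prob[unfolded B_def] same_m[unfolded m_def], folded B_def m_def, folded F1(3) F2(3)]
      have "\<Lambda> = distr (density (measure_pmf \<kappa>) m) borel_nonneg real"
      proof (rule measure_eqI)
        fix A assume "A \<in> sets \<Lambda>"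
        then have A: "A \<in> sets borel_nonneg" by (simp add: \<Lambda>_def)
        have "emeasure \<Lambda> A = (\<integral>\<^sup>+n. ennreal (m n) * indicator A (real n) \<partial>measure_pmf \<kappa>)"
          using law1[OF A] D1(9)[OF borel[OF A]] by (simp add: m_def)
        also have "\<dots> = emeasure (distr (density (measure_pmf \<kappa>) m) borel_nonneg real) A"
          using A by (subst emeasure_distr)
            (auto simp: space_restrict_space emeasure_density indicator_def intro!: nn_integral_cong)
        finally show "emeasure \<Lambda> A = emeasure (distr (density (measure_pmf \<kappa>) m) borel_nonneg real) A" .
      qed (simp add: \<Lambda>_def)
      then have ent: "relative_entropy \<Lambda> (law_on_nonneg \<kappa>) = ereal (\<integral>n. m n * ln (m n) \<partial>measure_pmf \<kappa>)"
        using relative_entropy_law_on_nonneg[OF _ W(1)] D1(4) by (simp add: m_def)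
      define X where "X = a * ((\<integral>\<eta>. F\<^sub>1 \<eta> * ln (F\<^sub>1 \<eta>) \<partial>B) + (\<integral>\<eta>. F\<^sub>2 \<eta> * ln (F\<^sub>2 \<eta>) \<partial>B)
        - 2 * (\<integral>n. m n * ln (m n) \<partial>measure_pmf \<kappa>))"
      have "enn2ereal (WW2_sq \<Pi>\<^sub>1 \<Pi>\<^sub>2) \<le> enn2ereal (ennreal X)"
        using W(3) unfolding X_def less_eq_ennreal.rep_eq .
      \<comment> \<open>\<open>X\<close> is nonnegative, hence not truncated by
        \<open>ennreal\<close>.\<close>
      also have "\<dots> = ereal X"
        using W(2) by (simp add: X_def enn2ereal_ennreal)
      finally have "enn2ereal (WW2_sq \<Pi>\<^sub>1 \<Pi>\<^sub>2) + ereal (2 * a * (\<integral>n. m n * ln (m n) \<partial>measure_pmf \<kappa>))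
          \<le> ereal X + ereal (2 * a * (\<integral>n. m n * ln (m n) \<partial>measure_pmf \<kappa>))"
        by (rule add_right_mono)
      also have "\<dots> = ereal (a * (\<integral>\<eta>. F\<^sub>1 \<eta> * ln (F\<^sub>1 \<eta>) \<partial>B) + a * (\<integral>\<eta>. F\<^sub>2 \<eta> * ln (F\<^sub>2 \<eta>) \<partial>B))"
        by (simp add: X_def algebra_simps)
      finally show ?thesis
        by (simp add: ent F1(5) F2(5) flip: B_def)
    qed
  qed
qed

end
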